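(* Let $n\ge2$, $p>1$, $\frac1p+\frac1{p'}=1$, $m=\frac{p-n}{p-1}$, $-m<l\le1-m$, and let $\Omega=\{x\in\mathbb{R}^n:|x|<\varphi(x)\}$ be a bounded domain, star-shaped with respect to a small ball centered at the origin, where $\varphi$ is homogeneous of degree $0$. Put $$K(u)=\int_\Omega\frac{|u|^p}{|x|^{n-m-l}\left|\varphi^{m+l}(x)-|x|^{m+l}\right|^p}dx ,\qquad L(u)=\int_\Omega|x|^{l(1-p)}\left|\frac{\langle x,\nabla u\rangle}{|x|}\right|^pdx,$$ and consider the inequalities $$(A)\quad L(u)^{\frac1p}\ge\frac{m+l}{p'}K(u)^{\frac1p}+\frac1p\limsup_{\varepsilon\to0}\varepsilon^{1-n}\int_{S_\varepsilon}\frac{|u(x)|^p\,dS}{\varphi^{(m+l)(p-1)}(x)}\;K(u)^{-\frac1{p'}},\qquad (B)\quad L(u)\ge\left(\frac{m+l}{p'}\right)^pK(u),$$ where $S_\varepsilon=\{|x|=\varepsilon\}$. Then $(A)$ is an equality for $u=u_k$, $$u_k(x)=\left(\varphi^{m+l}(x)-|x|^{m+l}\right)^k\Phi(x),\qquad k>\frac1{p'},$$ where $\Phi\not\equiv0$ is a homogeneous function of degree $0$. Moreover, the constant $\left(\frac{m+l}{p'}\right)^p$ is optimal for $(B)$ and for $(A)$ (in $(A)$ it enters through its $p$-th root $\frac{m+l}{p'}$) in the class $W^{1,p}_0(|x|^{l(1-p)},\Omega)$.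
   Context: A bounded domain with $C^0$ boundary is star-shaped with respect to a point $x_0\in\Omega$ if every ray starting from $x_0$ intersects $\partial\Omega$ at only one point; it is star-shaped with respect to a ball $B\subset\Omega$ if it is star-shaped with respect to every point of $B$. In this case the positive degree-$0$ homogeneous function $\varphi$ is Lipschitz on the unit sphere. The space $W^{1,p}_0(|x|^{l(1-p)},\Omega)$ is the completion of $C_0^\infty(\Omega)$ with respect to the norm $\left(\int_\Omega|x|^{l(1-p)}|\nabla u|^pdx\right)^{1/p}$. The function $\Phi$ is assumed regular enough for both sides of $(A)$ to be defined and finite at $u_k$ (for instance, Lipschitz on the unit sphere). "Optimal" means: if the constant is replaced by any larger one, the inequality fails for some function of the class. *)

theory Defs
  imports "HOL-Analysis.Analysis"
begin

definition homogeneous0 :: "('a::real_vector \<Rightarrow> real) \<Rightarrow> bool" where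
  "homogeneous0 f \<longleftrightarrow> (\<forall>t>0. \<forall>x. f (t *\<^sub>R x) = f x)"

text \<open>Exactly one intersection point per ray; for bounded \<open>\<Omega>\<close> and \<open>x0 \<in> \<Omega>\<close>
  at least one always exists.\<close>
definition star_shaped_at :: "'a::real_normed_vector set \<Rightarrow> 'a \<Rightarrow> bool" where
  "star_shaped_at \<Omega> x0 \<longleftrightarrow> x0 \<in> \<Omega> \<and>
     (\<forall>v. v \<noteq> 0 \<longrightarrow> (\<exists>!y. y \<in> frontier \<Omega> \<and> y \<in> {x0 + t *\<^sub>R v | t. t \<ge> 0}))"

definition star_shaped_wrt_ball :: "'a::real_normed_vector set \<Rightarrow> 'a set \<Rightarrow> bool" where
  "star_shaped_wrt_ball \<Omega> B \<longleftrightarrow> B \<subseteq> \<Omega> \<and> (\<forall>x0\<in>B. star_shaped_at \<Omega> x0)"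

text \<open>The surface measure \<open>dS\<close> on \<open>{x. norm x = r}\<close>, as a Borel measure on the whole space:
  \<open>\<sigma>\<^sub>r(A) = r\<^sup>n\<^sup>-\<^sup>1 \<sigma>(A / r)\<close>, where the measure \<open>\<sigma>\<close> on the unit sphere is
  \<open>\<sigma>(E) = n \<cdot> |{t \<theta> : 0 < t < 1, \<theta> \<in> E}|\<close>
  (the construction in Folland, Real Analysis, Section 2.7). The origin, which the map below
  sends to itself, is a Lebesgue null set.\<close>
definition sphere_measure :: "real \<Rightarrow> 'a::euclidean_space measure" where
  "sphere_measure r =
     scale_measure (ennreal (real DIM('a) * r ^ (DIM('a) - 1)))
       (distr (restrict_space lborel (ball 0 1)) borel (\<lambda>x. (r / norm x) *\<^sub>R x))"

definition grad :: "('a::real_inner \<Rightarrow> real) \<Rightarrow> 'a \<Rightarrow> 'a" where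
  "grad f x = (THE D. GDERIV f x :> D)"

primrec Ck :: "nat \<Rightarrow> ('a::euclidean_space \<Rightarrow> real) \<Rightarrow> bool" where
  "Ck 0 f \<longleftrightarrow> continuous_on UNIV f"
| "Ck (Suc k) f \<longleftrightarrow> f differentiable_on UNIV \<and> (\<forall>b\<in>Basis. Ck k (\<lambda>x. grad f x \<bullet> b))"

definition test_functions :: "'a::euclidean_space set \<Rightarrow> ('a \<Rightarrow> real) set" where
  "test_functions \<Omega> =
     {\<psi>. (\<forall>k. Ck k \<psi>) \<and> compact (closure {x. \<psi> x \<noteq> 0}) \<and> closure {x. \<psi> x \<noteq> 0} \<subseteq> \<Omega>}"

definition is_weak_gradient :: "'a::euclidean_space set \<Rightarrow> ('a \<Rightarrow> real) \<Rightarrow> ('a \<Rightarrow> 'a) \<Rightarrow> bool" where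
  "is_weak_gradient \<Omega> u g \<longleftrightarrow>
     (\<forall>C. compact C \<and> C \<subseteq> \<Omega> \<longrightarrow> set_integrable lborel C u \<and> set_integrable lborel C g) \<and>
     (\<forall>\<psi>\<in>test_functions \<Omega>. \<forall>b\<in>Basis.
        (LINT x:\<Omega>|lborel. u x * (grad \<psi> x \<bullet> b)) = - (LINT x:\<Omega>|lborel. (g x \<bullet> b) * \<psi> x))"

text \<open>Unique up to Lebesgue null subsets of \<open>\<Omega>\<close> whenever it exists.\<close>
definition weak_grad :: "'a::euclidean_space set \<Rightarrow> ('a \<Rightarrow> real) \<Rightarrow> 'a \<Rightarrow> 'a" where
  "weak_grad \<Omega> u = (SOME g. is_weak_gradient \<Omega> u g)"

text \<open>The completion of \<open>C\<^sub>0\<^sup>\<infinity>(\<Omega>)\<close> in the norm \<open>(\<integral>\<^sub>\<Omega> w |\<nabla>u|\<^sup>p dx)\<^bsup>1/p\<^esup>\<close>, realized as a space of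
  functions: \<open>u\<close> is the \<open>L\<^sup>1(\<Omega>)\<close>-limit of a sequence of test functions that converges to \<open>u\<close> in
  this norm. (For the weights \<open>w = |x|\<^bsup>l(1-p)\<^esup>\<close> considered here and bounded \<open>\<Omega>\<close>, Cauchy sequences
  of test functions do converge in \<open>L\<^sup>1(\<Omega>)\<close>, and the gradient limit is the weak gradient of \<open>u\<close>.)

  Elements of the completion are only classes modulo null sets, while integrals of \<open>u\<close> over
  spheres refer to traces. The sphere condition chooses a representative whose restriction to every
  sphere about the origin is the trace; without it, changing \<open>u\<close> on a null union of
  spheres would change such integrals arbitrarily.\<close>
definition W0 :: "real \<Rightarrow> ('a::euclidean_space \<Rightarrow> real) \<Rightarrow> 'a set \<Rightarrow> ('a \<Rightarrow> real) set" where
  "W0 p w \<Omega> =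
     {u. u \<in> borel_measurable borel \<and> (\<forall>x. x \<notin> \<Omega> \<longrightarrow> u x = 0) \<and>
         (\<exists>g. is_weak_gradient \<Omega> u g) \<and>
         (\<exists>\<psi>. (\<forall>j::nat. \<psi> j \<in> test_functions \<Omega>) \<and>
            (\<lambda>j. \<integral>\<^sup>+x\<in>\<Omega>. ennreal \<bar>\<psi> j x - u x\<bar> \<partial>lborel) \<longlonglongrightarrow> 0 \<and>
            (\<lambda>j. \<integral>\<^sup>+x\<in>\<Omega>. ennreal (w x * norm (grad (\<psi> j) x - weak_grad \<Omega> u x) powr p) \<partial>lborel)
               \<longlonglongrightarrow> 0 \<and>
            (\<forall>r>0. (\<lambda>j. \<integral>\<^sup>+x. ennreal (\<bar>\<psi> j x - u x\<bar> powr p) \<partial>sphere_measure r) \<longlonglongrightarrow> 0))}"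

definition K_integrand ::
  "('a::euclidean_space \<Rightarrow> real) \<Rightarrow> real \<Rightarrow> real \<Rightarrow> real \<Rightarrow> ('a \<Rightarrow> real) \<Rightarrow> 'a \<Rightarrow> real" where
  "K_integrand \<phi> p m l u x =
     \<bar>u x\<bar> powr p /
       (norm x powr (real DIM('a) - m - l) * \<bar>\<phi> x powr (m + l) - norm x powr (m + l)\<bar> powr p)"

definition L_integrand ::
  "'a::euclidean_space set \<Rightarrow> real \<Rightarrow> real \<Rightarrow> ('a \<Rightarrow> real) \<Rightarrow> 'a \<Rightarrow> real" where
  "L_integrand \<Omega> p l u x =
     norm x powr (l * (1 - p)) * \<bar>(x \<bullet> weak_grad \<Omega> u x) / norm x\<bar> powr p"

definition K_fun ::
  "'a::euclidean_space set \<Rightarrow> ('a \<Rightarrow> real) \<Rightarrow> real \<Rightarrow> real \<Rightarrow> real \<Rightarrow> ('a \<Rightarrow> real) \<Rightarrow> real" where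
  "K_fun \<Omega> \<phi> p m l u = (LINT x:\<Omega>|lborel. K_integrand \<phi> p m l u x)"

definition L_fun ::
  "'a::euclidean_space set \<Rightarrow> real \<Rightarrow> real \<Rightarrow> ('a \<Rightarrow> real) \<Rightarrow> real" where
  "L_fun \<Omega> p l u = (LINT x:\<Omega>|lborel. L_integrand \<Omega> p l u x)"

definition KL_finite ::
  "'a::euclidean_space set \<Rightarrow> ('a \<Rightarrow> real) \<Rightarrow> real \<Rightarrow> real \<Rightarrow> real \<Rightarrow> ('a \<Rightarrow> real) \<Rightarrow> bool" where
  "KL_finite \<Omega> \<phi> p m l u \<longleftrightarrow>
     set_integrable lborel \<Omega> (K_integrand \<phi> p m l u) \<and>
     set_integrable lborel \<Omega> (L_integrand \<Omega> p l u)"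

definition sphere_limsup ::
  "('a::euclidean_space \<Rightarrow> real) \<Rightarrow> real \<Rightarrow> real \<Rightarrow> real \<Rightarrow> ('a \<Rightarrow> real) \<Rightarrow> ennreal" where
  "sphere_limsup \<phi> p m l u =
     Limsup (at_right 0) (\<lambda>\<epsilon>. ennreal (\<epsilon> powr (1 - real DIM('a))) *
       (\<integral>\<^sup>+x. ennreal (\<bar>u x\<bar> powr p / \<phi> x powr ((m + l) * (p - 1))) \<partial>sphere_measure \<epsilon>))"

text \<open>Inequality A is \<open>L\<^bsup>1/p\<^esup> \<ge> C\<^bsup>1/p\<^esup> K\<^bsup>1/p\<^esup> + (1/p) limsup(\<dots>) K\<^bsup>-1/p'\<^esup>\<close> and inequality B is \<open>L \<ge> C K\<close>;
  the sharp constant is \<open>C = ((m + l) / p')\<^sup>p\<close> in both. The two sides of A are meaningful when \<open>KL_finite\<close> holds and \<open>K_fun > 0\<close>.\<close>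
definition lhsA :: "'a::euclidean_space set \<Rightarrow> real \<Rightarrow> real \<Rightarrow> ('a \<Rightarrow> real) \<Rightarrow> ereal" where
  "lhsA \<Omega> p l u = ereal (L_fun \<Omega> p l u powr (1 / p))"

definition rhsA ::
  "real \<Rightarrow> 'a::euclidean_space set \<Rightarrow> ('a \<Rightarrow> real) \<Rightarrow> real \<Rightarrow> real \<Rightarrow> real \<Rightarrow> real \<Rightarrow> ('a \<Rightarrow> real) \<Rightarrow> ereal"
  where
  "rhsA C \<Omega> \<phi> p p' m l u =
     ereal (C powr (1 / p) * K_fun \<Omega> \<phi> p m l u powr (1 / p)) +
     ereal (1 / p) * enn2ereal (sphere_limsup \<phi> p m l u) *
       ereal (K_fun \<Omega> \<phi> p m l u powr (- 1 / p'))"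

definition ineqA ::
  "real \<Rightarrow> 'a::euclidean_space set \<Rightarrow> ('a \<Rightarrow> real) \<Rightarrow> real \<Rightarrow> real \<Rightarrow> real \<Rightarrow> real \<Rightarrow> ('a \<Rightarrow> real) \<Rightarrow> bool"
  where
  "ineqA C \<Omega> \<phi> p p' m l u \<longleftrightarrow> lhsA \<Omega> p l u \<ge> rhsA C \<Omega> \<phi> p p' m l u"

definition ineqB ::
  "real \<Rightarrow> 'a::euclidean_space set \<Rightarrow> ('a \<Rightarrow> real) \<Rightarrow> real \<Rightarrow> real \<Rightarrow> real \<Rightarrow> ('a \<Rightarrow> real) \<Rightarrow> bool"
  where
  "ineqB C \<Omega> \<phi> p m l u \<longleftrightarrow> L_fun \<Omega> p l u \<ge> C * K_fun \<Omega> \<phi> p m l u"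

definition u_ext ::
  "('a::euclidean_space \<Rightarrow> real) \<Rightarrow> real \<Rightarrow> real \<Rightarrow> real \<Rightarrow> ('a \<Rightarrow> real) \<Rightarrow> 'a \<Rightarrow> real" where
  "u_ext \<phi> m l k \<Phi> x = (\<phi> x powr (m + l) - norm x powr (m + l)) powr k * \<Phi> x"

text \<open>The regularity of \<open>\<Phi>\<close> that makes both sides of inequality A meaningful at \<open>u\<^sub>k\<close>: \<open>\<nabla>u\<^sub>k\<close> exists as a
  weak gradient, and \<open>\<Phi>\<close> is in \<open>L\<^sup>p\<close> of the unit sphere. It holds for every \<open>\<Phi>\<close> that is Lipschitz on
  the unit sphere, since then \<open>u\<^sub>k\<close> is locally Lipschitz in \<open>\<Omega> - {0}\<close> with gradient
  \<open>O(1/|x| + |x|\<^bsup>m+l-1\<^esup>)\<close> at the origin.\<close>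
definition admissible ::
  "'a::euclidean_space set \<Rightarrow> ('a \<Rightarrow> real) \<Rightarrow> real \<Rightarrow> real \<Rightarrow> real \<Rightarrow> real \<Rightarrow> ('a \<Rightarrow> real) \<Rightarrow> bool" where
  "admissible \<Omega> \<phi> p m l k \<Phi> \<longleftrightarrow>
     \<Phi> \<in> borel_measurable borel \<and>
     (\<integral>\<^sup>+x. ennreal (\<bar>\<Phi> x\<bar> powr p) \<partial>sphere_measure 1) < \<infinity> \<and>
     (\<exists>g. is_weak_gradient \<Omega> (u_ext \<phi> m l k \<Phi>) g)"

end

theory Submission
  imports Defs "HOL-Computational_Algebra.Polynomial"
begin

text \<open>In polar coordinates, with \<open>a = m + l\<close> and \<open>r = |x|\<close>, both functionals decouple into
  one-dimensional integrals along the rays from the origin, since the weights combine to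
  \<open>r\<^bsup>n-1\<^esup> |x|\<^bsup>l(1-p)\<^esup> = r\<^bsup>(p-1)(1-a)\<^esup>\<close> and \<open>r\<^bsup>n-1\<^esup> |x|\<^bsup>a-n\<^esup> = r\<^bsup>a-1\<^esup>\<close>. For \<open>u\<^sub>k\<close> the radial derivative is a multiple
  of \<open>r\<^bsup>a-1\<^esup>(\<phi>\<^sup>a - r\<^sup>a)\<^bsup>k-1\<^esup>\<Phi>\<close>, so that \<open>L\<close>, \<open>K\<close> and the limit over small spheres are explicit multiples of the same
  integral of \<open>|\<Phi>|\<^sup>p \<phi>\<^bsup>a((k-1)p+1)\<^esup>\<close> over the unit sphere.

  For the optimality it suffices to find, for every larger constant, a single test function violating
  (B); it violates (A) as well, because the limsup term is nonnegative. By Stone-Weierstrass there is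
  a smooth homogeneous \<open>Q\<close> slightly below \<open>\<phi>\<close>. Any smooth function of \<open>\<tau> = 1 - (|x|/Q)\<^sup>a\<close> with compact
  support in \<open>(0, 1)\<close> is a test function, and for \<open>\<tau>\<^bsup>1/p'\<^esup> W(- \<epsilon> ln \<tau>)\<close> with a fixed
  bump \<open>W\<close> the quotient of \<open>L\<close> and \<open>K\<close> tends to the claimed constant as \<open>\<epsilon> \<rightarrow> 0\<close> and \<open>Q \<rightarrow> \<phi>\<close>.\<close>

section \<open>Smooth functions\<close>

text \<open>The sharp constant is that of a one-dimensional Hardy inequality at the boundary. With
  \<tau> the normalised gap to the boundary, a function behaving like \<tau>^k has integrands
  behaving like \<tau>^((k - 1) p), which is integrable at \<tau> = 0 exactly when k > 1 / p'. The
  borderline power \<tau>^(1 / p') would be extremal but has infinite integrals, so the minimizing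
  family is this power cut off on a logarithmic scale.

  Two obstacles shape the details. The profile \<phi> is known to be continuous off the origin and
  no more, whereas test functions need iterated gradients of every order on the whole space; so
  \<phi> cannot enter a test function, and the loss from using Q instead is controlled on the
  support, where \<tau> has a positive lower bound. Moreover \<open>u_ext\<close> is only assumed to
  have some weak gradient g, and \<Phi> is only measurable, so no pointwise gradient is available.
  Only the component x \<bullet> g is identified, by integrating along rays, on which
  \<open>u_ext\<close> is smooth.\<close>

lemma GDERIV_unique:
  assumes "GDERIV f x :> D" "GDERIV f x :> D'"
  shows "D = D'"
proof -
  have "(\<lambda>h. inner h D) = (\<lambda>h. inner h D')"
    using assms unfolding gderiv_def by (rule has_derivative_unique)
  then have "inner (D - D') D = inner (D - D') D'" by metis
  then have "inner (D - D') (D - D') = 0" by (simp add: inner_diff_right)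
  then show ?thesis by simp
qed

lemma grad_eqI: "GDERIV f x :> D \<Longrightarrow> grad f x = D"
  unfolding grad_def using GDERIV_unique by blast

lemma GDERIV_local:
  assumes "GDERIV f x :> D" "open S" "x \<in> S" "\<And>y. y \<in> S \<Longrightarrow> f y = g y"
  shows "GDERIV g x :> D"
  using assms unfolding gderiv_def by (metis has_derivative_transform_within_open)

lemma differentiable_GDERIV_grad:
  fixes f :: "'a::euclidean_space \<Rightarrow> real"
  assumes "f differentiable (at x)"
  shows "GDERIV f x :> grad f x"
proof -
  obtain f' where f': "(f has_derivative f') (at x)" using assms by (auto simp: differentiable_def)
  interpret bounded_linear f' using f' by (rule has_derivative_bounded_linear)
  define D where "D = (\<Sum>b\<in>Basis. f' b *\<^sub>R b)"
  have "f' h = inner h D" for h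
  proof -
    have "f' h = f' (\<Sum>b\<in>Basis. (h \<bullet> b) *\<^sub>R b)" by (simp add: euclidean_representation)
    also have "\<dots> = (\<Sum>b\<in>Basis. (h \<bullet> b) * f' b)" by (simp add: sum scaleR)
    also have "\<dots> = inner h D" by (simp add: D_def inner_sum_right mult.commute)
    finally show ?thesis .
  qed
  then have "f' = (\<lambda>h. inner h D)" by auto
  then have "GDERIV f x :> D" using f' by (simp add: gderiv_def)
  then show ?thesis using grad_eqI by metis
qed

lemma GDERIV_ray:
  assumes "GDERIV f (t *\<^sub>R y) :> D"
  shows "((\<lambda>s. f (s *\<^sub>R y)) has_real_derivative (y \<bullet> D)) (at t)"
proof -
  have "((\<lambda>s. f (s *\<^sub>R y)) has_derivative (\<lambda>h. (h *\<^sub>R y) \<bullet> D)) (at t)"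
    using assms unfolding gderiv_def
    by (rule has_derivative_compose[rotated]) (auto intro!: derivative_eq_intros)
  then show ?thesis unfolding has_field_derivative_def by (rule has_derivative_subst) (auto simp: mult.commute)
qed

text \<open>\<open>Ck\<close> is defined by iterated gradients, so instead of analytic smoothness a
  class of formulas is used that contains the partial derivatives of its members on
  \<open>S\<close>. Rule \<open>comp\<close> carries a whole sequence \<open>H\<close> of successive
  derivatives, so that the outer derivative \<open>H (Suc i)\<close> is again available;
  \<open>ln\<close> is the only partial operation, hence the parameter \<open>S\<close>.\<close>

inductive_set smooth_terms :: "'a::euclidean_space set \<Rightarrow> ('a \<Rightarrow> real) set" for S where
  const: "(\<lambda>x. c) \<in> smooth_terms S"
| inner: "(\<lambda>x. x \<bullet> b) \<in> smooth_terms S"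
| add: "f \<in> smooth_terms S \<Longrightarrow> g \<in> smooth_terms S \<Longrightarrow> (\<lambda>x. f x + g x) \<in> smooth_terms S"
| mult: "f \<in> smooth_terms S \<Longrightarrow> g \<in> smooth_terms S \<Longrightarrow> (\<lambda>x. f x * g x) \<in> smooth_terms S"
| ln: "f \<in> smooth_terms S \<Longrightarrow> (\<And>x. x \<in> S \<Longrightarrow> f x > 0) \<Longrightarrow> (\<lambda>x. ln (f x)) \<in> smooth_terms S"
| comp: "f \<in> smooth_terms S \<Longrightarrow>
    (\<And>i t. (H i has_real_derivative H (Suc i) t) (at t)) \<Longrightarrow> (\<lambda>x. H (i::nat) (f x)) \<in> smooth_terms S"

lemma smooth_terms_exp: "f \<in> smooth_terms S \<Longrightarrow> (\<lambda>x. exp (f x)) \<in> smooth_terms S"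
  by (rule smooth_terms.comp[where H="\<lambda>i. exp"]) auto

lemma smooth_terms_minus: "f \<in> smooth_terms S \<Longrightarrow> (\<lambda>x. - f x) \<in> smooth_terms S"
  using smooth_terms.mult[OF smooth_terms.const[of "-1"], of f S] by simp

lemma smooth_terms_diff:
  "f \<in> smooth_terms S \<Longrightarrow> g \<in> smooth_terms S \<Longrightarrow> (\<lambda>x. f x - g x) \<in> smooth_terms S"
  using smooth_terms.add[OF _ smooth_terms_minus, of f S g] by simp

lemma smooth_terms_sum:
  "finite I \<Longrightarrow> (\<And>i. i \<in> I \<Longrightarrow> f i \<in> smooth_terms S) \<Longrightarrow> (\<lambda>x. \<Sum>i\<in>I. f i x) \<in> smooth_terms S"
  by (induction I rule: finite_induct) (auto intro: smooth_terms.const smooth_terms.add)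

lemma smooth_terms_prod:
  "finite I \<Longrightarrow> (\<And>i. i \<in> I \<Longrightarrow> f i \<in> smooth_terms S) \<Longrightarrow> (\<lambda>x. \<Prod>i\<in>I. f i x) \<in> smooth_terms S"
  by (induction I rule: finite_induct) (auto intro: smooth_terms.const smooth_terms.mult)

lemma smooth_terms_GDERIV:
  assumes "f \<in> smooth_terms S"
  shows "\<exists>g. (\<forall>b. (\<lambda>x. g x \<bullet> b) \<in> smooth_terms S) \<and> (\<forall>x\<in>S. GDERIV f x :> g x)"
  using assms
proof induction
  case (const c)
  show ?case
    by (rule exI[of _ "\<lambda>x. 0"]) (auto intro: smooth_terms.const GDERIV_const)
next
  case (inner b)
  have "GDERIV (\<lambda>x. x \<bullet> b) x :> b" for x
    unfolding gderiv_def by (auto intro!: derivative_eq_intros)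
  then show ?case
    by (intro exI[of _ "\<lambda>x. b"]) (auto intro: smooth_terms.const)
next
  case (add f1 f2)
  then obtain g1 g2 where
    "\<And>b. (\<lambda>x. g1 x \<bullet> b) \<in> smooth_terms S" "\<And>x. x\<in>S \<Longrightarrow> GDERIV f1 x :> g1 x"
    "\<And>b. (\<lambda>x. g2 x \<bullet> b) \<in> smooth_terms S" "\<And>x. x\<in>S \<Longrightarrow> GDERIV f2 x :> g2 x" by metis
  then show ?case
    by (intro exI[of _ "\<lambda>x. g1 x + g2 x"])
       (auto simp: inner_add_left intro: smooth_terms.add GDERIV_add)
next
  case (mult f1 f2)
  then obtain g1 g2 where g:
    "\<And>b. (\<lambda>x. g1 x \<bullet> b) \<in> smooth_terms S" "\<And>x. x\<in>S \<Longrightarrow> GDERIV f1 x :> g1 x"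
    "\<And>b. (\<lambda>x. g2 x \<bullet> b) \<in> smooth_terms S" "\<And>x. x\<in>S \<Longrightarrow> GDERIV f2 x :> g2 x" by metis
  note * = smooth_terms.add[OF smooth_terms.mult[OF mult.hyps(1) g(3)]
      smooth_terms.mult[OF mult.hyps(2) g(1)]]
  show ?case using * g(2,4)
    by (intro exI[of _ "\<lambda>x. f1 x *\<^sub>R g2 x + f2 x *\<^sub>R g1 x"])
       (auto simp: inner_add_left intro: GDERIV_mult)
next
  case (ln f)
  then obtain g where g: "\<And>b. (\<lambda>x. g x \<bullet> b) \<in> smooth_terms S" "\<And>x. x\<in>S \<Longrightarrow> GDERIV f x :> g x"
    by metis
  \<comment> \<open>The class has no division, so 1 / f is written as exp (- ln f).\<close>
  have 1: "GDERIV (\<lambda>x. ln (f x)) x :> exp (- ln (f x)) *\<^sub>R g x" if "x \<in> S" for x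
  proof -
    have "(ln has_real_derivative exp (- ln (f x))) (at (f x))"
      using ln.hyps(2)[OF that] by (auto intro!: derivative_eq_intros simp: exp_minus inverse_eq_divide)
    then show ?thesis using GDERIV_DERIV_compose g(2)[OF that] by blast
  qed
  have "(\<lambda>x. exp (- ln (f x))) \<in> smooth_terms S"
    using ln.hyps by (intro smooth_terms_exp smooth_terms_minus smooth_terms.ln)
  then show ?case using g 1
    by (intro exI[of _ "\<lambda>x. exp (- ln (f x)) *\<^sub>R g x"]) (auto intro: smooth_terms.mult)
next
  case (comp f H i)
  then obtain g where g: "\<And>b. (\<lambda>x. g x \<bullet> b) \<in> smooth_terms S" "\<And>x. x\<in>S \<Longrightarrow> GDERIV f x :> g x"
    by metis
  have "(\<lambda>x. H (Suc i) (f x)) \<in> smooth_terms S"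
    using comp.hyps by (rule smooth_terms.comp[where H=H])
  note * = smooth_terms.mult[OF this g(1)]
  have "GDERIV (\<lambda>x. H i (f x)) x :> H (Suc i) (f x) *\<^sub>R g x" if "x \<in> S" for x
    by (rule GDERIV_DERIV_compose[OF g(2)[OF that] comp.hyps(2)])
  then show ?case using *
    by (intro exI[of _ "\<lambda>x. H (Suc i) (f x) *\<^sub>R g x"]) auto
qed

text \<open>The open sets \<open>S\<close> and \<open>- C\<close> cover the space; on the first
  \<open>f\<close> is \<open>g\<close>, on the second it is zero, and on the overlap uniqueness of
  the gradient forces \<open>D\<close> to vanish. The gradient is thus supported in \<open>C\<close>
  again, which is what an induction on the order of differentiability needs.\<close>

lemma GDERIV_extend_zero:
  assumes "\<And>x. x \<in> S \<Longrightarrow> GDERIV g x :> D x" "open S" "closed C" "C \<subseteq> S"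
    and "\<And>x. x \<in> S \<Longrightarrow> f x = g x" "\<And>x. x \<notin> C \<Longrightarrow> f x = 0"
  shows "GDERIV f x :> (if x \<in> S then D x else 0)" and "x \<notin> C \<Longrightarrow> (if x \<in> S then D x else 0) = 0"
proof -
  have 1: "GDERIV f x :> D x" if "x \<in> S" for x
    using GDERIV_local[OF assms(1)[OF that] assms(2) that] assms(5) by metis
  have 0: "GDERIV f x :> 0" if "x \<notin> C" for x
    using GDERIV_local[OF GDERIV_const[of 0 x], of "- C" f] assms(3,6) that
    by (auto simp: open_Compl)
  show "GDERIV f x :> (if x \<in> S then D x else 0)"
    using 1 0 assms(4) by auto
  show "(if x \<in> S then D x else 0) = 0" if "x \<notin> C"
    using GDERIV_unique[OF 1 0[OF that]] by auto
qed

text \<open>The pair \<open>S\<close>, \<open>C\<close> survives differentiation: each gradient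
  component agrees on \<open>S\<close> with a term of the class and vanishes off \<open>C\<close>,
  so the induction hypothesis applies to it. This is how a formula that makes sense on
  \<open>S\<close> only yields a function smooth on the whole space.\<close>

lemma Ck_smooth_terms:
  fixes f :: "'a::euclidean_space \<Rightarrow> real"
  assumes "open S" "closed C" "C \<subseteq> S"
    and "g \<in> smooth_terms S" "\<And>x. x \<in> S \<Longrightarrow> f x = g x" "\<And>x. x \<notin> C \<Longrightarrow> f x = 0"
  shows "Ck k f"
  using assms(4-)
proof (induction k arbitrary: f g)
  case (0 f g)
  obtain D where D: "\<And>x. x\<in>S \<Longrightarrow> GDERIV g x :> D x"
    using smooth_terms_GDERIV[OF 0(1)] by metis
  have "GDERIV f x :> (if x \<in> S then D x else 0)" for x
    by (rule GDERIV_extend_zero[OF D assms(1-3) 0(2,3)])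
  then have "continuous_on UNIV f"
    unfolding gderiv_def by (meson continuous_at_imp_continuous_on has_derivative_continuous)
  then show ?case by simp
next
  case (Suc k f g)
  obtain D where D: "\<And>b. (\<lambda>x. D x \<bullet> b) \<in> smooth_terms S" "\<And>x. x\<in>S \<Longrightarrow> GDERIV g x :> D x"
    using smooth_terms_GDERIV[OF Suc(2)] by metis
  have G: "GDERIV f x :> (if x \<in> S then D x else 0)" for x
    by (rule GDERIV_extend_zero[OF D(2) assms(1-3) Suc(3,4)])
  have G0: "x \<notin> C \<Longrightarrow> (if x \<in> S then D x else 0) = 0" for x
    by (rule GDERIV_extend_zero[OF D(2) assms(1-3) Suc(3,4)])
  have gr: "grad f x = (if x \<in> S then D x else 0)" for x
    using G by (rule grad_eqI)
  have "f differentiable_on UNIV"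
    using G unfolding gderiv_def differentiable_on_def differentiable_def by blast
  moreover have "Ck k (\<lambda>x. grad f x \<bullet> b)" for b
    by (rule Suc(1)[OF D(1)[of b]]) (use gr G0 in auto)
  ultimately show ?case by simp
qed

lemma test_functions_smooth_terms:
  fixes f :: "'a::euclidean_space \<Rightarrow> real"
  assumes "open S" "compact C" "C \<subseteq> S" "C \<subseteq> \<Omega>"
    and "g \<in> smooth_terms S" "\<And>x. x \<in> S \<Longrightarrow> f x = g x" "\<And>x. x \<notin> C \<Longrightarrow> f x = 0"
  shows "f \<in> test_functions \<Omega>"
proof -
  have *: "closure {x. f x \<noteq> 0} \<subseteq> C"
    using assms(7) by (intro closure_minimal compact_imp_closed[OF assms(2)]) auto
  then have "compact (closure {x. f x \<noteq> 0})"
    using compact_Int_closed[OF assms(2) closed_closure, of "{x. f x \<noteq> 0}"] by (simp add: Int_absorb1)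
  moreover have "Ck k f" for k
    by (rule Ck_smooth_terms[OF assms(1) compact_imp_closed[OF assms(2)] assms(3,5-7)])
  ultimately show ?thesis unfolding test_functions_def
    using * assms(4) by simp
qed

text \<open>With s = 1 / t, differentiating P(s) exp (- s) in t gives s^2 (P(s) - P'(s)) exp (- s),
  since ds/dt = - s^2; this is the recursion.\<close>

fun flat_poly :: "nat \<Rightarrow> real poly" where
  "flat_poly 0 = 1"
| "flat_poly (Suc i) = [:0, 0, 1:] * (flat_poly i - pderiv (flat_poly i))"

text \<open>The \<open>i\<close>-th derivative of the function \<open>exp (- 1 / t)\<close>, extended by \<open>0\<close> to \<open>t \<le> 0\<close>.\<close>
definition flat :: "nat \<Rightarrow> real \<Rightarrow> real" where
  "flat i t = (if t \<le> 0 then 0 else poly (flat_poly i) (1 / t) * exp (- (1 / t)))"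

lemma poly_times_exp_minus_tendsto_0:
  "((\<lambda>s. poly q s * exp (- s)) \<longlongrightarrow> (0::real)) at_top"
proof -
  have "((\<lambda>s. \<Sum>i\<le>degree q. coeff q i * (s ^ i / exp s)) \<longlongrightarrow> (\<Sum>i\<le>degree q. coeff q i * 0)) at_top"
    by (intro tendsto_intros tendsto_power_div_exp_0)
  then show ?thesis
    by (simp add: poly_altdef exp_minus inverse_eq_divide flip: sum_divide_distrib)
qed

lemma DERIV_flat: "(flat i has_real_derivative flat (Suc i) t) (at t)"
proof -
  consider "t < 0" | "t > 0" | "t = 0" by linarith
  then show ?thesis
  proof cases
    case 1
    have "((\<lambda>t. 0) has_real_derivative 0) (at t)" by simp
    then have "(flat i has_real_derivative 0) (at t)"
      by (rule DERIV_cong_ev[THEN iffD1, rotated 3, OF _ refl _ refl])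
         (use 1 eventually_nhds_in_open[of "{..<0}" t] in \<open>auto elim!: eventually_mono simp: flat_def\<close>)
    then show ?thesis using 1 by (simp add: flat_def)
  next
    case 2
    have "((\<lambda>t. poly (flat_poly i) (1 / t) * exp (- (1 / t))) has_real_derivative flat (Suc i) t) (at t)"
      using 2 by (auto intro!: derivative_eq_intros DERIV_chain2[OF poly_DERIV] simp: flat_def power2_eq_square field_simps)
    then show ?thesis
      by (rule DERIV_cong_ev[THEN iffD1, rotated 3, OF _ refl _ refl])
         (use 2 eventually_nhds_in_open[of "{0<..}" t] in \<open>auto elim!: eventually_mono simp: flat_def\<close>)
  next
    case 3
    \<comment> \<open>At the origin the difference quotient is flat i t / t = s P(s) exp (- s) with
      s = 1 / t, and the exponential beats every polynomial as s tends to infinity.\<close>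
    have "((\<lambda>t. poly ([:0, 1:] * flat_poly i) (inverse t) * exp (- inverse t)) \<longlongrightarrow> 0) (at_right 0)"
      by (rule filterlim_compose[OF poly_times_exp_minus_tendsto_0 filterlim_inverse_at_top_right])
    then have "((\<lambda>t. flat i t / t) \<longlongrightarrow> 0) (at_right 0)"
      by (rule Lim_transform_eventually)
         (use eventually_at_right_less[of 0] in \<open>auto elim!: eventually_mono simp: flat_def field_simps\<close>)
    moreover have "((\<lambda>t. flat i t / t) \<longlongrightarrow> 0) (at_left 0)"
      by (rule tendsto_eventually)
         (auto simp: eventually_at_filter flat_def)
    ultimately have "((\<lambda>t. flat i t / t) \<longlongrightarrow> 0) (at 0)"
      by (simp add: filterlim_split_at)
    then show ?thesis using 3 by (simp add: has_field_derivative_iff flat_def)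
  qed
qed

lemma smooth_terms_flat: "f \<in> smooth_terms S \<Longrightarrow> (\<lambda>x. flat i (f x)) \<in> smooth_terms S"
  by (rule smooth_terms.comp[where H=flat]) (auto intro: DERIV_flat)

lemma continuous_on_flat: "continuous_on A (flat i)"
  using DERIV_flat[THEN DERIV_isCont] by (simp add: continuous_at_imp_continuous_on)

lemma flat_0_bounds: "0 \<le> flat 0 t" "flat 0 t \<le> 1" "t > 0 \<Longrightarrow> 0 < flat 0 t" "t \<le> 0 \<Longrightarrow> flat i t = 0"
  by (auto simp: flat_def)

lemma flat_0_scale_tendsto: "(\<lambda>j. flat 0 (real (Suc j) * t)) \<longlonglongrightarrow> (if t > 0 then 1 else 0)"
proof (cases "t > 0")
  case True
  have "(\<lambda>j. exp (- (1 / t * (1 / real (Suc j))))) \<longlonglongrightarrow> exp (- (1 / t * 0))"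
    by (intro tendsto_intros LIMSEQ_Suc[OF lim_1_over_n])
  moreover have "flat 0 (real (Suc j) * t) = exp (- (1 / t * (1 / real (Suc j))))" for j
  proof -
    have "real (Suc j) * t > 0" using True by simp
    then show ?thesis unfolding flat_def by (simp add: field_simps)
  qed
  ultimately show ?thesis using True by simp
next
  case False
  then show ?thesis by (simp add: flat_def mult_le_0_iff mult_nonneg_nonpos)
qed

section \<open>Weak gradients\<close>

lemma test_functionsD:
  assumes "\<psi> \<in> test_functions \<Omega>"
  shows "GDERIV \<psi> x :> grad \<psi> x" "continuous_on UNIV \<psi>" "continuous_on UNIV (grad \<psi>)"
    and "\<exists>C. compact C \<and> C \<subseteq> \<Omega> \<and> (\<forall>x. x \<notin> C \<longrightarrow> \<psi> x = 0 \<and> grad \<psi> x = 0)"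
proof -
  have Ck: "Ck (Suc 0) \<psi>" and C: "compact (closure {x. \<psi> x \<noteq> 0})" "closure {x. \<psi> x \<noteq> 0} \<subseteq> \<Omega>"
    using assms unfolding test_functions_def by blast+
  show G: "GDERIV \<psi> x :> grad \<psi> x" for x
    using Ck by (intro differentiable_GDERIV_grad) (simp add: differentiable_on_def)
  show "continuous_on UNIV \<psi>"
    using Ck by (auto intro: differentiable_imp_continuous_on)
  show "continuous_on UNIV (grad \<psi>)"
    using Ck by (subst continuous_on_componentwise) simp
  have "grad \<psi> x = 0" if "x \<notin> closure {x. \<psi> x \<noteq> 0}" for x
  proof -
    have "GDERIV \<psi> x :> 0"
      by (rule GDERIV_local[OF GDERIV_const[of 0], of "- closure {x. \<psi> x \<noteq> 0}"])
         (use that closure_subset[of "{x. \<psi> x \<noteq> 0}"] in auto)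
    then show ?thesis by (rule grad_eqI)
  qed
  then show "\<exists>C. compact C \<and> C \<subseteq> \<Omega> \<and> (\<forall>x. x \<notin> C \<longrightarrow> \<psi> x = 0 \<and> grad \<psi> x = 0)"
    using C closure_subset[of "{x. \<psi> x \<noteq> 0}"]
    by (intro exI[of _ "closure {x. \<psi> x \<noteq> 0}"]) auto
qed

text \<open>Nothing is known about \<open>h\<close> off \<open>C\<close>, not even measurability.
  The factor \<eta> vanishes there, so the product is \<eta> times the integrable function
  \<open>indicat_real C x *\<^sub>R h x\<close>, and the bound of \<eta> on \<open>C\<close>
  dominates it.\<close>

lemma set_integrable_mult_compact_support:
  fixes h \<eta> :: "'a::euclidean_space \<Rightarrow> real"
  assumes h: "set_integrable lborel C h" and C: "compact C" "C \<subseteq> \<Omega>"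
    and \<eta>: "continuous_on C \<eta>" "\<eta> \<in> borel_measurable borel" "\<And>x. x \<notin> C \<Longrightarrow> \<eta> x = 0"
  shows "set_integrable lborel \<Omega> (\<lambda>x. h x * \<eta> x)" "integrable lborel (\<lambda>x. h x * \<eta> x)"
proof -
  obtain B where B: "\<And>x. x \<in> C \<Longrightarrow> norm (\<eta> x) \<le> B"
    using compact_imp_bounded[OF compact_continuous_image[OF \<eta>(1) C(1)]] unfolding bounded_iff by auto
  have "integrable lborel (\<lambda>x. \<eta> x * (indicat_real C x *\<^sub>R h x))"
  proof (rule Bochner_Integration.integrable_bound)
    show "integrable lborel (\<lambda>x. B * (indicat_real C x *\<^sub>R h x))"
      using h unfolding set_integrable_def by (intro integrable_mult_right) auto
    show "(\<lambda>x. \<eta> x * (indicat_real C x *\<^sub>R h x)) \<in> borel_measurable lborel"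
      using h[unfolded set_integrable_def, THEN borel_measurable_integrable] \<eta>(2) by measurable
    show "AE x in lborel. norm (\<eta> x * (indicat_real C x *\<^sub>R h x)) \<le> norm (B * (indicat_real C x *\<^sub>R h x))"
    proof (rule AE_I2)
      fix x
      show "norm (\<eta> x * (indicat_real C x *\<^sub>R h x)) \<le> norm (B * (indicat_real C x *\<^sub>R h x))"
        using B[of x] by (cases "x \<in> C") (auto simp: abs_mult intro!: mult_right_mono)
    qed
  qed
  moreover have "(\<lambda>x. \<eta> x * (indicat_real C x *\<^sub>R h x)) = (\<lambda>x. indicat_real \<Omega> x *\<^sub>R (h x * \<eta> x))"
    using \<eta>(3) C(2) by (fastforce simp: indicator_def)
  moreover have "(\<lambda>x. \<eta> x * (indicat_real C x *\<^sub>R h x)) = (\<lambda>x. h x * \<eta> x)"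
    using \<eta>(3) C(2) by (fastforce simp: indicator_def)
  ultimately show "set_integrable lborel \<Omega> (\<lambda>x. h x * \<eta> x)" "integrable lborel (\<lambda>x. h x * \<eta> x)"
    by (simp_all add: set_integrable_def)
qed

lemma set_integral_eq_integral_support:
  fixes f :: "'a \<Rightarrow> real"
  assumes "\<And>x. x \<notin> \<Omega> \<Longrightarrow> f x = 0"
  shows "(LINT x:\<Omega>|M. f x) = integral\<^sup>L M f"
  unfolding set_lebesgue_integral_def
  by (rule Bochner_Integration.integral_cong) (use assms in \<open>auto simp: indicator_def\<close>)

text \<open>Translation invariance of Lebesgue measure makes the integral of every difference
  quotient in direction \<open>b\<close> zero. The mean value theorem bounds the quotients by a
  bound of the derivative, and dominated convergence passes to the limit.\<close>

lemma integral_partial_derivative_zero: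
  fixes f :: "'a::euclidean_space \<Rightarrow> real"
  assumes D: "\<And>x. GDERIV f x :> D x" and cont: "continuous_on UNIV (\<lambda>x. D x \<bullet> b)"
    and C: "compact C" "\<And>x. x \<notin> C \<Longrightarrow> f x = 0" "\<And>x. x \<notin> C \<Longrightarrow> D x = 0"
  shows "(LINT x|lborel. D x \<bullet> b) = 0"
proof -
  have cf: "continuous_on UNIV f"
    using D unfolding gderiv_def by (meson continuous_at_imp_continuous_on has_derivative_continuous)
  obtain M0 where M0: "\<And>x. x \<in> C \<Longrightarrow> norm (D x \<bullet> b) \<le> M0"
    using compact_imp_bounded[OF compact_continuous_image[OF continuous_on_subset[OF cont subset_UNIV] C(1)]]
    unfolding bounded_iff by auto
  define M where "M = max M0 0"
  have M: "\<bar>D x \<bullet> b\<bar> \<le> M" for x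
    using M0[of x] C(3)[of x] by (cases "x \<in> C") (auto simp: M_def)
  obtain R where R: "\<And>x. x \<in> C \<Longrightarrow> norm x \<le> R"
    using compact_imp_bounded[OF C(1)] unfolding bounded_iff by auto
  define t where "t j = 1 / real (Suc j)" for j
  have t: "0 < t j" "t j \<le> 1" for j by (auto simp: t_def)
  define q where "q j x = (f (x + t j *\<^sub>R b) - f x) / t j" for j x
  have dline: "((\<lambda>s. f (x + s *\<^sub>R b)) has_real_derivative (D (x + s *\<^sub>R b) \<bullet> b)) (at s)" for x s
  proof -
    have "((\<lambda>s. f (x + s *\<^sub>R b)) has_derivative (\<lambda>h. (h *\<^sub>R b) \<bullet> D (x + s *\<^sub>R b))) (at s)"
      using D[of "x + s *\<^sub>R b"] unfolding gderiv_def
      by (rule has_derivative_compose[rotated]) (auto intro!: derivative_eq_intros)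
    then show ?thesis unfolding has_field_derivative_def
      by (rule has_derivative_subst) (auto simp: mult.commute inner_commute)
  qed
  have qM: "\<bar>q j x\<bar> \<le> M" for j x
  proof -
    obtain z where "f (x + t j *\<^sub>R b) - f (x + 0 *\<^sub>R b) = (t j - 0) * (D (x + z *\<^sub>R b) \<bullet> b)"
      using MVT2[OF t(1)[of j], of "\<lambda>s. f (x + s *\<^sub>R b)" "\<lambda>s. D (x + s *\<^sub>R b) \<bullet> b"] dline by blast
    then have "q j x = D (x + z *\<^sub>R b) \<bullet> b" using t(1)[of j] by (simp add: q_def)
    then show ?thesis using M by simp
  qed
  \<comment> \<open>Since \<open>t j \<le> 1\<close>, the shift by \<open>t j *\<^sub>R b\<close>
    moves points by at most \<open>norm b\<close>; outside the enlarged ball both values of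
    \<open>f\<close> vanish.\<close>
  have q0: "q j x = 0" if "x \<notin> cball 0 (R + norm b)" for j x
  proof -
    have x: "norm x > R + norm b" using that by simp
    then have "norm x > R" using norm_ge_zero[of b] by linarith
    moreover have "norm (x + t j *\<^sub>R b) > R"
    proof -
      have "norm (t j *\<^sub>R b) \<le> norm b" using t[of j] by (simp add: mult_left_le_one_le)
      then show ?thesis using x norm_diff_ineq[of x "t j *\<^sub>R b"] by linarith
    qed
    ultimately have "x \<notin> C" "x + t j *\<^sub>R b \<notin> C" using R not_less by blast+
    then show ?thesis using C(2) unfolding q_def by simp
  qed
  have fi: "integrable lborel f"
  proof -
    have "integrable lborel (\<lambda>x. indicator C x *\<^sub>R f x)"
      using borel_integrable_compact[OF C(1) continuous_on_subset[OF cf]] by simp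
    moreover have "(\<lambda>x. indicator C x *\<^sub>R f x) = f" using C(2) by (auto simp: indicator_def fun_eq_iff)
    ultimately show ?thesis by simp
  qed
  have fm[measurable]: "f \<in> borel_measurable borel"
    using cf by (rule borel_measurable_continuous_onI)
  have tr: "integrable lborel (\<lambda>x. f (x + c))" "(LINT x|lborel. f (x + c)) = integral\<^sup>L lborel f" for c
  proof -
    have "integrable (distr lborel borel ((+) c)) f" using fi by (simp add: lborel_distr_plus)
    then show "integrable lborel (\<lambda>x. f (x + c))"
      by (subst (asm) integrable_distr_eq) (auto simp: add.commute)
    have "integral\<^sup>L lborel f = integral\<^sup>L (distr lborel borel ((+) c)) f" by (simp add: lborel_distr_plus)
    then show "(LINT x|lborel. f (x + c)) = integral\<^sup>L lborel f"
      by (subst (asm) integral_distr) (auto simp: add.commute)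
  qed
  have qi: "(LINT x|lborel. q j x) = 0" for j
    unfolding q_def using tr[of "t j *\<^sub>R b"] fi by (simp add: Bochner_Integration.integral_diff)
  have "(\<lambda>j. LINT x|lborel. q j x) \<longlonglongrightarrow> (LINT x|lborel. D x \<bullet> b)"
  proof (rule integral_dominated_convergence[where w="\<lambda>x. indicator (cball 0 (R + norm b)) x *\<^sub>R M"])
    show "(\<lambda>x. D x \<bullet> b) \<in> borel_measurable lborel"
      using borel_measurable_continuous_onI[OF cont] by simp
    show "q j \<in> borel_measurable lborel" for j unfolding q_def by simp
    show "integrable lborel (\<lambda>x::'a. indicator (cball 0 (R + norm b)) x *\<^sub>R M)"
      by (intro borel_integrable_compact) auto
    show "AE x in lborel. norm (q j x) \<le> indicator (cball 0 (R + norm b)) x *\<^sub>R M" for j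
      using qM q0 by (intro AE_I2) (auto simp: indicator_def)
    show "AE x in lborel. (\<lambda>j. q j x) \<longlonglongrightarrow> D x \<bullet> b"
    proof (rule AE_I2)
      fix x
      have "((\<lambda>s. (f (x + s *\<^sub>R b) - f x) / s) \<longlongrightarrow> D x \<bullet> b) (at 0)"
        using dline[of x 0] by (simp add: DERIV_def)
      moreover have "filterlim t (at 0) sequentially"
        unfolding filterlim_at t_def using LIMSEQ_Suc[OF lim_1_over_n[where 'a=real]] by simp
      ultimately show "(\<lambda>j. q j x) \<longlonglongrightarrow> D x \<bullet> b"
        unfolding q_def by (rule filterlim_compose)
    qed
  qed
  then show ?thesis using qi by (simp add: LIMSEQ_const_iff)
qed

text \<open>The product u \<psi> has compact support, so the integral of its partial derivative
  vanishes, and the product rule turns this into integration by parts.\<close>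

lemma is_weak_gradient_test_function:
  assumes u: "u \<in> test_functions \<Omega>"
  shows "is_weak_gradient \<Omega> u (grad u)"
  unfolding is_weak_gradient_def
proof (intro conjI allI impI ballI)
  fix C :: "'a set" assume C: "compact C \<and> C \<subseteq> \<Omega>"
  show "set_integrable lborel C u" "set_integrable lborel C (grad u)"
    unfolding set_integrable_def using C continuous_on_subset[OF test_functionsD(2)[OF u]]
      continuous_on_subset[OF test_functionsD(3)[OF u]]
    by (intro borel_integrable_compact; simp)+
next
  fix \<psi> and b :: 'a assume \<psi>: "\<psi> \<in> test_functions \<Omega>" and b: "b \<in> Basis"
  note cu = test_functionsD(2,3)[OF u] and c\<psi> = test_functionsD(2,3)[OF \<psi>]
  obtain C where C: "compact C" "C \<subseteq> \<Omega>" "\<And>x. x \<notin> C \<Longrightarrow> u x = 0 \<and> grad u x = 0"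
    using test_functionsD(4)[OF u] by blast
  have int: "integrable lborel f"
    if "continuous_on UNIV f" "\<And>x. x \<notin> C \<Longrightarrow> f x = 0" for f :: "'a \<Rightarrow> real"
  proof -
    have "integrable lborel (\<lambda>x. indicator C x *\<^sub>R f x)"
      using borel_integrable_compact[OF C(1) continuous_on_subset[OF that(1)]] by simp
    moreover have "(\<lambda>x. indicator C x *\<^sub>R f x) = f" using that(2) by (auto simp: indicator_def fun_eq_iff)
    ultimately show ?thesis by simp
  qed
  have "(LINT x|lborel. (u x *\<^sub>R grad \<psi> x + \<psi> x *\<^sub>R grad u x) \<bullet> b) = 0"
    by (rule integral_partial_derivative_zero[OF GDERIV_mult _ C(1)])
       (use C test_functionsD(1)[OF u] test_functionsD(1)[OF \<psi>] in
         \<open>auto intro!: continuous_intros cu c\<psi>\<close>)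
  moreover have "(LINT x|lborel. (u x *\<^sub>R grad \<psi> x + \<psi> x *\<^sub>R grad u x) \<bullet> b) =
      (LINT x|lborel. u x * (grad \<psi> x \<bullet> b)) + (LINT x|lborel. (grad u x \<bullet> b) * \<psi> x)"
    unfolding inner_add_left
    by (subst Bochner_Integration.integral_add)
       (use C in \<open>auto intro!: int continuous_intros cu c\<psi> simp: mult.commute\<close>)
  ultimately have *: "(LINT x|lborel. u x * (grad \<psi> x \<bullet> b)) + (LINT x|lborel. (grad u x \<bullet> b) * \<psi> x) = 0"
    by simp
  show "(LINT x:\<Omega>|lborel. u x * (grad \<psi> x \<bullet> b)) = - (LINT x:\<Omega>|lborel. (grad u x \<bullet> b) * \<psi> x)"
  proof -
    have "x \<notin> \<Omega> \<Longrightarrow> u x = 0 \<and> grad u x = 0" for x using C by blast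
    then have "(LINT x:\<Omega>|lborel. u x * (grad \<psi> x \<bullet> b)) = (LINT x|lborel. u x * (grad \<psi> x \<bullet> b))"
      "(LINT x:\<Omega>|lborel. (grad u x \<bullet> b) * \<psi> x) = (LINT x|lborel. (grad u x \<bullet> b) * \<psi> x)"
      by (intro set_integral_eq_integral_support; simp)+
    with * show ?thesis by simp
  qed
qed

text \<open>The products of \<open>flat 0\<close> over the faces of a box, steepened, increase to its indicator.\<close>
lemma box_indicator_limit_smooth:
  fixes a b :: "'a::euclidean_space"
  obtains \<psi> :: "nat \<Rightarrow> 'a \<Rightarrow> real" where
    "\<And>j. \<psi> j \<in> smooth_terms UNIV" "\<And>j x. x \<notin> box a b \<Longrightarrow> \<psi> j x = 0"
    "\<And>j x. 0 \<le> \<psi> j x \<and> \<psi> j x \<le> 1" "\<And>x. (\<lambda>j. \<psi> j x) \<longlonglongrightarrow> indicator (box a b) x"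
proof
  define \<psi> where "\<psi> j x = (\<Prod>i\<in>Basis. flat 0 (real (Suc j) * (x \<bullet> i - a \<bullet> i)) * flat 0 (real (Suc j) * (b \<bullet> i - x \<bullet> i)))" for j and x :: 'a
  show "\<psi> j \<in> smooth_terms UNIV" for j
    unfolding \<psi>_def
    by (intro smooth_terms_prod finite_Basis smooth_terms.mult smooth_terms_flat smooth_terms_diff
        smooth_terms.const smooth_terms.inner)
  show "\<psi> j x = 0" if "x \<notin> box a b" for j x
  proof -
    obtain i where "i \<in> Basis" "x \<bullet> i - a \<bullet> i \<le> 0 \<or> b \<bullet> i - x \<bullet> i \<le> 0"
      using \<open>x \<notin> box a b\<close> by (auto simp: mem_box not_less)
    then show ?thesis unfolding \<psi>_def
      by (intro prod_zero) (auto intro!: bexI[of _ i] flat_0_bounds(4) mult_nonneg_nonpos)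
  qed
  show "0 \<le> \<psi> j x \<and> \<psi> j x \<le> 1" for j x
    unfolding \<psi>_def
    by (intro conjI prod_nonneg prod_le_1) (auto intro!: mult_nonneg_nonneg mult_le_one flat_0_bounds(1,2))
  fix x
  have "(\<lambda>j. \<psi> j x) \<longlonglongrightarrow> (\<Prod>i\<in>Basis. (if x \<bullet> i - a \<bullet> i > 0 then 1 else 0) * (if b \<bullet> i - x \<bullet> i > 0 then 1 else 0))"
    unfolding \<psi>_def by (intro tendsto_prod tendsto_mult flat_0_scale_tendsto)
  moreover have "(\<Prod>i\<in>Basis. (if x \<bullet> i - a \<bullet> i > 0 then 1 else 0) * (if b \<bullet> i - x \<bullet> i > 0 then 1 else 0))
      = (indicator (box a b) x :: real)"
    by (auto simp: indicator_def mem_box intro!: prod.neutral prod_zero)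
  ultimately show "(\<lambda>j. \<psi> j x) \<longlonglongrightarrow> indicator (box a b) x" by simp
qed

text \<open>The Borel sets on which \<open>h\<close> has integral zero form a Dynkin system
  containing the boxes, which are stable under intersection and generate the Borel sets. Support in
  a single box gives total integral zero, which handles complements.\<close>

lemma AE_zero_if_box_integrals_zero:
  fixes h :: "'a::euclidean_space \<Rightarrow> real"
  assumes h: "integrable lborel h" and "\<And>x. x \<notin> box c d \<Longrightarrow> h x = 0"
    and 0: "\<And>a b. (LINT x:box a b|lborel. h x) = 0"
  shows "AE x in lborel. h x = 0"
proof (rule sigma_finite_measure.density_zero[OF sigma_finite_lborel h])
  fix A :: "'a set" assume A: "A \<in> sets lborel"
  have si: "set_integrable lborel B h" if "B \<in> sets borel" for B
    unfolding set_integrable_def using integrable_mult_indicator[OF _ h, of B] that by simp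
  have all: "integral\<^sup>L lborel h = 0"
    using 0[of c d] set_integral_eq_integral_support[of "box c d" h] assms(2) by simp
  have "Int_stable (range (\<lambda>(a, b). box a b :: 'a set))"
    by (auto simp: Int_stable_def box_Int_box)
  moreover have "(range (\<lambda>(a, b). box a b)) \<subseteq> Pow (UNIV :: 'a set)" by auto
  moreover have "A \<in> sigma_sets UNIV (range (\<lambda>(a, b). box a b))"
    using A unfolding sets_lborel borel_eq_box by simp
  ultimately show "(LINT x:A|lborel. h x) = 0"
  proof (induction rule: sigma_sets_induct_disjoint)
    case (basic A) then show ?case using 0 by auto
  next
    case empty then show ?case by (simp add: set_lebesgue_integral_def)
  next
    case (compl A)
    then have [measurable]: "A \<in> sets borel" by (simp add: borel_eq_box)
    have "(LINT x:A \<union> (UNIV - A)|lborel. h x) = (LINT x:A|lborel. h x) + (LINT x:UNIV - A|lborel. h x)"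
      by (intro set_integral_Un si) auto
    then show ?case using compl all by (simp add: set_lebesgue_integral_def)
  next
    case (union F)
    then have [measurable]: "\<And>i. F i \<in> sets borel" by (simp add: borel_eq_box subset_eq)
    have "(LINT x:(\<Union>i. F i)|lborel. h x) = (\<Sum>i. (LINT x:(F i)|lborel. h x))"
      by (rule lebesgue_integral_countable_add)
         (use union(1) in \<open>auto simp: disjoint_family_on_def intro!: si\<close>)
    then show ?case using union by simp
  qed
qed

text \<open>Testing is demanded only against test functions in \<open>smooth_terms UNIV\<close>: for
  these it is immediate that the product with a coordinate is again a test function, which the
  radial identity relies on. Smooth approximations of box indicators give vanishing box integrals,
  and countably many boxes cover \<Omega>.\<close>

lemma fundamental_lemma_calculus_of_variations:
  fixes h :: "'a::euclidean_space \<Rightarrow> real"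
  assumes "open \<Omega>" and h: "\<And>C. compact C \<Longrightarrow> C \<subseteq> \<Omega> \<Longrightarrow> set_integrable lborel C h"
    and 0: "\<And>\<psi>. \<psi> \<in> smooth_terms UNIV \<Longrightarrow> \<psi> \<in> test_functions \<Omega> \<Longrightarrow> (LINT x:\<Omega>|lborel. h x * \<psi> x) = 0"
  shows "AE x in lborel. x \<in> \<Omega> \<longrightarrow> h x = 0"
proof -
  have box0: "(LINT x:box a b|lborel. h x) = 0" if ab: "cbox a b \<subseteq> \<Omega>" for a b
  proof -
    obtain \<psi> :: "nat \<Rightarrow> 'a \<Rightarrow> real" where \<psi>: "\<And>j. \<psi> j \<in> smooth_terms UNIV"
      "\<And>j x. x \<notin> box a b \<Longrightarrow> \<psi> j x = 0" "\<And>j x. 0 \<le> \<psi> j x \<and> \<psi> j x \<le> 1"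
      "\<And>x. (\<lambda>j. \<psi> j x) \<longlonglongrightarrow> indicator (box a b) x"
      using box_indicator_limit_smooth by blast
    have tf: "\<psi> j \<in> test_functions \<Omega>" for j
      by (rule test_functions_smooth_terms[OF open_UNIV compact_cbox _ ab \<psi>(1)])
         (use \<psi>(2) box_subset_cbox[of a b] in auto)
    have m\<psi>[measurable]: "\<psi> j \<in> borel_measurable borel" for j
      by (rule borel_measurable_continuous_onI[OF test_functionsD(2)[OF tf]])
    have hi: "integrable lborel (\<lambda>x. indicator (cbox a b) x *\<^sub>R h x)"
      using h[OF compact_cbox ab] by (simp add: set_integrable_def)
    note [measurable] = borel_measurable_integrable[OF hi]
    have "(\<lambda>j. LINT x|lborel. (indicator (cbox a b) x *\<^sub>R h x) * \<psi> j x) \<longlonglongrightarrow>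
        (LINT x|lborel. (indicator (cbox a b) x *\<^sub>R h x) * indicator (box a b) x)"
    proof (rule integral_dominated_convergence[where w="\<lambda>x. norm (indicator (cbox a b) x *\<^sub>R h x)"])
      show "AE x in lborel. norm (indicator (cbox a b) x *\<^sub>R h x * \<psi> j x) \<le> norm (indicator (cbox a b) x *\<^sub>R h x)" for j
        using \<psi>(3)[of j] by (intro AE_I2) (auto simp: abs_mult mult_left_le)
      show "AE x in lborel. (\<lambda>j. indicator (cbox a b) x *\<^sub>R h x * \<psi> j x) \<longlonglongrightarrow> indicator (cbox a b) x *\<^sub>R h x * indicator (box a b) x"
        by (intro AE_I2 tendsto_intros \<psi>(4))
    qed (use hi in auto)
    moreover have "(LINT x|lborel. (indicator (cbox a b) x *\<^sub>R h x) * \<psi> j x) = 0" for j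
    proof -
      have "(LINT x|lborel. (indicator (cbox a b) x *\<^sub>R h x) * \<psi> j x) = (LINT x:\<Omega>|lborel. h x * \<psi> j x)"
        unfolding set_lebesgue_integral_def
        by (rule Bochner_Integration.integral_cong)
           (use \<psi>(2) ab box_subset_cbox[of a b] in \<open>fastforce simp: indicator_def\<close>)+
      then show ?thesis using 0[OF \<psi>(1) tf] by simp
    qed
    ultimately have "(LINT x|lborel. (indicator (cbox a b) x *\<^sub>R h x) * indicator (box a b) x) = 0"
      by (simp add: LIMSEQ_const_iff)
    moreover have "(\<lambda>x. (indicator (cbox a b) x *\<^sub>R h x) * indicator (box a b) x) = (\<lambda>x. indicator (box a b) x *\<^sub>R h x)"
      using box_subset_cbox[of a b] by (auto simp: indicator_def fun_eq_iff)
    ultimately show ?thesis by (simp add: set_lebesgue_integral_def)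
  qed
  have AEbox: "AE x in lborel. x \<in> cbox c d \<longrightarrow> h x = 0" if cd: "cbox c d \<subseteq> \<Omega>" for c d
  proof -
    have ci: "set_integrable lborel (cbox c d) h" using h[OF compact_cbox cd] .
    then have "set_integrable lborel (box c d) h"
      by (rule set_integrable_subset) (auto simp: box_subset_cbox)
    then have "integrable lborel (\<lambda>x. indicator (box c d) x *\<^sub>R h x)"
      by (simp add: set_integrable_def)
    then have "AE x in lborel. indicator (box c d) x *\<^sub>R h x = 0"
    proof (rule AE_zero_if_box_integrals_zero)
      show "indicator (box c d) x *\<^sub>R h x = 0" if "x \<notin> box c d" for x
        using that by simp
      fix a b :: 'a
      \<comment> \<open>The corners of the intersection of the two boxes, so that
        \<open>box0\<close> applies to it.\<close>
      define a' b' where "a' = (\<Sum>i\<in>Basis. max (a\<bullet>i) (c\<bullet>i) *\<^sub>R i)" "b' = (\<Sum>i\<in>Basis. min (b\<bullet>i) (d\<bullet>i) *\<^sub>R i)"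
      have "cbox a' b' \<subseteq> \<Omega>" using Int_interval[of a b c d] cd unfolding a'_b'_def by blast
      then have "(LINT x:box a' b'|lborel. h x) = 0" by (rule box0)
      then show "(LINT x:box a b|lborel. indicator (box c d) x *\<^sub>R h x) = 0"
        unfolding set_lebesgue_integral_def a'_b'_def box_Int_box[symmetric]
        by (simp add: indicator_inter_arith mult.assoc)
    qed
    \<comment> \<open>The faces of a box form a null set, so the result for the open box extends to
      the closed one; the countable cover used below consists of closed boxes.\<close>
    moreover have "AE x in lborel. x \<notin> cbox c d - box c d"
    proof -
      have "cbox c d - box c d \<in> null_sets lborel"
        using negligible_frontier_interval[of c d] 
        by (auto simp: negligible_iff_null_sets null_sets_completion_iff)
      then show ?thesis by (rule AE_not_in)
    qed
    ultimately show ?thesis by eventually_elim (auto simp: indicator_def split: if_splits)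
  qed
  obtain \<D> where \<D>: "countable \<D>" "\<D> \<subseteq> Pow \<Omega>" "\<And>X. X \<in> \<D> \<Longrightarrow> \<exists>a b. X = cbox a b" "\<Union>\<D> = \<Omega>"
    using open_countable_Union_open_cbox[OF \<open>open \<Omega>\<close>] by metis
  have "AE x in lborel. \<forall>X\<in>\<D>. x \<in> X \<longrightarrow> h x = 0"
    unfolding AE_ball_countable[OF \<D>(1)]
  proof
    fix X assume X: "X \<in> \<D>"
    then obtain a b where "X = cbox a b" "cbox a b \<subseteq> \<Omega>" using \<D>(2,3) by blast
    then show "AE x in lborel. x \<in> X \<longrightarrow> h x = 0" using AEbox by simp
  qed
  then show ?thesis by eventually_elim (use \<D>(4) in blast)
qed

section \<open>Uniqueness of weak gradients, and test functions as members of the completion\<close>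

lemma weak_gradient_unique:
  fixes g1 g2 :: "'a::euclidean_space \<Rightarrow> 'a"
  assumes "open \<Omega>" and g1: "is_weak_gradient \<Omega> u g1" and g2: "is_weak_gradient \<Omega> u g2"
  shows "AE x in lborel. x \<in> \<Omega> \<longrightarrow> g1 x = g2 x"
proof -
  have "AE x in lborel. x \<in> \<Omega> \<longrightarrow> (g1 x \<bullet> b - g2 x \<bullet> b) = 0" if b: "b \<in> Basis" for b
  proof (rule fundamental_lemma_calculus_of_variations[OF \<open>open \<Omega>\<close>])
    have i: "set_integrable lborel C (\<lambda>x. g1 x \<bullet> b)" "set_integrable lborel C (\<lambda>x. g2 x \<bullet> b)" if "compact C" "C \<subseteq> \<Omega>" for C
    proof -
      have "integrable lborel (\<lambda>x. (indicator C x *\<^sub>R g1 x) \<bullet> b)" "integrable lborel (\<lambda>x. (indicator C x *\<^sub>R g2 x) \<bullet> b)"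
        using g1 g2 that unfolding is_weak_gradient_def set_integrable_def
        by (auto intro!: integrable_inner_left simp del: inner_scaleR_left)
      then show "set_integrable lborel C (\<lambda>x. g1 x \<bullet> b)" "set_integrable lborel C (\<lambda>x. g2 x \<bullet> b)"
        by (auto simp: set_integrable_def)
    qed
    then show "set_integrable lborel C (\<lambda>x. g1 x \<bullet> b - g2 x \<bullet> b)" if "compact C" "C \<subseteq> \<Omega>" for C
      using that by (intro set_integral_diff)
    fix \<psi> :: "'a \<Rightarrow> real" assume \<psi>: "\<psi> \<in> test_functions \<Omega>"
    obtain C where C: "compact C" "C \<subseteq> \<Omega>" "\<And>x. x \<notin> C \<Longrightarrow> \<psi> x = 0"
      using test_functionsD(4)[OF \<psi>] by blast
    note c = test_functionsD(2)[OF \<psi>]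
    note j = set_integrable_mult_compact_support(1)[OF _ C(1,2) continuous_on_subset[OF c subset_UNIV]
        borel_measurable_continuous_onI[OF c] C(3)]
    have "(LINT x:\<Omega>|lborel. (g1 x \<bullet> b) * \<psi> x - (g2 x \<bullet> b) * \<psi> x) = 
        (LINT x:\<Omega>|lborel. (g1 x \<bullet> b) * \<psi> x) - (LINT x:\<Omega>|lborel. (g2 x \<bullet> b) * \<psi> x)"
      using i C by (intro set_integral_diff j) auto
    also have "\<dots> = 0"
      using g1 g2 \<psi> b unfolding is_weak_gradient_def by simp
    finally show "(LINT x:\<Omega>|lborel. (g1 x \<bullet> b - g2 x \<bullet> b) * \<psi> x) = 0"
      by (simp add: left_diff_distrib)
  qed
  then have "AE x in lborel. \<forall>b\<in>Basis. x \<in> \<Omega> \<longrightarrow> (g1 x \<bullet> b - g2 x \<bullet> b) = 0"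
    by (intro AE_finite_allI) auto
  then show ?thesis by eventually_elim (auto intro: euclidean_eqI)
qed

text \<open>\<open>weak_grad\<close> is a choice by SOME, so its values are controlled only up to a
  null set; later identities for it therefore hold almost everywhere.\<close>

lemma weak_grad_AE_eq:
  assumes "open \<Omega>" "is_weak_gradient \<Omega> u g"
  shows "AE x in lborel. x \<in> \<Omega> \<longrightarrow> weak_grad \<Omega> u x = g x"
    and "is_weak_gradient \<Omega> u (weak_grad \<Omega> u)"
proof -
  show "is_weak_gradient \<Omega> u (weak_grad \<Omega> u)"
    unfolding weak_grad_def using someI[of "is_weak_gradient \<Omega> u", OF assms(2)] .
  then show "AE x in lborel. x \<in> \<Omega> \<longrightarrow> weak_grad \<Omega> u x = g x"
    using weak_gradient_unique assms by blast
qed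

text \<open>The constant sequence with value \<open>u\<close> converges to \<open>u\<close> in all
  three senses. The gradient term vanishes because \<open>weak_grad\<close> agrees almost everywhere
  with the classical gradient.\<close>

lemma test_functions_W0:
  fixes u :: "'a::euclidean_space \<Rightarrow> real"
  assumes "open \<Omega>" and u: "u \<in> test_functions \<Omega>"
  shows "u \<in> W0 p w \<Omega>"
proof -
  have "AE x in lborel. x \<in> \<Omega> \<longrightarrow> weak_grad \<Omega> u x = grad u x"
    by (rule weak_grad_AE_eq[OF \<open>open \<Omega>\<close> is_weak_gradient_test_function[OF u]])
  then have "AE x in lborel. ennreal (w x * norm (grad u x - weak_grad \<Omega> u x) powr p) * indicator \<Omega> x = 0"
    by eventually_elim (auto simp: indicator_def)
  then have "(\<integral>\<^sup>+x\<in>\<Omega>. ennreal (w x * norm (grad u x - weak_grad \<Omega> u x) powr p) \<partial>lborel) = (\<integral>\<^sup>+x. 0 \<partial>(lborel :: 'a measure))"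
    by (rule nn_integral_cong_AE)
  moreover have "x \<notin> \<Omega> \<Longrightarrow> u x = 0" for x using test_functionsD(4)[OF u] by blast
  ultimately show ?thesis unfolding W0_def
    using u is_weak_gradient_test_function[OF u] borel_measurable_continuous_onI[OF test_functionsD(2)[OF u]]
    by (auto intro!: exI[of _ "\<lambda>j. u"])
qed

section \<open>Polar coordinates\<close>

lemma pred_mem_ball[measurable (raw)]:
  fixes f :: "'b \<Rightarrow> 'a::euclidean_space"
  assumes [measurable]: "f \<in> M \<rightarrow>\<^sub>M borel" "g \<in> borel_measurable M"
  shows "Measurable.pred M (\<lambda>x. f x \<in> ball c (g x))"
  unfolding mem_ball by measurable

lemma nn_integral_scaleR:
  fixes G :: "'a::euclidean_space \<Rightarrow> ennreal"
  assumes [measurable]: "G \<in> borel_measurable borel" and s: "s > 0"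
  shows "(\<integral>\<^sup>+x. G x \<partial>lborel) = ennreal (s ^ DIM('a)) * (\<integral>\<^sup>+x. G (s *\<^sub>R x) \<partial>lborel)"
proof -
  have "(\<integral>\<^sup>+x. G x \<partial>lborel) = (\<integral>\<^sup>+x. G x \<partial>density (distr lborel borel (\<lambda>x::'a. 0 + s *\<^sub>R x)) (\<lambda>_. ennreal (\<bar>s\<bar>^DIM('a))))"
    using lborel_affine[of s "0::'a"] s by simp
  also have "\<dots> = ennreal (s ^ DIM('a)) * (\<integral>\<^sup>+x. G (s *\<^sub>R x) \<partial>lborel)"
    using s by (simp add: nn_integral_density nn_integral_distr nn_integral_cmult)
  finally show ?thesis .
qed

text \<open>After the integrals in the polar formula are exchanged, the radial variable ranges over
  s > norm y; this tail integral cancels the power of norm y that is left over there.\<close>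

lemma nn_integral_inverse_power_tail:
  fixes y :: real
  assumes "y > 0" "n > 0"
  shows "(\<integral>\<^sup>+s. ennreal (real n * (1 / s ^ Suc n)) * indicator {y<..} s \<partial>lborel) = ennreal (1 / y ^ n)"
proof -
  have "(\<integral>\<^sup>+s. ennreal (real n * (1 / s ^ Suc n)) * indicator {y<..} s \<partial>lborel) =
      (\<integral>\<^sup>+s. ennreal (real n * (1 / s ^ Suc n)) * indicator {y..} s \<partial>lborel)"
    by (rule nn_integral_cong_AE)
       (use AE_lborel_singleton[of y] in eventually_elim, auto simp: indicator_def)
  also have "\<dots> = ennreal (0 - (- (1 / y ^ n)))"
  proof (rule nn_integral_FTC_atLeast)
    show "((\<lambda>s::real. - (1 / s ^ n)) \<longlongrightarrow> 0) at_top"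
    proof -
      have "((\<lambda>s::real. inverse (s ^ n)) \<longlongrightarrow> 0) at_top"
        by (rule tendsto_inverse_0_at_top[OF filterlim_pow_at_top[OF assms(2) filterlim_ident]])
      from tendsto_minus[OF this] show ?thesis by (simp add: inverse_eq_divide)
    qed
    fix s assume "y \<le> s"
    then have "s > 0" using assms by simp
    obtain k where k: "n = Suc k" using assms(2) gr0_conv_Suc by blast
    have "((\<lambda>s. - (1 / s ^ n)) has_real_derivative real n * s ^ (n - 1) / (s ^ n * s ^ n)) (at s)"
      using \<open>s > 0\<close> by (auto intro!: derivative_eq_intros)
    moreover have "real n * s ^ (n - 1) / (s ^ n * s ^ n) = real n * (1 / s ^ Suc n)"
      using \<open>s > 0\<close> by (simp add: k field_simps)
    ultimately show "((\<lambda>s. - (1 / s ^ n)) has_real_derivative real n * (1 / s ^ Suc n)) (at s)"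
      by simp
    show "0 \<le> real n * (1 / s ^ Suc n)" using \<open>s > 0\<close> by simp
  qed auto
  finally show ?thesis by simp
qed

text \<open>The outer integral over the unit ball is, up to the factor \<open>n\<close>, the integral over the unit
  sphere. Substituting \<open>r = s |x|\<close> in the inner integral and exchanging the order of integration
  proves the formula without constructing a product measure.\<close>
theorem nn_integral_polar:
  fixes F :: "'a::euclidean_space \<Rightarrow> ennreal"
  assumes [measurable]: "F \<in> borel_measurable borel"
  shows "(\<integral>\<^sup>+x. F x \<partial>lborel) = ennreal (real DIM('a)) * (\<integral>\<^sup>+x. indicator (ball 0 1) x *
    (\<integral>\<^sup>+r. indicator {0<..} r * ennreal (r ^ (DIM('a) - 1)) * F (r *\<^sub>R sgn x) \<partial>lborel) \<partial>(lborel::'a measure))"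
proof -
  let ?n = "DIM('a)"
  have pN: "t ^ ?n = t * t ^ (?n - 1)" for t :: real
    by (metis DIM_positive One_nat_def Suc_pred power_Suc)
  have mp: "borel_measurable (lborel \<Otimes>\<^sub>M lborel) = (borel_measurable (borel \<Otimes>\<^sub>M borel) :: (real \<times> 'a \<Rightarrow> ennreal) set)"
    "borel_measurable (lborel \<Otimes>\<^sub>M lborel) = (borel_measurable (borel \<Otimes>\<^sub>M borel) :: ('a \<times> real \<Rightarrow> ennreal) set)"
    by (intro measurable_cong_sets sets_pair_measure_cong; simp)+

  have 1: "(\<integral>\<^sup>+r. indicator {0<..} r * ennreal (r ^ (?n - 1)) * F (r *\<^sub>R sgn x) \<partial>lborel) =
      (\<integral>\<^sup>+s. indicator {0<..} s * ennreal (s ^ (?n - 1)) * ennreal (norm x ^ ?n) * F (s *\<^sub>R x) \<partial>lborel)"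
    if "x \<noteq> 0" for x :: 'a
  proof -
    have "(\<integral>\<^sup>+r. indicator {0<..} r * ennreal (r ^ (?n - 1)) * F (r *\<^sub>R sgn x) \<partial>lborel) =
       ennreal \<bar>norm x\<bar> * (\<integral>\<^sup>+s. indicator {0<..} (0 + norm x * s) * ennreal ((0 + norm x * s) ^ (?n - 1)) * F ((0 + norm x * s) *\<^sub>R sgn x) \<partial>lborel)"
      by (rule nn_integral_real_affine) (use that in auto)
    also have "\<dots> = (\<integral>\<^sup>+s. ennreal (norm x) * (indicator {0<..} (norm x * s) * ennreal ((norm x * s) ^ (?n - 1)) * F ((norm x * s) *\<^sub>R sgn x)) \<partial>lborel)"
      by (subst nn_integral_cmult) auto
    also have "\<dots> = (\<integral>\<^sup>+s. indicator {0<..} s * ennreal (s ^ (?n - 1)) * ennreal (norm x ^ ?n) * F (s *\<^sub>R x) \<partial>lborel)"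
    proof (rule nn_integral_cong)
      fix s :: real
      have F: "F ((norm x * s) *\<^sub>R sgn x) = F (s *\<^sub>R x)"
        using that by (simp add: sgn_div_norm field_simps)
      have "norm x * (norm x * s) ^ (?n - 1) = s ^ (?n - 1) * norm x ^ ?n"
        unfolding pN[of "norm x"] by (simp add: power_mult_distrib)
      then have "ennreal (norm x) * ennreal ((norm x * s) ^ (?n - 1)) = ennreal (s ^ (?n - 1)) * ennreal (norm x ^ ?n)" if "s > 0"
        using that by (simp flip: ennreal_mult)
      then show "ennreal (norm x) * (indicator {0<..} (norm x * s) * ennreal ((norm x * s) ^ (?n - 1)) * F ((norm x * s) *\<^sub>R sgn x)) =
        indicator {0<..} s * ennreal (s ^ (?n - 1)) * ennreal (norm x ^ ?n) * F (s *\<^sub>R x)"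
        unfolding F using that
        by (cases "s > 0") (auto simp: indicator_def zero_less_mult_iff simp flip: mult.assoc)
    qed
    finally show ?thesis .
  qed
  have "(\<integral>\<^sup>+x. indicator (ball 0 1) x * (\<integral>\<^sup>+r. indicator {0<..} r * ennreal (r ^ (?n - 1)) * F (r *\<^sub>R sgn x) \<partial>lborel) \<partial>(lborel::'a measure))
     = (\<integral>\<^sup>+x. (\<integral>\<^sup>+s. indicator (ball 0 1) x * (indicator {0<..} s * ennreal (s ^ (?n - 1)) * ennreal (norm x ^ ?n) * F (s *\<^sub>R x)) \<partial>lborel) \<partial>(lborel::'a measure))"
  proof (rule nn_integral_cong_AE, use AE_lborel_singleton[of "0::'a"] in eventually_elim)
    fix x :: 'a assume "x \<noteq> 0"
    show "indicator (ball 0 1) x * (\<integral>\<^sup>+r. indicator {0<..} r * ennreal (r ^ (?n - 1)) * F (r *\<^sub>R sgn x) \<partial>lborel) =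
      (\<integral>\<^sup>+s. indicator (ball 0 1) x * (indicator {0<..} s * ennreal (s ^ (?n - 1)) * ennreal (norm x ^ ?n) * F (s *\<^sub>R x)) \<partial>lborel)"
      unfolding 1[OF \<open>x \<noteq> 0\<close>] by (subst nn_integral_cmult) auto
  qed
  also have "\<dots> = (\<integral>\<^sup>+s. (\<integral>\<^sup>+x. indicator (ball 0 1) x * (indicator {0<..} s * ennreal (s ^ (?n - 1)) * ennreal (norm x ^ ?n) * F (s *\<^sub>R x)) \<partial>(lborel::'a measure)) \<partial>lborel)"
    by (rule lborel_pair.Fubini') (simp only: split_beta' mp, measurable)
  \<comment> \<open>Substituting y = s x in the inner integral: the volume factor s^(-n), the factor
    s^(n - 1) and |x|^n = |y|^n / s^n combine to |y|^n / s^(n + 1), and the condition norm x < 1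
    becomes norm y < s.\<close>
  also have "\<dots> = (\<integral>\<^sup>+s. (\<integral>\<^sup>+y. indicator {0<..} s * (ennreal (1 / s ^ Suc ?n) * (indicator (ball 0 s) y * ennreal (norm y ^ ?n) * F y)) \<partial>(lborel::'a measure)) \<partial>lborel)"
  proof (rule nn_integral_cong)
    fix s :: real
    show "(\<integral>\<^sup>+x. indicator (ball 0 1) x * (indicator {0<..} s * ennreal (s ^ (?n - 1)) * ennreal (norm x ^ ?n) * F (s *\<^sub>R x)) \<partial>(lborel::'a measure))
      = (\<integral>\<^sup>+y. indicator {0<..} s * (ennreal (1 / s ^ Suc ?n) * (indicator (ball 0 s) y * ennreal (norm y ^ ?n) * F y)) \<partial>(lborel::'a measure))"
    proof (cases "s > 0")
      case True
      have "(\<integral>\<^sup>+y. indicator {0<..} s * (ennreal (1 / s ^ Suc ?n) * (indicator (ball 0 s) y * ennreal (norm y ^ ?n) * F y)) \<partial>(lborel::'a measure))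
        = ennreal (s ^ ?n) * (\<integral>\<^sup>+x. indicator {0<..} s * (ennreal (1 / s ^ Suc ?n) * (indicator (ball 0 s) (s *\<^sub>R x) * ennreal (norm (s *\<^sub>R x) ^ ?n) * F (s *\<^sub>R x))) \<partial>(lborel::'a measure))"
        by (rule nn_integral_scaleR) (measurable, rule True)
      also have "\<dots> = (\<integral>\<^sup>+x. ennreal (s ^ ?n) * (indicator {0<..} s * (ennreal (1 / s ^ Suc ?n) * (indicator (ball 0 s) (s *\<^sub>R x) * ennreal (norm (s *\<^sub>R x) ^ ?n) * F (s *\<^sub>R x)))) \<partial>(lborel::'a measure))"
        by (subst nn_integral_cmult) auto
      also have "\<dots> = (\<integral>\<^sup>+x. indicator (ball 0 1) x * (indicator {0<..} s * ennreal (s ^ (?n - 1)) * ennreal (norm x ^ ?n) * F (s *\<^sub>R x)) \<partial>(lborel::'a measure))"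
      proof (rule nn_integral_cong)
        fix x :: 'a
        have "s ^ ?n * (1 / s ^ Suc ?n * norm (s *\<^sub>R x) ^ ?n) = s ^ (?n - 1) * norm x ^ ?n"
          using True pN[of s] by (simp add: power_mult_distrib field_simps)
        then have "ennreal (s ^ ?n) * (ennreal (1 / s ^ Suc ?n) * ennreal (norm (s *\<^sub>R x) ^ ?n)) = ennreal (s ^ (?n - 1)) * ennreal (norm x ^ ?n)"
          using True by (simp add: divide_nonneg_nonneg flip: ennreal_mult)
        then show "ennreal (s ^ ?n) * (indicator {0<..} s * (ennreal (1 / s ^ Suc ?n) * (indicator (ball 0 s) (s *\<^sub>R x) * ennreal (norm (s *\<^sub>R x) ^ ?n) * F (s *\<^sub>R x)))) =
          indicator (ball 0 1) x * (indicator {0<..} s * ennreal (s ^ (?n - 1)) * ennreal (norm x ^ ?n) * F (s *\<^sub>R x))"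
          using True by (auto simp: indicator_def simp flip: mult.assoc)
      qed
      finally show ?thesis by simp
    qed simp
  qed
  also have "\<dots> = (\<integral>\<^sup>+y. (\<integral>\<^sup>+s. indicator {0<..} s * (ennreal (1 / s ^ Suc ?n) * (indicator (ball 0 s) y * ennreal (norm y ^ ?n) * F y)) \<partial>lborel) \<partial>(lborel::'a measure))"
    by (rule lborel_pair.Fubini'[symmetric]) (simp only: split_beta' mp, measurable)
  finally have "ennreal (real ?n) * (\<integral>\<^sup>+x. indicator (ball 0 1) x * (\<integral>\<^sup>+r. indicator {0<..} r * ennreal (r ^ (?n - 1)) * F (r *\<^sub>R sgn x) \<partial>lborel) \<partial>(lborel::'a measure))
     = (\<integral>\<^sup>+y. ennreal (real ?n) * (\<integral>\<^sup>+s. indicator {0<..} s * (ennreal (1 / s ^ Suc ?n) * (indicator (ball 0 s) y * ennreal (norm y ^ ?n) * F y)) \<partial>lborel) \<partial>(lborel::'a measure))"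
    by (simp add: nn_integral_cmult)
  also have "\<dots> = (\<integral>\<^sup>+y. F y \<partial>lborel)"
  proof (rule nn_integral_cong_AE, use AE_lborel_singleton[of "0::'a"] in eventually_elim)
    fix y :: 'a assume y: "y \<noteq> 0"
    have "ennreal (real ?n) * (\<integral>\<^sup>+s. indicator {0<..} s * (ennreal (1 / s ^ Suc ?n) * (indicator (ball 0 s) y * ennreal (norm y ^ ?n) * F y)) \<partial>lborel)
      = (\<integral>\<^sup>+s. ennreal (real ?n) * (indicator {0<..} s * (ennreal (1 / s ^ Suc ?n) * (indicator (ball 0 s) y * ennreal (norm y ^ ?n) * F y))) \<partial>lborel)"
      by (subst nn_integral_cmult)
         (measurable, simp_all add: open_Collect_less continuous_on_id continuous_on_const)
    also have "\<dots> = (\<integral>\<^sup>+s. (ennreal (real ?n * (1 / s ^ Suc ?n)) * indicator {norm y<..} s) * (ennreal (norm y ^ ?n) * F y) \<partial>lborel)"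
    proof (rule nn_integral_cong)
      fix s :: real
      show "ennreal (real ?n) * (indicator {0<..} s * (ennreal (1 / s ^ Suc ?n) * (indicator (ball 0 s) y * ennreal (norm y ^ ?n) * F y)))
       = (ennreal (real ?n * (1 / s ^ Suc ?n)) * indicator {norm y<..} s) * (ennreal (norm y ^ ?n) * F y)"
      proof (cases "norm y < s")
        case True
        then have "s > 0" using norm_ge_zero[of y] by linarith
        then have "ennreal (real ?n * (1 / s ^ Suc ?n)) = ennreal (real ?n) * ennreal (1 / s ^ Suc ?n)"
          by (intro ennreal_mult) auto
        then show ?thesis using True \<open>s > 0\<close> by (simp add: indicator_def mult.assoc)
      qed (simp add: indicator_def)
    qed
    also have "\<dots> = ennreal (1 / norm y ^ ?n) * (ennreal (norm y ^ ?n) * F y)"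
      by (subst nn_integral_multc) (use nn_integral_inverse_power_tail[of "norm y" ?n] y in auto)
    also have "\<dots> = F y"
      using y by (simp add: mult.assoc[symmetric] flip: ennreal_mult)
    finally show "ennreal (real ?n) * (\<integral>\<^sup>+s. indicator {0<..} s * (ennreal (1 / s ^ Suc ?n) * (indicator (ball 0 s) y * ennreal (norm y ^ ?n) * F y)) \<partial>lborel) = F y" .
  qed
  finally show ?thesis by simp
qed

lemma nn_integral_sphere_measure:
  fixes f :: "'a::euclidean_space \<Rightarrow> ennreal"
  assumes [measurable]: "f \<in> borel_measurable borel"
  shows "(\<integral>\<^sup>+x. f x \<partial>sphere_measure r) = ennreal (real DIM('a) * r ^ (DIM('a) - 1)) *
    (\<integral>\<^sup>+x. indicator (ball 0 1) x * f (r *\<^sub>R sgn x) \<partial>(lborel :: 'a measure))"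
proof -
  have *: "(\<lambda>x. (r / norm x) *\<^sub>R x) \<in> restrict_space lborel (ball 0 1) \<rightarrow>\<^sub>M (borel :: 'a measure)"
    by (rule measurable_restrict_space1) simp
  show ?thesis
    unfolding sphere_measure_def
    by (subst nn_integral_scale_measure, simp, subst nn_integral_distr[OF *])
       (simp_all add: nn_integral_restrict_space sgn_div_norm divide_inverse mult.commute)
qed

section \<open>Integrals that vanish because they vanish on every ray\<close>

lemma integral_zero_nn_integral_eq:
  fixes f :: "'a \<Rightarrow> real"
  assumes "integrable M f" "integral\<^sup>L M f = 0"
  shows "(\<integral>\<^sup>+x. ennreal (f x) \<partial>M) = (\<integral>\<^sup>+x. ennreal (- f x) \<partial>M)"
proof -
  have fin: "(\<integral>\<^sup>+x. ennreal (f x) \<partial>M) \<noteq> \<infinity>" "(\<integral>\<^sup>+x. ennreal (- f x) \<partial>M) \<noteq> \<infinity>"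
    using assms(1) unfolding real_integrable_def by auto
  have "enn2real (\<integral>\<^sup>+x. ennreal (f x) \<partial>M) = enn2real (\<integral>\<^sup>+x. ennreal (- f x) \<partial>M)"
    using real_lebesgue_integral_def[OF assms(1)] assms(2) by simp
  then show ?thesis using fin by (metis ennreal_enn2real_if infinity_ennreal_def)
qed

text \<open>The polar formula covers nonnegative functions only, so it is applied to the positive
  and the negative part of \<open>F\<close>. Their weighted integrals agree on every ray, hence so
  do their integrals over the whole space.\<close>

lemma integral_zero_if_ray_integrals_zero:
  fixes F :: "'a::euclidean_space \<Rightarrow> real"
  assumes F: "integrable lborel F"
    and ray: "\<And>y. norm y = 1 \<Longrightarrow>
      has_bochner_integral lborel (\<lambda>r. indicator {0<..} r * (r ^ (DIM('a) - 1) * F (r *\<^sub>R y))) 0"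
  shows "integral\<^sup>L lborel F = 0"
proof -
  note [measurable] = borel_measurable_integrable[OF F]
  have eq: "indicator {0<..} r * ennreal (r ^ k) * ennreal t = ennreal (indicator {0<..} r * (r ^ k * t))" for r t :: real and k
    by (auto simp: indicator_def ennreal_mult')
  have "(\<integral>\<^sup>+r. indicator {0<..} r * ennreal (r ^ (DIM('a) - 1)) * ennreal (F (r *\<^sub>R sgn x)) \<partial>lborel) =
    (\<integral>\<^sup>+r. indicator {0<..} r * ennreal (r ^ (DIM('a) - 1)) * ennreal (- F (r *\<^sub>R sgn x)) \<partial>lborel)"
    (is "?I x = ?J x") if "x \<noteq> 0" for x :: 'a
  proof -
    have "norm (sgn x) = 1" using that by (simp add: norm_sgn)
    note ray = ray[OF this, unfolded has_bochner_integral_iff]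
    show ?thesis unfolding eq
      using integral_zero_nn_integral_eq[OF conjunct1[OF ray] conjunct2[OF ray]] by simp
  qed
  then have "(\<integral>\<^sup>+x. ennreal (F x) \<partial>lborel) = (\<integral>\<^sup>+x. ennreal (- F x) \<partial>lborel)"
  proof (subst (1 2) nn_integral_polar)
    assume *: "\<And>x::'a. x \<noteq> 0 \<Longrightarrow> ?I x = ?J x"
    have "(\<integral>\<^sup>+x. indicator (ball 0 1) x * ?I x \<partial>lborel) = (\<integral>\<^sup>+x. indicator (ball 0 1) x * ?J x \<partial>lborel)"
    proof (rule nn_integral_cong_AE, use AE_lborel_singleton[of "0::'a"] in eventually_elim)
      fix x :: 'a assume "x \<noteq> 0"
      show "indicator (ball 0 1) x * ?I x = indicator (ball 0 1) x * ?J x"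
        unfolding *[OF \<open>x \<noteq> 0\<close>] ..
    qed
    then show "ennreal (real DIM('a)) * (\<integral>\<^sup>+x. indicator (ball 0 1) x * ?I x \<partial>lborel) =
        ennreal (real DIM('a)) * (\<integral>\<^sup>+x. indicator (ball 0 1) x * ?J x \<partial>lborel)"
      by (rule arg_cong)
  qed measurable
  then show ?thesis using real_lebesgue_integral_def[OF F] by simp
qed

section \<open>The profile of a star-shaped domain\<close>

locale star_domain =
  fixes \<phi> :: "'a::euclidean_space \<Rightarrow> real" and \<Omega> :: "'a set"
  assumes hom: "homogeneous0 \<phi>" and pos: "\<And>x. \<phi> x > 0" and \<Omega>_def: "\<Omega> = {x. norm x < \<phi> x}"
    and open_\<Omega>: "open \<Omega>" and bounded_\<Omega>: "bounded \<Omega>" and star: "star_shaped_at \<Omega> 0"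
begin

lemma \<phi>_scale: "t > 0 \<Longrightarrow> \<phi> (t *\<^sub>R x) = \<phi> x"
  using hom by (simp add: homogeneous0_def)

lemma \<phi>_sgn: "x \<noteq> 0 \<Longrightarrow> \<phi> (sgn x) = \<phi> x"
  by (simp add: sgn_div_norm \<phi>_scale)

lemma scaleR_sgn_in_\<Omega>: "x \<noteq> 0 \<Longrightarrow> c > 0 \<Longrightarrow> c *\<^sub>R sgn x \<in> \<Omega> \<longleftrightarrow> c < \<phi> x"
  by (simp add: \<Omega>_def \<phi>_scale \<phi>_sgn norm_sgn)

text \<open>A ball inside the open set \<Omega> bounds \<phi> from below, boundedness of \<Omega>
  bounds it from above. Homogeneity does not tie the value at the origin to any other, hence the
  restriction to x \<noteq> 0.\<close>

lemma \<phi>_bounds: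
  obtains \<rho> R where "0 < \<rho>" "\<rho> < R" "\<And>x. x \<noteq> 0 \<Longrightarrow> \<rho> \<le> \<phi> x \<and> \<phi> x \<le> R"
proof -
  obtain R where R: "\<And>x. x \<in> \<Omega> \<Longrightarrow> norm x \<le> R" using bounded_\<Omega> unfolding bounded_iff by auto
  have "0 \<in> \<Omega>" using star by (simp add: star_shaped_at_def)
  then obtain \<rho> where \<rho>: "\<rho> > 0" "ball 0 \<rho> \<subseteq> \<Omega>" using open_\<Omega> open_contains_ball by blast
  have "\<rho> \<le> \<phi> x" if "x \<noteq> 0" for x
  proof (rule ccontr)
    assume "\<not> \<rho> \<le> \<phi> x"
    then have "\<phi> x *\<^sub>R sgn x \<in> ball 0 \<rho>" using that pos[of x] by (simp add: norm_sgn)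
    then show False using \<rho>(2) scaleR_sgn_in_\<Omega>[OF that pos] by blast
  qed
  moreover have "\<phi> x \<le> R" if "x \<noteq> 0" for x
  proof (rule dense_le_bounded[OF pos])
    fix c assume "0 < c" "c < \<phi> x"
    then have "c *\<^sub>R sgn x \<in> \<Omega>" using scaleR_sgn_in_\<Omega>[OF that] by blast
    then show "c \<le> R" using R \<open>0 < c\<close> that by (fastforce simp: norm_sgn)
  qed
  ultimately show ?thesis using that[of \<rho> "max R (2 * \<rho>)"] \<rho>(1) by fastforce
qed

text \<open>\<phi>(x) sgn x is a frontier point, being a limit of points of \<Omega> along the ray.
  If c sgn x lay in the closure, it would be a second frontier point on the same ray, contradicting
  star-shapedness.\<close>

lemma not_in_closure_\<Omega>: 
  assumes "x \<noteq> 0" "c > \<phi> x"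
  shows "c *\<^sub>R sgn x \<notin> closure \<Omega>"
proof
  assume cl: "c *\<^sub>R sgn x \<in> closure \<Omega>"
  have c: "c > 0" using assms(2) pos[of x] by linarith
  have fr: "z \<in> frontier \<Omega>" if "z \<in> closure \<Omega>" "z \<notin> \<Omega>" for z
    using that open_\<Omega> by (simp add: frontier_def interior_open)
  have 1: "c *\<^sub>R sgn x \<in> frontier \<Omega>"
    using cl c assms scaleR_sgn_in_\<Omega>[OF assms(1) c] by (intro fr) auto
  have "((\<lambda>t. t *\<^sub>R sgn x) \<longlongrightarrow> \<phi> x *\<^sub>R sgn x) (at_left (\<phi> x))"
    by (intro tendsto_intros)
  moreover have "\<forall>\<^sub>F t in at_left (\<phi> x). t *\<^sub>R sgn x \<in> closure \<Omega>"
    using eventually_at_left_real[OF pos[of x]]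
    by eventually_elim (use scaleR_sgn_in_\<Omega>[OF assms(1)] closure_subset in auto)
  ultimately have "\<phi> x *\<^sub>R sgn x \<in> closure \<Omega>"
    by (intro Lim_in_closed_set[of "closure \<Omega>"]) (auto simp: trivial_limit_at_left_real)
  then have 2: "\<phi> x *\<^sub>R sgn x \<in> frontier \<Omega>"
    using scaleR_sgn_in_\<Omega>[OF assms(1) pos] by (intro fr) auto
  have v: "sgn x \<noteq> 0" using assms(1) by (simp add: sgn_zero_iff)
  have "\<exists>!y. y \<in> frontier \<Omega> \<and> y \<in> {0 + t *\<^sub>R sgn x | t. t \<ge> 0}"
    using star v unfolding star_shaped_at_def by blast
  then have "c *\<^sub>R sgn x = \<phi> x *\<^sub>R sgn x"
  proof (rule ex1E)
    fix y assume "\<forall>z. z \<in> frontier \<Omega> \<and> z \<in> {0 + t *\<^sub>R sgn x | t. t \<ge> 0} \<longrightarrow> z = y"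
    moreover have "c *\<^sub>R sgn x \<in> {0 + t *\<^sub>R sgn x | t. t \<ge> 0}" "\<phi> x *\<^sub>R sgn x \<in> {0 + t *\<^sub>R sgn x | t. t \<ge> 0}"
      using c pos[of x] by fastforce+
    ultimately have "c *\<^sub>R sgn x = y" "\<phi> x *\<^sub>R sgn x = y" using 1 2 by blast+
    then show ?thesis by simp
  qed
  then show False using v assms(2) by simp
qed

text \<open>Openness of \<Omega> gives lower semicontinuity. Openness of the complement of its
  closure gives upper semicontinuity, and there the uniqueness of the frontier point on each ray
  enters.\<close>

lemma continuous_on_\<phi>: "continuous_on (- {0}) \<phi>"
proof (rule continuous_at_imp_continuous_on, rule ballI)
  fix x :: 'a assume "x \<in> - {0}"
  then have x: "x \<noteq> 0" by simp
  have ev: "\<forall>\<^sub>F z in nhds x. z \<noteq> 0" by (rule t1_space_nhds) (rule x)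
  have sg: "((\<lambda>z. c *\<^sub>R sgn z) \<longlongrightarrow> c *\<^sub>R sgn x) (nhds x)" for c
    unfolding sgn_div_norm using x by (intro tendsto_intros filterlim_ident) auto
  have "(\<phi> \<longlongrightarrow> \<phi> x) (nhds x)"
  proof (rule order_tendstoI)
    fix c assume "c < \<phi> x"
    show "\<forall>\<^sub>F z in nhds x. c < \<phi> z"
    proof (cases "c > 0")
      case True
      have "\<forall>\<^sub>F z in nhds x. c *\<^sub>R sgn z \<in> \<Omega>"
        by (rule topological_tendstoD[OF sg open_\<Omega>]) (use scaleR_sgn_in_\<Omega>[OF x True] \<open>c < \<phi> x\<close> in auto)
      with ev show ?thesis by eventually_elim (use scaleR_sgn_in_\<Omega> True in auto)
    next
      case False
      then have "c < \<phi> z" for z using pos[of z] by linarith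
      then show ?thesis by simp
    qed
  next
    fix c' assume "\<phi> x < c'"
    then obtain c where c: "\<phi> x < c" "c < c'" using dense by blast
    then have c0: "c > 0" using pos[of x] by linarith
    have "\<forall>\<^sub>F z in nhds x. c *\<^sub>R sgn z \<in> - closure \<Omega>"
      by (rule topological_tendstoD[OF sg]) (use not_in_closure_\<Omega>[OF x c(1)] in auto)
    with ev show "\<forall>\<^sub>F z in nhds x. \<phi> z < c'"
    proof eventually_elim
      case (elim z)
      then have "c *\<^sub>R sgn z \<notin> \<Omega>" using closure_subset by blast
      then show ?case using scaleR_sgn_in_\<Omega>[OF elim(1) c0] c(2) by simp
    qed
  qed
  then show "isCont \<phi> x" unfolding continuous_at by (rule tendsto_mono[rotated]) (simp add: at_within_def)
qed

lemma measurable_\<phi>[measurable]: "\<phi> \<in> borel_measurable borel"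
proof -
  have "\<phi> \<in> borel_measurable (restrict_space borel (- {0}))"
    by (rule borel_measurable_continuous_on_restrict[OF continuous_on_\<phi>])
  then have "(\<lambda>x. indicator (- {0}) x *\<^sub>R \<phi> x) \<in> borel_measurable borel"
    by (subst (asm) borel_measurable_restrict_space_iff) auto
  moreover have "(\<lambda>x::'a. indicator {0} x *\<^sub>R \<phi> 0) \<in> borel_measurable borel" by simp
  ultimately have "(\<lambda>x. indicator (- {0}) x *\<^sub>R \<phi> x + indicator {0} x *\<^sub>R \<phi> 0) \<in> borel_measurable borel"
    by (rule borel_measurable_add)
  moreover have "\<phi> = (\<lambda>x. indicator (- {0}) x *\<^sub>R \<phi> x + indicator {0} x *\<^sub>R \<phi> 0)"
    by (auto simp: indicator_def fun_eq_iff)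
  ultimately show ?thesis by simp
qed

lemma measurable_\<Omega>[measurable]: "\<Omega> \<in> sets borel"
  using open_\<Omega> by simp

text \<open>A uniform distance, measured along rays, of \<open>C\<close> from the origin and from
  the boundary. The last property concerns all directions, so that [\<delta>, \<phi>(y) - \<delta>]
  is a genuine interval even on rays that miss \<open>C\<close>.\<close>

lemma compact_gap:
  assumes "compact C" "C \<subseteq> \<Omega>" "0 \<notin> C"
  obtains \<delta> where "\<delta> > 0" "\<And>x. x \<in> C \<Longrightarrow> \<delta> < norm x \<and> norm x < \<phi> x - \<delta>" "\<And>x. x \<noteq> 0 \<Longrightarrow> 2 * \<delta> < \<phi> x"
proof -
  obtain \<rho> R where \<rho>: "0 < \<rho>" "\<And>x. x \<noteq> 0 \<Longrightarrow> \<rho> \<le> \<phi> x \<and> \<phi> x \<le> R" using \<phi>_bounds by metis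
  show ?thesis
  proof (cases "C = {}")
    case True
    show ?thesis
    proof (rule that)
      show "0 < \<rho> / 3" "x \<in> C \<Longrightarrow> \<rho> / 3 < norm x \<and> norm x < \<phi> x - \<rho> / 3" for x
        using \<rho>(1) True by auto
      show "2 * (\<rho> / 3) < \<phi> x" if "x \<noteq> 0" for x using \<rho>(1) \<rho>(2)[OF that] by linarith
    qed
  next
    case False
    have "continuous_on C (\<lambda>x. min (norm x) (\<phi> x - norm x))"
      using assms(3) by (intro continuous_intros continuous_on_subset[OF continuous_on_\<phi>]) auto
    then obtain z where z: "z \<in> C" "\<And>x. x \<in> C \<Longrightarrow> min (norm z) (\<phi> z - norm z) \<le> min (norm x) (\<phi> x - norm x)"
      using continuous_attains_inf[OF assms(1) False] by blast
    have "min (norm z) (\<phi> z - norm z) > 0" using z(1) assms by (auto simp: \<Omega>_def)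
    define \<mu> where "\<mu> = min (norm z) (\<phi> z - norm z)"
    define \<delta> where "\<delta> = min \<mu> \<rho> / 3"
    have "\<mu> > 0" using \<open>min (norm z) (\<phi> z - norm z) > 0\<close> by (simp add: \<mu>_def)
    then have d: "0 < \<delta>" "\<delta> < min (norm z) (\<phi> z - norm z)" "2 * \<delta> < \<rho>"
      using \<rho>(1) unfolding \<delta>_def \<mu>_def[symmetric] by (cases "\<mu> \<le> \<rho>"; simp)+
    show ?thesis
    proof (rule that[OF d(1)])
      show "\<delta> < norm x \<and> norm x < \<phi> x - \<delta>" if "x \<in> C" for x using z(2)[OF that] d(2) by linarith
      show "2 * \<delta> < \<phi> x" if "x \<noteq> 0" for x using \<rho>(2)[OF that] d(3) by linarith
    qed
  qed
qed

end

section \<open>Radial derivatives\<close>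

text \<open>An antiderivative is - (c^a - r^a)^(\<beta> + 1) / (a (\<beta> + 1)). For negative
  \<beta> the integrand is unbounded at r = c, so the fundamental theorem is used on the open
  interval with one-sided limits; \<beta> > -1 makes the limit at \<open>c\<close> zero.\<close>

lemma nn_integral_power_difference:
  fixes a c \<beta> :: real
  assumes a: "a > 0" and c: "c > 0" and \<beta>: "\<beta> > -1"
  shows "(\<integral>\<^sup>+r. ennreal (r powr (a - 1) * (c powr a - r powr a) powr \<beta>) * indicator {0<..<c} r \<partial>lborel)
    = ennreal (c powr (a * (\<beta> + 1)) / (a * (\<beta> + 1)))"
proof -
  define f where "f r = r powr (a - 1) * (c powr a - r powr a) powr \<beta>" for r
  define F where "F r = - ((c powr a - r powr a) powr (\<beta> + 1) / (a * (\<beta> + 1)))" for r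
  have less: "r powr a < c powr a" if "0 < r" "r < c" for r
    using that a by (simp add: powr_less_mono2)
  have F: "DERIV F r :> f r" if "0 < r" "r < c" for r
  proof -
    have "((\<lambda>r. (c powr a - r powr a) powr (\<beta> + 1)) has_real_derivative
        (\<beta> + 1) * (c powr a - r powr a) powr \<beta> * (- (a * r powr (a - 1)))) (at r)"
      using less[OF that] that by (auto intro!: derivative_eq_intros)
    from DERIV_minus[OF DERIV_cdivide[OF this, of "a * (\<beta> + 1)"]] show ?thesis unfolding F_def f_def
      by (rule DERIV_cong) (use a \<beta> in simp)
  qed
  have cf: "isCont f r" if "0 < r" "r < c" for r
    unfolding f_def using less[OF that] that by (intro continuous_intros) auto
  have A: "(F \<longlongrightarrow> - (c powr (a * (\<beta> + 1)) / (a * (\<beta> + 1)))) (at_right 0)"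
  proof -
    have lim0: "((\<lambda>r. r powr a) \<longlongrightarrow> 0 powr a) (at_right 0)"
      using a by (intro tendsto_powr' tendsto_intros) (auto simp: eventually_at_filter)
    then have "(F \<longlongrightarrow> - ((c powr a - 0 powr a) powr (\<beta> + 1) / (a * (\<beta> + 1)))) (at_right 0)"
      unfolding F_def using a \<beta> c
      by (intro tendsto_minus tendsto_divide tendsto_powr[OF tendsto_diff[OF tendsto_const lim0]] tendsto_const) auto
    then show ?thesis using a by (simp add: powr_powr)
  qed
  have B: "(F \<longlongrightarrow> 0) (at_left c)"
  proof -
    have "((\<lambda>r. (c powr a - r powr a) powr (\<beta> + 1)) \<longlongrightarrow> (c powr a - c powr a) powr (\<beta> + 1)) (at_left c)"
    proof (rule tendsto_powr')
      show "((\<lambda>r. c powr a - r powr a) \<longlongrightarrow> c powr a - c powr a) (at_left c)"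
        using c by (intro tendsto_intros) auto
      show "c powr a - c powr a \<noteq> 0 \<or> 0 < \<beta> + 1 \<and> (\<forall>\<^sub>F x in at_left c. 0 \<le> c powr a - x powr a)"
        using \<beta> eventually_at_left_real[OF c] by (auto elim!: eventually_mono dest: less)
    qed auto
    then have "(F \<longlongrightarrow> - ((c powr a - c powr a) powr (\<beta> + 1) / (a * (\<beta> + 1)))) (at_left c)"
      unfolding F_def using a \<beta> by (intro tendsto_minus tendsto_divide tendsto_const) auto
    then show ?thesis by simp
  qed
  note I = interval_integral_FTC_nonneg[of "ereal 0" "ereal c" F f, unfolded ereal_tendsto_simps, OF _ _ _ _ A B]
  have "set_integrable lborel (einterval (ereal 0) (ereal c)) f"
    by (rule I(1)) (use c F cf in \<open>auto simp: f_def intro!: AE_I2\<close>)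
  moreover have "(LBINT r=ereal 0..ereal c. f r) = 0 - - (c powr (a * (\<beta> + 1)) / (a * (\<beta> + 1)))"
    by (rule I(2)) (use c F cf in \<open>auto simp: f_def intro!: AE_I2\<close>)
  ultimately have "integrable lborel (\<lambda>r. indicator {0<..<c} r *\<^sub>R f r)"
    "(LINT r|lborel. indicator {0<..<c} r *\<^sub>R f r) = c powr (a * (\<beta> + 1)) / (a * (\<beta> + 1))"
    using c by (simp_all add: interval_lebesgue_integral_def set_integrable_def set_lebesgue_integral_def)
  then have "(\<integral>\<^sup>+r. ennreal (indicator {0<..<c} r *\<^sub>R f r) \<partial>lborel) = ennreal (c powr (a * (\<beta> + 1)) / (a * (\<beta> + 1)))"
    by (subst nn_integral_eq_integral) (auto simp: f_def)
  moreover have "ennreal (indicator {0<..<c} r *\<^sub>R f r) = ennreal (f r) * indicator {0<..<c} r" for r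
    by (auto simp: indicator_def)
  ultimately show ?thesis by (simp add: f_def)
qed

text \<open>Measurability is only implicit in the local integrability of \<open>g\<close>, so it is
  assembled as a pointwise limit over an exhaustion of \<Omega> by compact sets; off \<Omega> the
  values of \<open>g\<close> are arbitrary.\<close>

lemma weak_gradient_measurable:
  fixes g :: "'a::euclidean_space \<Rightarrow> 'a"
  assumes "open \<Omega>" "is_weak_gradient \<Omega> u g"
  shows "(\<lambda>x. indicator \<Omega> x *\<^sub>R g x) \<in> borel_measurable borel"
proof -
  obtain C :: "nat \<Rightarrow> 'a set" where C: "\<And>n. compact (C n)" "\<And>n. C n \<subseteq> \<Omega>"
    "\<And>n. C n \<subseteq> interior (C (Suc n))" "\<Union> (range C) = \<Omega>"
    "\<And>K. \<lbrakk>compact K; K \<subseteq> \<Omega>\<rbrakk> \<Longrightarrow> \<exists>N. \<forall>n\<ge>N. K \<subseteq> C n"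
    by (rule open_Union_compact_subsets[OF \<open>open \<Omega>\<close>]) (rule that; assumption)
  show ?thesis
  proof (rule borel_measurable_LIMSEQ_metric)
    fix i
    have "set_integrable lborel (C i) g"
      using assms(2) conjI[OF C(1)[of i] C(2)[of i]] unfolding is_weak_gradient_def by simp
    then show "(\<lambda>x. indicat_real (C i) x *\<^sub>R g x) \<in> borel_measurable borel"
      unfolding set_integrable_def using borel_measurable_integrable by fastforce
  next
    fix x :: 'a
    show "(\<lambda>i. indicat_real (C i) x *\<^sub>R g x) \<longlonglongrightarrow> indicat_real \<Omega> x *\<^sub>R g x"
    proof (cases "x \<in> \<Omega>")
      case True
      then obtain N where "\<forall>n\<ge>N. {x} \<subseteq> C n" using C(5)[of "{x}"] by auto
      then show ?thesis
        using True by (intro tendsto_eventually) (auto simp: eventually_sequentially indicator_def)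
    next
      case False
      then have "x \<notin> C i" for i using C(2) by blast
      then show ?thesis using False by simp
    qed
  qed
qed

text \<open>Testing against \<open>x\<^sub>b \<psi>\<close> and summing over the coordinates \<open>b\<close>.\<close>
lemma weak_gradient_radial_identity:
  fixes u :: "'a::euclidean_space \<Rightarrow> real"
  assumes g: "is_weak_gradient \<Omega> u g" and \<psi>: "\<psi> \<in> smooth_terms UNIV" "\<psi> \<in> test_functions \<Omega>"
  shows "(LINT x:\<Omega>|lborel. u x * (real DIM('a) * \<psi> x + x \<bullet> grad \<psi> x)) = - (LINT x:\<Omega>|lborel. (x \<bullet> g x) * \<psi> x)"
proof -
  obtain C where C: "compact C" "C \<subseteq> \<Omega>" "\<And>x. x \<notin> C \<Longrightarrow> \<psi> x = 0 \<and> grad \<psi> x = 0"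
    using test_functionsD(4)[OF \<psi>(2)] by blast
  note c\<psi> = test_functionsD(2,3)[OF \<psi>(2)]
  have uC: "set_integrable lborel C u" and gC: "set_integrable lborel C g"
    using g C unfolding is_weak_gradient_def by blast+
  have gCb: "set_integrable lborel C (\<lambda>x. g x \<bullet> b)" for b
  proof -
    have "integrable lborel (\<lambda>x. (indicator C x *\<^sub>R g x) \<bullet> b)"
      using gC unfolding set_integrable_def by (intro integrable_inner_left) auto
    then show ?thesis by (simp add: set_integrable_def)
  qed
  have int: "set_integrable lborel \<Omega> (\<lambda>x. h x * \<eta> x)"
    if "set_integrable lborel C h" "continuous_on UNIV \<eta>" "\<And>x. x \<notin> C \<Longrightarrow> \<eta> x = 0" for h \<eta> :: "'a \<Rightarrow> real"
    by (rule set_integrable_mult_compact_support(1)[OF that(1) C(1,2) continuous_on_subset[OF that(2)]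
        borel_measurable_continuous_onI[OF that(2)] that(3)]) auto
  have b: "(LINT x:\<Omega>|lborel. u x * (\<psi> x + (x \<bullet> b) * (grad \<psi> x \<bullet> b))) = - (LINT x:\<Omega>|lborel. (g x \<bullet> b) * ((x \<bullet> b) * \<psi> x))"
    if b: "b \<in> Basis" for b
  proof -
    have st: "(\<lambda>x. (x \<bullet> b) * \<psi> x) \<in> smooth_terms UNIV"
      by (intro smooth_terms.mult smooth_terms.inner \<psi>(1))
    have t: "(\<lambda>x. (x \<bullet> b) * \<psi> x) \<in> test_functions \<Omega>"
      by (rule test_functions_smooth_terms[OF open_UNIV C(1) _ C(2) st]) (use C(3) in auto)
    have "GDERIV (\<lambda>x. x \<bullet> b) x :> b" for x
      unfolding gderiv_def by (auto intro!: derivative_eq_intros)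
    then have "grad (\<lambda>x. (x \<bullet> b) * \<psi> x) x = (x \<bullet> b) *\<^sub>R grad \<psi> x + \<psi> x *\<^sub>R b" for x
      by (intro grad_eqI GDERIV_mult test_functionsD(1)[OF \<psi>(2)])
    then have "grad (\<lambda>x. (x \<bullet> b) * \<psi> x) x \<bullet> b = \<psi> x + (x \<bullet> b) * (grad \<psi> x \<bullet> b)" for x
      using b by (simp add: inner_add_left)
    moreover have "(LINT x:\<Omega>|lborel. u x * (grad (\<lambda>x. (x \<bullet> b) * \<psi> x) x \<bullet> b)) =
        - (LINT x:\<Omega>|lborel. (g x \<bullet> b) * ((x \<bullet> b) * \<psi> x))"
      using g t b unfolding is_weak_gradient_def by blast
    ultimately show ?thesis by simp
  qed
  \<comment> \<open>Each coordinate contributes \<psi> once, so the sum over the basis produces the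
    dimension as a factor, while the remaining terms add up to x \<bullet> grad \<psi>.\<close>
  have "(LINT x:\<Omega>|lborel. u x * (real DIM('a) * \<psi> x + x \<bullet> grad \<psi> x)) = 
    (LINT x:\<Omega>|lborel. (\<Sum>b\<in>Basis. u x * (\<psi> x + (x \<bullet> b) * (grad \<psi> x \<bullet> b))))"
  proof -
    have "u x * (real DIM('a) * \<psi> x + x \<bullet> grad \<psi> x) = (\<Sum>b\<in>Basis. u x * (\<psi> x + (x \<bullet> b) * (grad \<psi> x \<bullet> b)))" for x
      unfolding sum_distrib_left[symmetric] sum.distrib euclidean_inner[of x "grad \<psi> x"] by simp
    then show ?thesis by simp
  qed
  also have "\<dots> = (\<Sum>b\<in>Basis. (LINT x:\<Omega>|lborel. u x * (\<psi> x + (x \<bullet> b) * (grad \<psi> x \<bullet> b))))"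
    unfolding set_lebesgue_integral_def scaleR_sum_right
    by (rule Bochner_Integration.integral_sum)
       (fold set_integrable_def, rule int[OF uC], use C(3) in \<open>auto intro!: continuous_intros c\<psi>\<close>)
  also have "\<dots> = - (\<Sum>b\<in>Basis. (LINT x:\<Omega>|lborel. (g x \<bullet> b) * ((x \<bullet> b) * \<psi> x)))"
    by (simp add: b sum_negf)
  also have "(\<Sum>b\<in>Basis. (LINT x:\<Omega>|lborel. (g x \<bullet> b) * ((x \<bullet> b) * \<psi> x))) = 
      (LINT x:\<Omega>|lborel. (\<Sum>b\<in>Basis. (g x \<bullet> b) * ((x \<bullet> b) * \<psi> x)))"
    unfolding set_lebesgue_integral_def scaleR_sum_right
    by (rule Bochner_Integration.integral_sum[symmetric])
       (fold set_integrable_def, rule int[OF gCb], use C(3) in \<open>auto intro!: continuous_intros c\<psi>\<close>)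
  also have "\<dots> = (LINT x:\<Omega>|lborel. (x \<bullet> g x) * \<psi> x)"
  proof -
    have "(\<Sum>b\<in>Basis. (g x \<bullet> b) * ((x \<bullet> b) * \<psi> x)) = (x \<bullet> g x) * \<psi> x" for x
      unfolding euclidean_inner[of x "g x"] sum_distrib_right by (simp add: mult_ac)
    then show ?thesis by simp
  qed
  finally show ?thesis .
qed

section \<open>The radial part of the weak gradient of the extremal functions\<close>

context star_domain
begin

lemma u_ext_ray:
  assumes "homogeneous0 \<Phi>" "norm y = 1" "r > 0"
  shows "u_ext \<phi> m l k \<Phi> (r *\<^sub>R y) = (\<phi> y powr (m + l) - r powr (m + l)) powr k * \<Phi> y"
  using assms by (simp add: u_ext_def \<phi>_scale homogeneous0_def)

text \<open>This is the Euler derivative r d/dr of \<open>u_ext\<close>, the candidate for x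
  \<bullet> g; it is not divided by the norm of x.\<close>

definition radial_u_ext :: "real \<Rightarrow> real \<Rightarrow> real \<Rightarrow> ('a \<Rightarrow> real) \<Rightarrow> 'a \<Rightarrow> real" where
  "radial_u_ext m l k \<Phi> x =
     - (k * (m + l) * norm x powr (m + l) * (\<phi> x powr (m + l) - norm x powr (m + l)) powr (k - 1) * \<Phi> x)"

lemma radial_derivative_u_ext:
  assumes a: "m + l > 0" and \<Phi>: "homogeneous0 \<Phi>" and y: "norm y = 1" and r: "0 < r" "r < \<phi> y"
  shows "((\<lambda>r. u_ext \<phi> m l k \<Phi> (r *\<^sub>R y)) has_real_derivative radial_u_ext m l k \<Phi> (r *\<^sub>R y) / r) (at r)"
proof -
  have "r powr (m + l) < \<phi> y powr (m + l)" using r a by (simp add: powr_less_mono2)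
  then have "((\<lambda>r. (\<phi> y powr (m + l) - r powr (m + l)) powr k * \<Phi> y) has_real_derivative
      k * (\<phi> y powr (m + l) - r powr (m + l)) powr (k - 1) * (- ((m + l) * r powr (m + l - 1))) * \<Phi> y) (at r)"
    using r by (auto intro!: derivative_eq_intros)
  moreover have "k * (\<phi> y powr (m + l) - r powr (m + l)) powr (k - 1) * (- ((m + l) * r powr (m + l - 1))) * \<Phi> y
      = radial_u_ext m l k \<Phi> (r *\<^sub>R y) / r"
    using r y \<Phi> by (simp add: radial_u_ext_def \<phi>_scale homogeneous0_def powr_diff field_simps)
  ultimately have "((\<lambda>r. (\<phi> y powr (m + l) - r powr (m + l)) powr k * \<Phi> y) has_real_derivative
      radial_u_ext m l k \<Phi> (r *\<^sub>R y) / r) (at r)" by simp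
  then show ?thesis
    by (rule has_field_derivative_transform_within_open[of _ _ _ "{0<..}"])
       (use r u_ext_ray[OF \<Phi> y] in auto)
qed

text \<open>Both sides define the same distribution off the origin. The radial identity expresses
  the integral of (x \<bullet> g) \<psi> through u and \<psi>; on the other hand r^(n - 1) (u (n
  \<psi> + x \<bullet> grad \<psi>) + V \<psi>) is, on each ray, the derivative of r^n u \<psi> and
  integrates to zero. The origin is removed because continuity of \<phi> is available only off
  it.\<close>

lemma radial_weak_gradient_u_ext:
  fixes \<Phi> :: "'a \<Rightarrow> real"
  assumes a: "m + l > 0" and \<Phi>: "homogeneous0 \<Phi>" and m\<Phi>[measurable]: "\<Phi> \<in> borel_measurable borel"
    and g: "is_weak_gradient \<Omega> (u_ext \<phi> m l k \<Phi>) g"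
  shows "AE x in lborel. x \<in> \<Omega> - {0} \<longrightarrow> x \<bullet> g x = radial_u_ext m l k \<Phi> x"
proof -
  let ?u = "u_ext \<phi> m l k \<Phi>" and ?V = "radial_u_ext m l k \<Phi>"
  define \<Omega>' where "\<Omega>' = \<Omega> - {0}"
  have o': "open \<Omega>'" unfolding \<Omega>'_def using open_\<Omega> by auto
  \<comment> \<open>The logarithmic radial derivative: V = u \<eta> with \<eta> continuous on
    \<Omega> minus the origin, so V inherits local integrability from u without any local bound on
    \<Phi>.\<close>
  define \<eta> where "\<eta> x = - (k * (m + l) * norm x powr (m + l) / (\<phi> x powr (m + l) - norm x powr (m + l)))" for x
  have less: "norm x powr (m + l) < \<phi> x powr (m + l)" if "x \<in> \<Omega>" for x
    using that a by (auto simp: \<Omega>_def intro: powr_less_mono2)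
  have V: "?V x = ?u x * \<eta> x" if "x \<in> \<Omega>" for x
    using less[OF that] by (simp add: radial_u_ext_def u_ext_def \<eta>_def powr_diff field_simps)
  have c\<eta>: "continuous_on C \<eta>" if "C \<subseteq> \<Omega>'" for C
    unfolding \<eta>_def using that less pos
    by (intro continuous_intros continuous_on_subset[OF continuous_on_\<phi>]) (fastforce simp: \<Omega>'_def)+
  have intV: "integrable lborel (\<lambda>x. (indicator C x * ?V x) * \<zeta> x)"
    if C: "compact C" "C \<subseteq> \<Omega>'" and \<zeta>: "continuous_on UNIV \<zeta>" for C \<zeta>
  proof -
    have uC: "set_integrable lborel C ?u"
      using g C unfolding is_weak_gradient_def \<Omega>'_def by blast
    have 1: "continuous_on C (\<lambda>x. indicator C x * \<eta> x * \<zeta> x)"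
      by (rule continuous_on_eq[of _ "\<lambda>x. \<eta> x * \<zeta> x"])
         (auto intro!: continuous_intros c\<eta> C continuous_on_subset[OF \<zeta>])
    have "C \<in> sets borel" using C(1) by (simp add: borel_compact)
    then have 2: "(\<lambda>x. indicator C x * \<eta> x * \<zeta> x) \<in> borel_measurable borel"
      unfolding \<eta>_def using borel_measurable_continuous_onI[OF \<zeta>] by simp
    have "integrable lborel (\<lambda>x. ?u x * (indicator C x * \<eta> x * \<zeta> x))"
      by (rule set_integrable_mult_compact_support(2)[OF uC C(1) subset_refl 1 2]) simp
    moreover have "(\<lambda>x. ?u x * (indicator C x * \<eta> x * \<zeta> x)) = (\<lambda>x. (indicator C x * ?V x) * \<zeta> x)"
      using V C(2) by (auto simp: indicator_def \<Omega>'_def fun_eq_iff)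
    ultimately show ?thesis by simp
  qed
  have intg: "set_integrable lborel C (\<lambda>x. x \<bullet> g x)" if C: "compact C" "C \<subseteq> \<Omega>'" for C
  proof -
    have gC: "integrable lborel (\<lambda>x. indicator C x *\<^sub>R g x)"
      using g C unfolding is_weak_gradient_def \<Omega>'_def set_integrable_def by blast
    obtain R where R: "\<And>x. x \<in> C \<Longrightarrow> norm x \<le> R" using compact_imp_bounded[OF C(1)] unfolding bounded_iff by auto
    have "integrable lborel (\<lambda>x. x \<bullet> (indicator C x *\<^sub>R g x))"
    proof (rule Bochner_Integration.integrable_bound)
      show "integrable lborel (\<lambda>x. R *\<^sub>R (indicator C x *\<^sub>R g x))" using gC by (rule integrable_scaleR_right)
      show "(\<lambda>x. x \<bullet> (indicator C x *\<^sub>R g x)) \<in> borel_measurable lborel"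
        using borel_measurable_integrable[OF gC] by (intro borel_measurable_inner) auto
      show "AE x in lborel. norm (x \<bullet> (indicator C x *\<^sub>R g x)) \<le> norm (R *\<^sub>R (indicator C x *\<^sub>R g x))"
      proof (rule AE_I2)
        fix x
        have "\<bar>x \<bullet> g x\<bar> \<le> \<bar>R\<bar> * norm (g x)" if "x \<in> C"
        proof -
          have "norm x \<le> \<bar>R\<bar>" using R[OF that] by linarith
          then show ?thesis
            using Cauchy_Schwarz_ineq2[of x "g x"] mult_right_mono[of "norm x" "\<bar>R\<bar>" "norm (g x)"] by simp
        qed
        then show "norm (x \<bullet> (indicator C x *\<^sub>R g x)) \<le> norm (R *\<^sub>R (indicator C x *\<^sub>R g x))"
          by (auto simp: indicator_def)
      qed
    qed
    then show ?thesis by (simp add: set_integrable_def)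
  qed
  have "AE x in lborel. x \<in> \<Omega>' \<longrightarrow> x \<bullet> g x - ?V x = 0"
  proof (rule fundamental_lemma_calculus_of_variations[OF o'])
    fix C assume C: "compact C" "C \<subseteq> \<Omega>'"
    have "set_integrable lborel C ?V" using intV[OF C, of "\<lambda>x. 1"] by (simp add: set_integrable_def)
    then show "set_integrable lborel C (\<lambda>x. x \<bullet> g x - ?V x)"
      by (rule set_integral_diff(1)[OF intg[OF C]])
  next
    fix \<psi> :: "'a \<Rightarrow> real" assume st: "\<psi> \<in> smooth_terms UNIV" and t': "\<psi> \<in> test_functions \<Omega>'"
    have t: "\<psi> \<in> test_functions \<Omega>" using t' unfolding test_functions_def \<Omega>'_def by blast
    obtain C where C: "compact C" "C \<subseteq> \<Omega>'" "\<And>x. x \<notin> C \<Longrightarrow> \<psi> x = 0 \<and> grad \<psi> x = 0"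
      using test_functionsD(4)[OF t'] by blast
    note c\<psi> = test_functionsD(2,3)[OF t]
    have uC: "set_integrable lborel C ?u"
      using g C unfolding is_weak_gradient_def \<Omega>'_def by blast
    have i1: "integrable lborel (\<lambda>x. ?u x * (real DIM('a) * \<psi> x + x \<bullet> grad \<psi> x))"
      by (rule set_integrable_mult_compact_support(2)[OF uC C(1) subset_refl])
         (use C(3) in \<open>auto intro!: continuous_intros borel_measurable_continuous_onI continuous_on_subset[OF c\<psi>(1)] continuous_on_subset[OF c\<psi>(2)]\<close>)
    have Cz: "(indicator C x * h) * \<psi> x = h * \<psi> x" for x h
      using C(3)[of x] by (auto simp: indicator_def)
    have i2: "integrable lborel (\<lambda>x. ?V x * \<psi> x)"
      using intV[OF C(1,2) c\<psi>(1)] by (simp add: Cz)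
    have i3: "integrable lborel (\<lambda>x. (x \<bullet> g x) * \<psi> x)"
      by (rule set_integrable_mult_compact_support(2)[OF intg[OF C(1,2)] C(1) subset_refl])
         (use C(3) in \<open>auto intro!: borel_measurable_continuous_onI continuous_on_subset[OF c\<psi>(1)]\<close>)
    have "0 \<notin> C" "C \<subseteq> \<Omega>" using C(2) by (auto simp: \<Omega>'_def)
    then obtain \<delta> where \<delta>: "\<delta> > 0" "\<And>x. x \<in> C \<Longrightarrow> \<delta> < norm x \<and> norm x < \<phi> x - \<delta>" "\<And>x. x \<noteq> 0 \<Longrightarrow> 2 * \<delta> < \<phi> x"
      using compact_gap[OF C(1)] by metis
    have "(LINT x|lborel. ?u x * (real DIM('a) * \<psi> x + x \<bullet> grad \<psi> x) + ?V x * \<psi> x) = 0"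
    proof (rule integral_zero_if_ray_integrals_zero)
      show "integrable lborel (\<lambda>x. ?u x * (real DIM('a) * \<psi> x + x \<bullet> grad \<psi> x) + ?V x * \<psi> x)"
        using i1 i2 by (rule Bochner_Integration.integrable_add)
      fix y :: 'a assume y: "norm y = 1"
      then have "y \<noteq> 0" by auto
      define F where "F r = r ^ (DIM('a) - 1) * (?u (r *\<^sub>R y) * (real DIM('a) * \<psi> (r *\<^sub>R y) + (r *\<^sub>R y) \<bullet> grad \<psi> (r *\<^sub>R y)) + ?V (r *\<^sub>R y) * \<psi> (r *\<^sub>R y))" for r
      \<comment> \<open>\<open>f\<close> is a primitive of \<open>F\<close> along the ray. It
        vanishes at both ends of [\<delta>, \<phi>(y) - \<delta>], outside which \<psi> is
        zero.\<close>
      define f where "f r = r ^ DIM('a) * (?u (r *\<^sub>R y) * \<psi> (r *\<^sub>R y))" for r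
      have out: "\<psi> (r *\<^sub>R y) = 0 \<and> grad \<psi> (r *\<^sub>R y) = 0" if "r > 0" "r \<le> \<delta> \<or> r \<ge> \<phi> y - \<delta>" for r
      proof (rule C(3))
        show "r *\<^sub>R y \<notin> C" using \<delta>(2)[of "r *\<^sub>R y"] that y by (auto simp: \<phi>_scale)
      qed
      have d2: "\<delta> \<le> \<phi> y - \<delta>" using \<delta>(3)[OF \<open>y \<noteq> 0\<close>] by simp
      have "has_bochner_integral lborel (\<lambda>r. F r * indicator {\<delta>..\<phi> y - \<delta>} r) (f (\<phi> y - \<delta>) - f \<delta>)"
      proof (rule has_bochner_integral_FTC_Icc_real[OF d2])
        fix r assume "\<delta> \<le> r" "r \<le> \<phi> y - \<delta>"
        then have r: "0 < r" "r < \<phi> y" using \<delta>(1) by auto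
        have du: "((\<lambda>r. ?u (r *\<^sub>R y)) has_real_derivative ?V (r *\<^sub>R y) / r) (at r)"
          by (rule radial_derivative_u_ext[OF a \<Phi> y r])
        have d\<psi>: "((\<lambda>r. \<psi> (r *\<^sub>R y)) has_real_derivative y \<bullet> grad \<psi> (r *\<^sub>R y)) (at r)"
          by (rule GDERIV_ray[OF test_functionsD(1)[OF t]])
        have pw: "r ^ DIM('a) = r * r ^ (DIM('a) - 1)"
          by (metis DIM_positive One_nat_def Suc_pred power_Suc)
        have "(f has_real_derivative real DIM('a) * r ^ (DIM('a) - 1) * (?u (r *\<^sub>R y) * \<psi> (r *\<^sub>R y)) + 
            (?V (r *\<^sub>R y) / r * \<psi> (r *\<^sub>R y) + (y \<bullet> grad \<psi> (r *\<^sub>R y)) * ?u (r *\<^sub>R y)) * r ^ DIM('a)) (at r)"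
          unfolding f_def by (intro DERIV_mult DERIV_cong[OF DERIV_pow] du d\<psi>) simp
        then show "(f has_real_derivative F r) (at r)"
          by (rule DERIV_cong) (use r in \<open>simp add: F_def pw field_simps\<close>)
        have less: "r powr (m + l) < \<phi> y powr (m + l)" using r a by (simp add: powr_less_mono2)
        have cV: "isCont (\<lambda>r. ?V (r *\<^sub>R y)) r"
        proof -
          have "isCont (\<lambda>r. - (k * (m + l) * r powr (m + l) * (\<phi> y powr (m + l) - r powr (m + l)) powr (k - 1) * \<Phi> y)) r"
            using r less by (intro continuous_intros) auto
          moreover have "\<forall>\<^sub>F s in nhds r. - (k * (m + l) * s powr (m + l) * (\<phi> y powr (m + l) - s powr (m + l)) powr (k - 1) * \<Phi> y) = ?V (s *\<^sub>R y)"
          proof -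
            have "\<forall>\<^sub>F s in nhds r. s \<in> {0<..}" by (rule eventually_nhds_in_open) (use r in auto)
            then show ?thesis
              by eventually_elim (use y \<Phi> in \<open>simp add: radial_u_ext_def \<phi>_scale homogeneous0_def\<close>)
          qed
          ultimately show ?thesis by (simp add: isCont_cong)
        qed
        have cg: "isCont (\<lambda>r. grad \<psi> (r *\<^sub>R y)) r"
          using c\<psi>(2) by (intro continuous_at_compose[unfolded o_def, of r "\<lambda>r. r *\<^sub>R y" "grad \<psi>"] continuous_intros)
            (auto simp: continuous_on_eq_continuous_at)
        show "isCont F r"
          unfolding F_def by (intro continuous_intros cV cg DERIV_isCont[OF du] DERIV_isCont[OF d\<psi>])
      qed
      moreover have "f (\<phi> y - \<delta>) = 0" "f \<delta> = 0"
        unfolding f_def using out[of "\<phi> y - \<delta>"] out[of \<delta>] \<delta>(1) d2 by auto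
      moreover have "F r * indicator {\<delta>..\<phi> y - \<delta>} r = indicator {0<..} r * F r" for r
        using out[of r] \<delta>(1) by (cases "r > 0"; cases "\<delta> \<le> r \<and> r \<le> \<phi> y - \<delta>") (auto simp: F_def)
      ultimately have "has_bochner_integral lborel (\<lambda>r. indicator {0<..} r * F r) 0" by simp
      then show "has_bochner_integral lborel (\<lambda>r. indicator {0<..} r * (r ^ (DIM('a) - 1) *
          (?u (r *\<^sub>R y) * (real DIM('a) * \<psi> (r *\<^sub>R y) + (r *\<^sub>R y) \<bullet> grad \<psi> (r *\<^sub>R y)) + ?V (r *\<^sub>R y) * \<psi> (r *\<^sub>R y)))) 0"
        unfolding F_def by simp
    qed
    then have "(LINT x|lborel. ?u x * (real DIM('a) * \<psi> x + x \<bullet> grad \<psi> x)) = - (LINT x|lborel. ?V x * \<psi> x)"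
      by (simp add: Bochner_Integration.integral_add[OF i1 i2])
    moreover have "(LINT x|lborel. ?u x * (real DIM('a) * \<psi> x + x \<bullet> grad \<psi> x)) = - (LINT x|lborel. (x \<bullet> g x) * \<psi> x)"
    proof -
      have z: "x \<notin> \<Omega> \<Longrightarrow> \<psi> x = 0 \<and> grad \<psi> x = 0" for x using C(3)[of x] \<open>C \<subseteq> \<Omega>\<close> by blast
      have "(LINT x:\<Omega>|lborel. ?u x * (real DIM('a) * \<psi> x + x \<bullet> grad \<psi> x)) = (LINT x|lborel. ?u x * (real DIM('a) * \<psi> x + x \<bullet> grad \<psi> x))"
        "(LINT x:\<Omega>|lborel. (x \<bullet> g x) * \<psi> x) = (LINT x|lborel. (x \<bullet> g x) * \<psi> x)"
        by (intro set_integral_eq_integral_support; simp add: z)+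
      then show ?thesis using weak_gradient_radial_identity[OF g st t] by simp
    qed
    moreover have "(LINT x:\<Omega>'|lborel. (x \<bullet> g x - ?V x) * \<psi> x) = (LINT x|lborel. (x \<bullet> g x) * \<psi> x - ?V x * \<psi> x)"
    proof (subst set_integral_eq_integral_support)
      show "x \<notin> \<Omega>' \<Longrightarrow> (x \<bullet> g x - ?V x) * \<psi> x = 0" for x using C(2) C(3)[of x] by auto
    qed (simp add: left_diff_distrib)
    ultimately show "(LINT x:\<Omega>'|lborel. (x \<bullet> g x - ?V x) * \<psi> x) = 0"
      by (simp add: Bochner_Integration.integral_diff[OF i3 i2])
  qed
  then show ?thesis by eventually_elim (simp add: \<Omega>'_def)
qed

end

section \<open>Equality for the extremal functions\<close>

locale hardy_setting = star_domain \<phi> \<Omega> for \<phi> :: "'a::euclidean_space \<Rightarrow> real" and \<Omega> +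
  fixes p p' m l a :: real
  assumes p: "p > 1" and pp': "1 / p + 1 / p' = 1"
    and m: "m = (p - real DIM('a)) / (p - 1)" and a_def: "a = m + l" and a: "a > 0"
begin

lemma p': "p' > 0" "1 / p' = 1 - 1 / p"
proof -
  show "1 / p' = 1 - 1 / p" using pp' by simp
  then have "1 / p' > 0" using p by simp
  then show "p' > 0" by (simp add: zero_less_divide_iff)
qed

text \<open>The value of \<open>m\<close> amounts to m (p - 1) = p - n; hence the weight of L
  depends only on \<open>a\<close>, \<open>p\<close> and the dimension.\<close>

lemma weight_exponent: "l * (1 - p) = a * (1 - p) + p - real DIM('a)"
proof -
  have "m * (p - 1) = p - real DIM('a)" using p by (simp add: m)
  then show ?thesis by (simp add: a_def algebra_simps)
qed

lemma powr_less_\<phi>: "x \<in> \<Omega> \<Longrightarrow> norm x powr a < \<phi> x powr a"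
  using a by (auto simp: \<Omega>_def intro: powr_less_mono2)

lemma measurable_K_integrand[measurable]:
  assumes [measurable]: "u \<in> borel_measurable borel"
  shows "K_integrand \<phi> p m l u \<in> borel_measurable borel"
  unfolding K_integrand_def by measurable

lemma measurable_u_ext[measurable]:
  assumes [measurable]: "\<Phi> \<in> borel_measurable borel"
  shows "u_ext \<phi> m l k \<Phi> \<in> borel_measurable borel"
  unfolding u_ext_def by measurable

text \<open>Off \<Omega> the chosen weak gradient may fail to be measurable, so the indicator is
  kept with the integrand.\<close>

lemma measurable_L_integrand:
  assumes "is_weak_gradient \<Omega> u g"
  shows "(\<lambda>x. indicator \<Omega> x * L_integrand \<Omega> p l u x) \<in> borel_measurable borel"
proof -
  have [measurable]: "(\<lambda>x. indicat_real \<Omega> x *\<^sub>R weak_grad \<Omega> u x) \<in> borel_measurable borel"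
    by (rule weak_gradient_measurable[OF open_\<Omega> weak_grad_AE_eq(2)[OF open_\<Omega> assms]])
  have "(\<lambda>x. indicator \<Omega> x * L_integrand \<Omega> p l u x) = (\<lambda>x. indicator \<Omega> x * (norm x powr (l * (1 - p)) *
      \<bar>(x \<bullet> (indicat_real \<Omega> x *\<^sub>R weak_grad \<Omega> u x)) / norm x\<bar> powr p))"
    by (auto simp: L_integrand_def indicator_def fun_eq_iff)
  also have "\<dots> \<in> borel_measurable borel" by measurable
  finally show ?thesis .
qed

text \<open>On each ray the integrand becomes |\<Phi>|^p r^(a - 1) (\<phi>^a - r^a)^\<beta> with
  \<beta> = (k - 1) p, and k > 1 / p' is equivalent to \<beta> > -1, the condition for convergence
  at the boundary.\<close>

lemma nn_integral_K_u_ext: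
  assumes \<Phi>: "homogeneous0 \<Phi>" and [measurable]: "\<Phi> \<in> borel_measurable borel" and k: "k > 1 / p'"
  shows "(\<integral>\<^sup>+x. ennreal (indicator \<Omega> x * K_integrand \<phi> p m l (u_ext \<phi> m l k \<Phi>) x) \<partial>lborel) =
    ennreal (1 / (a * ((k - 1) * p + 1))) * (ennreal (real DIM('a)) *
      (\<integral>\<^sup>+x. indicator (ball 0 1) x * ennreal (\<bar>\<Phi> x\<bar> powr p * \<phi> x powr (a * ((k - 1) * p + 1))) \<partial>lborel))"
proof -
  let ?n = "DIM('a)"
  define \<beta> where "\<beta> = (k - 1) * p"
  have "p * (1 / p') = p - 1" using p by (simp add: p' field_simps)
  then have \<beta>: "\<beta> > -1" using k p mult_strict_left_mono[OF k, of p] by (simp add: \<beta>_def algebra_simps)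
  have d: "a * (\<beta> + 1) > 0" using a \<beta> by simp
  have inner: "(\<integral>\<^sup>+r. indicator {0<..} r * ennreal (r ^ (?n - 1)) *
        ennreal (indicator \<Omega> (r *\<^sub>R sgn x) * K_integrand \<phi> p m l (u_ext \<phi> m l k \<Phi>) (r *\<^sub>R sgn x)) \<partial>lborel)
     = ennreal (1 / (a * (\<beta> + 1))) * ennreal (\<bar>\<Phi> x\<bar> powr p * \<phi> x powr (a * (\<beta> + 1)))"
    if x: "x \<noteq> 0" for x
  proof -
    have nx: "norm (sgn x) = 1" using x by (simp add: norm_sgn)
    have \<Phi>x: "\<Phi> (sgn x) = \<Phi> x" using \<Phi> x by (simp add: homogeneous0_def sgn_div_norm)
    have "(\<integral>\<^sup>+r. indicator {0<..} r * ennreal (r ^ (?n - 1)) *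
        ennreal (indicator \<Omega> (r *\<^sub>R sgn x) * K_integrand \<phi> p m l (u_ext \<phi> m l k \<Phi>) (r *\<^sub>R sgn x)) \<partial>lborel)
      = (\<integral>\<^sup>+r. ennreal (\<bar>\<Phi> x\<bar> powr p) * (ennreal (r powr (a - 1) * (\<phi> x powr a - r powr a) powr \<beta>) * indicator {0<..<\<phi> x} r) \<partial>lborel)"
    proof (rule nn_integral_cong)
      fix r :: real
      show "indicator {0<..} r * ennreal (r ^ (?n - 1)) *
        ennreal (indicator \<Omega> (r *\<^sub>R sgn x) * K_integrand \<phi> p m l (u_ext \<phi> m l k \<Phi>) (r *\<^sub>R sgn x)) =
        ennreal (\<bar>\<Phi> x\<bar> powr p) * (ennreal (r powr (a - 1) * (\<phi> x powr a - r powr a) powr \<beta>) * indicator {0<..<\<phi> x} r)"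
      proof (cases "0 < r \<and> r < \<phi> x")
        case True
        then have r: "0 < r" "r < \<phi> x" by auto
        have in\<Omega>: "r *\<^sub>R sgn x \<in> \<Omega>" using scaleR_sgn_in_\<Omega>[OF x r(1)] r(2) by simp
        define \<Delta> where "\<Delta> = \<phi> x powr a - r powr a"
        have \<Delta>: "\<Delta> > 0" using r a by (simp add: \<Delta>_def powr_less_mono2)
        have "K_integrand \<phi> p m l (u_ext \<phi> m l k \<Phi>) (r *\<^sub>R sgn x) =
            \<bar>\<Delta> powr k * \<Phi> x\<bar> powr p / (r powr (real ?n - a) * \<bar>\<Delta>\<bar> powr p)"
          unfolding K_integrand_def using r x nx
          by (simp add: u_ext_ray[OF \<Phi> nx r(1)] \<phi>_scale \<phi>_sgn \<Phi>x a_def \<Delta>_def algebra_simps)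
        also have "\<dots> = \<bar>\<Phi> x\<bar> powr p * (\<Delta> powr (k * p) / \<Delta> powr p) / r powr (real ?n - a)"
          using \<Delta> by (simp add: abs_mult powr_mult powr_powr mult_ac)
        also have "\<Delta> powr (k * p) / \<Delta> powr p = \<Delta> powr \<beta>"
          using \<Delta> by (simp add: \<beta>_def powr_diff[symmetric] left_diff_distrib)
        finally have K: "K_integrand \<phi> p m l (u_ext \<phi> m l k \<Phi>) (r *\<^sub>R sgn x) =
            \<bar>\<Phi> x\<bar> powr p * \<Delta> powr \<beta> / r powr (real ?n - a)" .
        have rp: "r ^ (?n - 1) / r powr (real ?n - a) = r powr (a - 1)"
        proof -
          have "r ^ (?n - 1) = r powr (real ?n - 1)"
            using r by (subst powr_realpow[symmetric]) (auto simp: of_nat_diff)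
          then show ?thesis using r by (simp add: powr_diff[symmetric])
        qed
        have "ennreal (r ^ (?n - 1)) * ennreal (K_integrand \<phi> p m l (u_ext \<phi> m l k \<Phi>) (r *\<^sub>R sgn x)) =
          ennreal (\<bar>\<Phi> x\<bar> powr p * (r ^ (?n - 1) / r powr (real ?n - a) * \<Delta> powr \<beta>))"
          unfolding K using r by (simp add: mult_ac flip: ennreal_mult)
        then show ?thesis using r in\<Omega>
          unfolding rp \<Delta>_def by (simp add: ennreal_mult)
      next
        case False
        then show ?thesis
          by (cases "r > 0") (auto simp: scaleR_sgn_in_\<Omega>[OF x])
      qed
    qed
    also have "\<dots> = ennreal (\<bar>\<Phi> x\<bar> powr p) * ennreal (\<phi> x powr (a * (\<beta> + 1)) / (a * (\<beta> + 1)))"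
      by (subst nn_integral_cmult) (simp_all add: nn_integral_power_difference[OF a pos \<beta>])
    also have "\<dots> = ennreal (1 / (a * (\<beta> + 1))) * ennreal (\<bar>\<Phi> x\<bar> powr p * \<phi> x powr (a * (\<beta> + 1)))"
      using d by (simp flip: ennreal_mult)
    finally show ?thesis .
  qed
  have "(\<integral>\<^sup>+x. ennreal (indicator \<Omega> x * K_integrand \<phi> p m l (u_ext \<phi> m l k \<Phi>) x) \<partial>lborel) =
    ennreal (real ?n) * (\<integral>\<^sup>+x. indicator (ball 0 1) x * (\<integral>\<^sup>+r. indicator {0<..} r * ennreal (r ^ (?n - 1)) *
        ennreal (indicator \<Omega> (r *\<^sub>R sgn x) * K_integrand \<phi> p m l (u_ext \<phi> m l k \<Phi>) (r *\<^sub>R sgn x)) \<partial>lborel) \<partial>lborel)"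
    by (rule nn_integral_polar) measurable
  also have "\<dots> = ennreal (real ?n) * (\<integral>\<^sup>+x. ennreal (1 / (a * (\<beta> + 1))) *
      (indicator (ball 0 1) x * ennreal (\<bar>\<Phi> x\<bar> powr p * \<phi> x powr (a * (\<beta> + 1)))) \<partial>lborel)"
  proof (rule arg_cong, rule nn_integral_cong_AE, use AE_lborel_singleton[of 0] in eventually_elim)
    fix x :: 'a assume "x \<noteq> 0"
    then show "indicator (ball 0 1) x * (\<integral>\<^sup>+r. indicator {0<..} r * ennreal (r ^ (?n - 1)) *
        ennreal (indicator \<Omega> (r *\<^sub>R sgn x) * K_integrand \<phi> p m l (u_ext \<phi> m l k \<Phi>) (r *\<^sub>R sgn x)) \<partial>lborel) =
        ennreal (1 / (a * (\<beta> + 1))) * (indicator (ball 0 1) x * ennreal (\<bar>\<Phi> x\<bar> powr p * \<phi> x powr (a * (\<beta> + 1))))"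
      by (subst inner) (simp_all add: mult_ac)
  qed
  also have "\<dots> = ennreal (1 / (a * (\<beta> + 1))) * (ennreal (real ?n) *
      (\<integral>\<^sup>+x. indicator (ball 0 1) x * ennreal (\<bar>\<Phi> x\<bar> powr p * \<phi> x powr (a * (\<beta> + 1))) \<partial>lborel))"
    by (subst nn_integral_cmult) (simp_all add: mult_ac)
  finally show ?thesis unfolding \<beta>_def .
qed

text \<open>Both integrands carry the same power of \<Delta> = \<phi>^a - r^a: differentiation
  lowers the exponent k to k - 1 in L, and division by \<Delta>^p has the same effect in K. So L is
  a constant multiple of K already under the integral sign and needs no separate
  integration.\<close>

lemma L_integrand_u_ext:
  assumes \<Phi>: "homogeneous0 \<Phi>" "\<Phi> \<in> borel_measurable borel" and g: "is_weak_gradient \<Omega> (u_ext \<phi> m l k \<Phi>) g"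
    and k: "k > 0"
  shows "AE x in lborel. indicator \<Omega> x * L_integrand \<Omega> p l (u_ext \<phi> m l k \<Phi>) x =
    (k * a) powr p * (indicator \<Omega> x * K_integrand \<phi> p m l (u_ext \<phi> m l k \<Phi>) x)"
proof -
  have a': "m + l > 0" using a by (simp add: a_def)
  have "AE x in lborel. x \<in> \<Omega> - {0} \<longrightarrow> x \<bullet> weak_grad \<Omega> (u_ext \<phi> m l k \<Phi>) x = radial_u_ext m l k \<Phi> x"
    by (rule radial_weak_gradient_u_ext[OF a' \<Phi> weak_grad_AE_eq(2)[OF open_\<Omega> g]])
  with AE_lborel_singleton[of 0] show ?thesis
  proof eventually_elim
    case (elim x)
    show ?case
    proof (cases "x \<in> \<Omega>")
      case True
      define r \<Delta> where "r = norm x" and "\<Delta> = \<phi> x powr a - norm x powr a"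
      have r: "r > 0" using elim(1) by (simp add: r_def)
      have \<Delta>: "\<Delta> > 0" using powr_less_\<phi>[OF True] by (simp add: \<Delta>_def)
      have "\<bar>(x \<bullet> weak_grad \<Omega> (u_ext \<phi> m l k \<Phi>) x) / norm x\<bar> = k * a * r powr (a - 1) * \<Delta> powr (k - 1) * \<bar>\<Phi> x\<bar>"
        using elim True r k a by (simp add: radial_u_ext_def r_def[symmetric] \<Delta>_def a_def[symmetric] abs_mult powr_diff)
      then have "L_integrand \<Omega> p l (u_ext \<phi> m l k \<Phi>) x =
        r powr (a * (1 - p) + p - real DIM('a)) * ((k * a) powr p * r powr ((a - 1) * p) * \<Delta> powr ((k - 1) * p) * \<bar>\<Phi> x\<bar> powr p)"
        using k a r \<Delta> by (simp add: L_integrand_def r_def[symmetric] weight_exponent powr_mult powr_powr)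
      also have "\<dots> = (k * a) powr p * ((r powr (a * (1 - p) + p - real DIM('a)) * r powr ((a - 1) * p)) * (\<Delta> powr ((k - 1) * p) * \<bar>\<Phi> x\<bar> powr p))"
        by (simp add: mult_ac)
      also have "r powr (a * (1 - p) + p - real DIM('a)) * r powr ((a - 1) * p) = 1 / r powr (real DIM('a) - a)"
        using r by (simp add: powr_add[symmetric] powr_minus_divide[symmetric] algebra_simps)
      also have "\<Delta> powr ((k - 1) * p) = \<Delta> powr (k * p) / \<Delta> powr p"
        using \<Delta> by (simp add: powr_diff[symmetric] left_diff_distrib)
      also have "1 / r powr (real DIM('a) - a) * (\<Delta> powr (k * p) / \<Delta> powr p * \<bar>\<Phi> x\<bar> powr p) = K_integrand \<phi> p m l (u_ext \<phi> m l k \<Phi>) x"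
        using \<Delta> r by (simp add: K_integrand_def u_ext_def r_def[symmetric] a_def[symmetric] \<Delta>_def[symmetric, folded r_def] abs_mult powr_mult powr_powr diff_diff_add)
      finally show ?thesis using True by simp
    qed simp
  qed
qed

text \<open>Factoring \<phi>^a out of \<phi>^a - \<epsilon>^a leaves (1 - (\<epsilon> /
  \<phi>)^a)^(k p), which lies between its value with the uniform lower bound \<rho> in place of
  \<phi> and 1. The spherical integral is thus squeezed between c(\<epsilon>) I and I, and the
  limsup is a limit.\<close>

lemma sphere_limsup_u_ext:
  assumes \<Phi>: "homogeneous0 \<Phi>" and [measurable]: "\<Phi> \<in> borel_measurable borel" and k: "k > 0"
    and I: "I = ennreal (real DIM('a)) *
      (\<integral>\<^sup>+x. indicator (ball 0 1) x * ennreal (\<bar>\<Phi> x\<bar> powr p * \<phi> x powr (a * ((k - 1) * p + 1))) \<partial>lborel)"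
    and fin: "I < \<infinity>"
  shows "sphere_limsup \<phi> p m l (u_ext \<phi> m l k \<Phi>) = I"
proof -
  let ?n = "DIM('a)"
  define H where "H x = ennreal (\<bar>\<Phi> x\<bar> powr p * \<phi> x powr (a * ((k - 1) * p + 1)))" for x
  have [measurable]: "H \<in> borel_measurable borel" unfolding H_def by measurable
  obtain \<rho> R where \<rho>: "0 < \<rho>" "\<And>x. x \<noteq> 0 \<Longrightarrow> \<rho> \<le> \<phi> x \<and> \<phi> x \<le> R" using \<phi>_bounds by metis
  define S where "S \<epsilon> = ennreal (\<epsilon> powr (1 - real ?n)) *
       (\<integral>\<^sup>+x. ennreal (\<bar>u_ext \<phi> m l k \<Phi> x\<bar> powr p / \<phi> x powr ((m + l) * (p - 1))) \<partial>sphere_measure \<epsilon>)" for \<epsilon>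
  define T where "T \<epsilon> x = ennreal ((1 - (\<epsilon> / \<phi> x) powr a) powr (k * p)) * H x" for \<epsilon> x
  have S: "S \<epsilon> = ennreal (real ?n) * (\<integral>\<^sup>+x. indicator (ball 0 1) x * T \<epsilon> x \<partial>lborel)" if \<epsilon>: "0 < \<epsilon>" "\<epsilon> < \<rho>" for \<epsilon>
  proof -
    have "S \<epsilon> = ennreal (\<epsilon> powr (1 - real ?n)) * (ennreal (real ?n * \<epsilon> ^ (?n - 1)) *
      (\<integral>\<^sup>+x. indicator (ball 0 1) x * ennreal (\<bar>u_ext \<phi> m l k \<Phi> (\<epsilon> *\<^sub>R sgn x)\<bar> powr p / \<phi> (\<epsilon> *\<^sub>R sgn x) powr ((m + l) * (p - 1))) \<partial>lborel))"
      unfolding S_def by (subst nn_integral_sphere_measure) auto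
    also have "(\<integral>\<^sup>+x. indicator (ball 0 1) x * ennreal (\<bar>u_ext \<phi> m l k \<Phi> (\<epsilon> *\<^sub>R sgn x)\<bar> powr p / \<phi> (\<epsilon> *\<^sub>R sgn x) powr ((m + l) * (p - 1))) \<partial>lborel)
       = (\<integral>\<^sup>+x. indicator (ball 0 1) x * T \<epsilon> x \<partial>lborel)"
    proof (rule nn_integral_cong_AE, use AE_lborel_singleton[of 0] in eventually_elim)
      fix x :: 'a assume x: "x \<noteq> 0"
      have nx: "norm (sgn x) = 1" using x by (simp add: norm_sgn)
      have \<Phi>x: "\<Phi> (sgn x) = \<Phi> x" using \<Phi> x by (simp add: homogeneous0_def sgn_div_norm)
      have f: "\<epsilon> < \<phi> x" "\<phi> x > 0" using \<rho>(2)[OF x] \<epsilon> pos by auto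
      have pw: "\<phi> x powr a - \<epsilon> powr a = \<phi> x powr a * (1 - (\<epsilon> / \<phi> x) powr a)"
        using f \<epsilon> by (simp add: powr_divide field_simps)
      have t: "1 - (\<epsilon> / \<phi> x) powr a > 0"
      proof -
        have "(\<epsilon> / \<phi> x) powr a < 1 powr a" using f \<epsilon> a by (intro powr_less_mono2) auto
        then show ?thesis by simp
      qed
      have 1: "\<bar>u_ext \<phi> m l k \<Phi> (\<epsilon> *\<^sub>R sgn x)\<bar> powr p = (1 - (\<epsilon> / \<phi> x) powr a) powr (k * p) * (\<phi> x powr (a * k * p) * \<bar>\<Phi> x\<bar> powr p)"
        using t f x \<epsilon> unfolding u_ext_ray[OF \<Phi> nx \<epsilon>(1)] \<Phi>x \<phi>_sgn[OF x] a_def[symmetric] pw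
        by (simp add: abs_mult powr_mult powr_powr mult_ac)
      \<comment> \<open>The exponent a k p from the numerator minus a (p - 1) from the weight is the
        same exponent that appears in K.\<close>
      have 2: "\<phi> x powr (a * k * p) / \<phi> x powr (a * (p - 1)) = \<phi> x powr (a * ((k - 1) * p + 1))"
        using f by (simp add: powr_diff[symmetric] algebra_simps)
      have "\<bar>u_ext \<phi> m l k \<Phi> (\<epsilon> *\<^sub>R sgn x)\<bar> powr p / \<phi> (\<epsilon> *\<^sub>R sgn x) powr ((m + l) * (p - 1)) =
         (1 - (\<epsilon> / \<phi> x) powr a) powr (k * p) * (\<bar>\<Phi> x\<bar> powr p * \<phi> x powr (a * ((k - 1) * p + 1)))"
      proof -
        have *: "\<And>t b f d e :: real. b / d = e \<Longrightarrow> t * (b * f) / d = t * (f * e)" by auto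
        have "\<phi> (\<epsilon> *\<^sub>R sgn x) = \<phi> x" using \<epsilon> x by (simp add: \<phi>_scale \<phi>_sgn)
        then show ?thesis
          using 1 *[OF 2] by (simp only: a_def[symmetric])
      qed
      then show "indicator (ball 0 1) x * ennreal (\<bar>u_ext \<phi> m l k \<Phi> (\<epsilon> *\<^sub>R sgn x)\<bar> powr p / \<phi> (\<epsilon> *\<^sub>R sgn x) powr ((m + l) * (p - 1)))
        = indicator (ball 0 1) x * T \<epsilon> x"
        by (simp add: T_def H_def ennreal_mult)
    qed
    also have "ennreal (\<epsilon> powr (1 - real ?n)) * (ennreal (real ?n * \<epsilon> ^ (?n - 1)) * (\<integral>\<^sup>+x. indicator (ball 0 1) x * T \<epsilon> x \<partial>lborel))
       = ennreal (real ?n) * (\<integral>\<^sup>+x. indicator (ball 0 1) x * T \<epsilon> x \<partial>lborel)"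
    proof -
      have "\<epsilon> ^ (?n - 1) = \<epsilon> powr (real ?n - 1)"
        using \<epsilon> by (subst powr_realpow[symmetric]) (auto simp: of_nat_diff)
      then have "\<epsilon> powr (1 - real ?n) * (real ?n * \<epsilon> ^ (?n - 1)) = real ?n"
        using \<epsilon> by (simp add: powr_add[symmetric])
      then have "ennreal (\<epsilon> powr (1 - real ?n)) * ennreal (real ?n * \<epsilon> ^ (?n - 1)) = ennreal (real ?n)"
        using \<epsilon> by (simp flip: ennreal_mult)
      then show ?thesis by (simp flip: mult.assoc)
    qed
    finally show ?thesis .
  qed
  define c where "c \<epsilon> = (1 - (\<epsilon> / \<rho>) powr a) powr (k * p)" for \<epsilon>
  have kp: "k * p > 0" using k p by simp
  have bounds: "ennreal (c \<epsilon>) * I \<le> S \<epsilon> \<and> S \<epsilon> \<le> I" if \<epsilon>: "0 < \<epsilon>" "\<epsilon> < \<rho>" for \<epsilon>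
  proof
    have cT: "ennreal (c \<epsilon>) * H x \<le> T \<epsilon> x \<and> T \<epsilon> x \<le> H x" if x: "x \<noteq> 0" for x
    proof -
      have f: "\<rho> \<le> \<phi> x" using \<rho>(2)[OF x] by simp
      have "(\<epsilon> / \<phi> x) powr a \<le> (\<epsilon> / \<rho>) powr a"
        using f \<epsilon> \<rho>(1) a by (intro powr_mono2) (auto simp: divide_left_mono frac_le)
      moreover have "(\<epsilon> / \<rho>) powr a \<le> 1 powr a" using \<epsilon> \<rho>(1) a by (intro powr_mono2) auto
      ultimately have 1: "0 \<le> 1 - (\<epsilon> / \<rho>) powr a" "1 - (\<epsilon> / \<rho>) powr a \<le> 1 - (\<epsilon> / \<phi> x) powr a" "1 - (\<epsilon> / \<phi> x) powr a \<le> 1"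
        by auto
      then have "c \<epsilon> \<le> (1 - (\<epsilon> / \<phi> x) powr a) powr (k * p)"
        unfolding c_def using kp by (intro powr_mono2) auto
      moreover have "(1 - (\<epsilon> / \<phi> x) powr a) powr (k * p) \<le> 1 powr (k * p)"
        using kp 1 by (intro powr_mono2) linarith+
      ultimately have 2: "ennreal (c \<epsilon>) \<le> ennreal ((1 - (\<epsilon> / \<phi> x) powr a) powr (k * p))"
          "ennreal ((1 - (\<epsilon> / \<phi> x) powr a) powr (k * p)) \<le> 1"
        by (auto intro: ennreal_leI)
      show ?thesis unfolding T_def using mult_right_mono[OF 2(1), of "H x"] mult_right_mono[OF 2(2), of "H x"] by simp
    qed
    have "ennreal (c \<epsilon>) * I = ennreal (real ?n) * (\<integral>\<^sup>+x. indicator (ball 0 1) x * (ennreal (c \<epsilon>) * H x) \<partial>lborel)"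
    proof -
      have "(\<integral>\<^sup>+x. indicator (ball 0 1) x * (ennreal (c \<epsilon>) * H x) \<partial>lborel) = (\<integral>\<^sup>+x. ennreal (c \<epsilon>) * (indicator (ball 0 1) x * H x) \<partial>lborel)"
        by (simp add: mult_ac)
      also have "\<dots> = ennreal (c \<epsilon>) * (\<integral>\<^sup>+x. indicator (ball 0 1) x * H x \<partial>lborel)"
        by (rule nn_integral_cmult) simp
      finally show ?thesis unfolding I H_def by (simp add: mult_ac)
    qed
    also have "\<dots> \<le> S \<epsilon>"
      unfolding S[OF \<epsilon>]
      by (intro mult_left_mono nn_integral_mono_AE, use AE_lborel_singleton[of 0] in eventually_elim)
         (auto intro!: mult_left_mono simp: cT)
    finally show "ennreal (c \<epsilon>) * I \<le> S \<epsilon>" .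
    show "S \<epsilon> \<le> I"
      unfolding S[OF \<epsilon>] I H_def[symmetric]
      by (intro mult_left_mono nn_integral_mono_AE, use AE_lborel_singleton[of 0] in eventually_elim)
         (auto intro!: mult_left_mono simp: cT)
  qed
  have ev: "\<forall>\<^sub>F \<epsilon> in at_right 0. 0 < \<epsilon> \<and> \<epsilon> < \<rho>"
    using eventually_at_right_real[OF \<rho>(1)] by (auto elim!: eventually_mono)
  have "((\<lambda>\<epsilon>. \<epsilon> powr a) \<longlongrightarrow> 0 powr a) (at_right 0)"
    using a by (intro tendsto_powr' tendsto_intros) (auto simp: eventually_at_filter)
  moreover have "\<forall>\<^sub>F \<epsilon> in at_right 0. \<epsilon> powr a / \<rho> powr a = (\<epsilon> / \<rho>) powr a"
    using ev by eventually_elim (use \<rho>(1) in \<open>simp add: powr_divide\<close>)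
  ultimately have "((\<lambda>\<epsilon>. (\<epsilon> / \<rho>) powr a) \<longlongrightarrow> 0) (at_right 0)"
    using tendsto_divide[of "\<lambda>\<epsilon>. \<epsilon> powr a" "0 powr a" "at_right 0" "\<lambda>_. \<rho> powr a" "\<rho> powr a"] \<rho>(1)
    by (auto intro: Lim_transform_eventually)
  then have "(c \<longlongrightarrow> (1 - 0) powr (k * p)) (at_right 0)"
    unfolding c_def by (intro tendsto_powr tendsto_diff tendsto_const) auto
  then have "((\<lambda>\<epsilon>. ennreal (c \<epsilon>) * I) \<longlongrightarrow> ennreal 1 * I) (at_right 0)"
    by (intro tendsto_mult_ennreal tendsto_ennrealI tendsto_const) (use fin in auto)
  then have "((\<lambda>\<epsilon>. ennreal (c \<epsilon>) * I) \<longlongrightarrow> I) (at_right 0)" by simp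
  moreover have "\<forall>\<^sub>F \<epsilon> in at_right 0. ennreal (c \<epsilon>) * I \<le> S \<epsilon>" "\<forall>\<^sub>F \<epsilon> in at_right 0. S \<epsilon> \<le> I"
    using ev by (auto elim!: eventually_mono simp: bounds)
  ultimately have "(S \<longlongrightarrow> I) (at_right 0)"
    using tendsto_sandwich[of "\<lambda>\<epsilon>. ennreal (c \<epsilon>) * I" S "at_right 0" "\<lambda>_. I" I] by auto
  then have "Limsup (at_right 0) S = I"
    by (intro lim_imp_Limsup) (auto simp: trivial_limit_at_right_real)
  then show ?thesis unfolding sphere_limsup_def S_def .
qed

text \<open>Put e = (k - 1) p + 1 and let J be the spherical integral of |\<Phi>|^p \<phi>^(a e).
  Then K = J / (a e), L = (k a)^p K and the limsup is J, so after division by K^(1 / p) the equality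
  is the scalar identity k a = a / p' + a e / p.\<close>

lemma u_ext_equality:
  assumes k: "k > 1 / p'" and \<Phi>: "homogeneous0 \<Phi>" and nz: "\<not> (AE x in sphere_measure 1. \<Phi> x = 0)"
    and adm: "admissible \<Omega> \<phi> p m l k \<Phi>"
  shows "KL_finite \<Omega> \<phi> p m l (u_ext \<phi> m l k \<Phi>)"
    and "K_fun \<Omega> \<phi> p m l (u_ext \<phi> m l k \<Phi>) > 0"
    and "sphere_limsup \<phi> p m l (u_ext \<phi> m l k \<Phi>) < \<infinity>"
    and "lhsA \<Omega> p l (u_ext \<phi> m l k \<Phi>) = rhsA ((a / p') powr p) \<Omega> \<phi> p p' m l (u_ext \<phi> m l k \<Phi>)"
proof -
  let ?u = "u_ext \<phi> m l k \<Phi>"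
  have m\<Phi>[measurable]: "\<Phi> \<in> borel_measurable borel"
    and \<Phi>fin: "(\<integral>\<^sup>+x. ennreal (\<bar>\<Phi> x\<bar> powr p) \<partial>sphere_measure 1) < \<infinity>"
    using adm by (auto simp: admissible_def)
  obtain g where g: "is_weak_gradient \<Omega> ?u g" using adm by (auto simp: admissible_def)
  have k0: "k > 0" using k p'(1) by (meson less_trans zero_less_divide_1_iff)
  define e where "e = (k - 1) * p + 1"
  have "p * (1 / p') = p - 1" using p by (simp add: p' field_simps)
  then have e: "e > 0" using mult_strict_left_mono[OF k, of p] p by (simp add: e_def algebra_simps)
  define I where "I = ennreal (real DIM('a)) *
      (\<integral>\<^sup>+x. indicator (ball 0 1) x * ennreal (\<bar>\<Phi> x\<bar> powr p * \<phi> x powr (a * e)) \<partial>lborel)"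
  obtain \<rho> R where \<rho>: "0 < \<rho>" "\<rho> < R" "\<And>x. x \<noteq> 0 \<Longrightarrow> \<rho> \<le> \<phi> x \<and> \<phi> x \<le> R" using \<phi>_bounds by metis
  have \<Phi>s: "\<Phi> (sgn x) = \<Phi> x" if "x \<noteq> 0" for x using \<Phi> that by (simp add: homogeneous0_def sgn_div_norm)
  \<comment> \<open>A function of the homogeneous \<Phi> is constant along rays, so its spherical
    integral is n times its integral over the unit ball.\<close>
  have sph: "(\<integral>\<^sup>+x. f (\<Phi> x) \<partial>sphere_measure 1) = ennreal (real DIM('a)) * (\<integral>\<^sup>+x. indicator (ball 0 1) x * f (\<Phi> x) \<partial>lborel)"
    if [measurable]: "f \<in> borel_measurable borel" for f :: "real \<Rightarrow> ennreal"
    by (subst nn_integral_sphere_measure, measurable, simp)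
       (rule arg_cong, rule nn_integral_cong_AE, use AE_lborel_singleton[of "0::'a"] in eventually_elim, simp add: \<Phi>s)
  have "I \<le> ennreal (real DIM('a)) * (\<integral>\<^sup>+x. ennreal (R powr (a * e)) * (indicator (ball 0 1) x * ennreal (\<bar>\<Phi> x\<bar> powr p)) \<partial>lborel)"
    unfolding I_def
  proof (intro mult_left_mono nn_integral_mono_AE, use AE_lborel_singleton[of 0] in eventually_elim)
    fix x :: 'a assume "x \<noteq> 0"
    then have "\<phi> x powr (a * e) \<le> R powr (a * e)"
      using \<rho>(3)[of x] a e \<rho>(1) by (intro powr_mono2) auto
    then have "\<bar>\<Phi> x\<bar> powr p * \<phi> x powr (a * e) \<le> R powr (a * e) * \<bar>\<Phi> x\<bar> powr p"
      by (metis mult.commute mult_left_mono powr_ge_zero)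
    then have "ennreal (\<bar>\<Phi> x\<bar> powr p * \<phi> x powr (a * e)) \<le> ennreal (R powr (a * e)) * ennreal (\<bar>\<Phi> x\<bar> powr p)"
      by (simp add: ennreal_leI flip: ennreal_mult)
    then show "indicator (ball 0 1) x * ennreal (\<bar>\<Phi> x\<bar> powr p * \<phi> x powr (a * e))
      \<le> ennreal (R powr (a * e)) * (indicator (ball 0 1) x * ennreal (\<bar>\<Phi> x\<bar> powr p))"
      by (auto simp: indicator_def)
  qed auto
  also have "\<dots> = ennreal (R powr (a * e)) * (\<integral>\<^sup>+x. ennreal (\<bar>\<Phi> x\<bar> powr p) \<partial>sphere_measure 1)"
    by (subst sph[of "\<lambda>y. ennreal (\<bar>y\<bar> powr p)"], measurable, subst nn_integral_cmult) (auto simp: mult_ac)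
  also have "\<dots> < \<infinity>" using \<Phi>fin by (simp add: ennreal_mult_less_top)
  finally have Ifin: "I < \<infinity>" .
  \<comment> \<open>Since \<phi> is positive, a vanishing integral would force \<Phi> = 0 almost
    everywhere in the ball and, transferred back by \<open>sph\<close>, almost everywhere on the
    sphere.\<close>
  have I0: "I \<noteq> 0"
  proof
    assume "I = 0"
    then have "(\<integral>\<^sup>+x. indicator (ball 0 1) x * ennreal (\<bar>\<Phi> x\<bar> powr p * \<phi> x powr (a * e)) \<partial>lborel) = 0"
      by (simp add: I_def)
    then have "AE x in lborel. indicator (ball 0 1) x * ennreal (\<bar>\<Phi> x\<bar> powr p * \<phi> x powr (a * e)) = 0"
      by (subst (asm) nn_integral_0_iff_AE) auto
    then have "AE x in lborel. indicator (ball 0 1) x * ennreal \<bar>\<Phi> x\<bar> = 0"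
    proof eventually_elim
      case (elim x)
      have "\<phi> x powr (a * e) > 0" using pos[of x] by simp
      then show ?case using elim by (auto simp: indicator_def ennreal_eq_0_iff mult_le_0_iff)
    qed
    then have "(\<integral>\<^sup>+x. ennreal \<bar>\<Phi> x\<bar> \<partial>sphere_measure 1) = 0"
      by (subst sph[of "\<lambda>y. ennreal \<bar>y\<bar>"], measurable) (simp add: nn_integral_0_iff_AE)
    then have "AE x in sphere_measure 1. ennreal \<bar>\<Phi> x\<bar> = 0"
      by (subst (asm) nn_integral_0_iff_AE) (auto simp: sphere_measure_def)
    then have "AE x in sphere_measure 1. \<Phi> x = 0" by eventually_elim simp
    with nz show False ..
  qed
  obtain J where J: "I = ennreal J" "J > 0"
    using Ifin I0 by (cases I) (auto simp: less_le)
  define K where "K = J / (a * e)"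
  have K: "K > 0" using J a e by (simp add: K_def)
  have "(\<integral>\<^sup>+x. ennreal (indicator \<Omega> x * K_integrand \<phi> p m l ?u x) \<partial>lborel) = ennreal (1 / (a * e)) * I"
    unfolding I_def e_def by (rule nn_integral_K_u_ext[OF \<Phi> m\<Phi> k])
  also have "\<dots> = ennreal K" using J a e by (simp add: K_def flip: ennreal_mult)
  finally have hK: "has_bochner_integral lborel (\<lambda>x. indicator \<Omega> x * K_integrand \<phi> p m l ?u x) K"
    using K by (intro has_bochner_integral_nn_integral) (auto simp: K_integrand_def)
  have "has_bochner_integral lborel (\<lambda>x. (k * a) powr p * (indicator \<Omega> x * K_integrand \<phi> p m l ?u x)) ((k * a) powr p * K)"
    using hK by (intro has_bochner_integral_mult_right) auto
  then have hL: "has_bochner_integral lborel (\<lambda>x. indicator \<Omega> x * L_integrand \<Omega> p l ?u x) ((k * a) powr p * K)"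
    by (subst has_bochner_integral_cong_AE[OF _ _ L_integrand_u_ext[OF \<Phi> m\<Phi> g k0]])
       (use measurable_L_integrand[OF g] in auto)
  show "KL_finite \<Omega> \<phi> p m l ?u"
    using hK hL by (auto simp: KL_finite_def set_integrable_def has_bochner_integral_iff)
  have Kf: "K_fun \<Omega> \<phi> p m l ?u = K"
    using hK by (simp add: K_fun_def set_lebesgue_integral_def has_bochner_integral_iff)
  have Lf: "L_fun \<Omega> p l ?u = (k * a) powr p * K"
    using hL by (simp add: L_fun_def set_lebesgue_integral_def has_bochner_integral_iff)
  show "K_fun \<Omega> \<phi> p m l ?u > 0" using Kf K by simp
  have sl: "sphere_limsup \<phi> p m l ?u = ennreal J"
    using sphere_limsup_u_ext[OF \<Phi> m\<Phi> k0 I_def[unfolded e_def] Ifin] J by simp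
  then show "sphere_limsup \<phi> p m l ?u < \<infinity>" by simp
  have e1: "L_fun \<Omega> p l ?u powr (1 / p) = k * a * K powr (1 / p)"
    unfolding Lf using k0 a p K by (simp add: powr_mult powr_powr)
  have e2: "((a / p') powr p) powr (1 / p) = a / p'"
    using a p p' by (simp add: powr_powr)
  \<comment> \<open>The limsup J equals a e K, and K K^(-1 / p') = K^(1 / p) because 1 - 1 / p' = 1
    / p.\<close>
  have e3: "J * K powr (- 1 / p') = a * e * K powr (1 / p)"
  proof -
    have "K * K powr (- 1 / p') = K powr (1 + (- 1 / p'))" unfolding powr_add using K by simp
    also have "1 + (- 1 / p') = 1 / p" using pp' by simp
    finally have "a * e * (K * K powr (- 1 / p')) = a * e * K powr (1 / p)" by simp
    moreover have "J = a * e * K" using a e by (simp add: K_def)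
    ultimately show ?thesis by simp
  qed
  have e4: "a / p' + 1 / p * (a * e) = k * a"
  proof -
    have "1 / p * e = k - 1 + 1 / p" using p by (simp add: e_def field_simps)
    then have "1 / p' + 1 / p * e = k" using p'(2) by simp
    then have "a * (1 / p' + 1 / p * e) = a * k" by simp
    then show ?thesis by (simp add: algebra_simps)
  qed
  have "L_fun \<Omega> p l ?u powr (1 / p) = ((a / p') powr p) powr (1 / p) * K powr (1 / p) + 1 / p * (J * K powr (- 1 / p'))"
    unfolding e1 e2 e3 e4[symmetric] by (simp add: distrib_right mult.assoc)
  then show "lhsA \<Omega> p l ?u = rhsA ((a / p') powr p) \<Omega> \<phi> p p' m l ?u"
    unfolding lhsA_def rhsA_def sl Kf using J(2) by (simp add: mult_ac)
qed

end

section \<open>Sharpness of the constant\<close>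

text \<open>Being supported in [1, 2], this function evaluated at - \<epsilon> ln \<tau> confines
  \<tau> to [exp (- 2 / \<epsilon>), exp (- 1 / \<epsilon>)], away from 0 (the boundary) and from 1
  (the origin).\<close>

definition bump :: "real \<Rightarrow> real" where
  "bump t = flat 0 (t - 1) * flat 0 (2 - t)"

definition bump' :: "real \<Rightarrow> real" where
  "bump' t = flat (Suc 0) (t - 1) * flat 0 (2 - t) - flat 0 (t - 1) * flat (Suc 0) (2 - t)"

lemma DERIV_bump: "(bump has_real_derivative bump' t) (at t)"
proof -
  have 1: "((\<lambda>t. flat 0 (t - 1)) has_real_derivative flat (Suc 0) (t - 1) * 1) (at t)"
    by (rule DERIV_chain2[OF DERIV_flat]) (auto intro!: derivative_eq_intros)
  have 2: "((\<lambda>t. flat 0 (2 - t)) has_real_derivative flat (Suc 0) (2 - t) * (- 1)) (at t)"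
    by (rule DERIV_chain2[OF DERIV_flat]) (auto intro!: derivative_eq_intros)
  show ?thesis unfolding bump_def[abs_def] bump'_def using DERIV_mult[OF 1 2]
    by (rule DERIV_cong) (simp add: algebra_simps)
qed

lemma continuous_bump: "continuous_on A bump" "continuous_on A bump'"
proof -
  have "continuous_on UNIV (\<lambda>t. flat i (t - 1))" "continuous_on UNIV (\<lambda>t. flat i (2 - t))" for i
    by (rule continuous_on_compose2[OF continuous_on_flat[of UNIV]]; auto intro!: continuous_intros)+
  then have "continuous_on UNIV bump" "continuous_on UNIV bump'"
    unfolding bump_def[abs_def] bump'_def[abs_def] by (auto intro!: continuous_intros)
  then show "continuous_on A bump" "continuous_on A bump'"
    by (auto intro: continuous_on_subset)
qed

lemma bump_bounds:
  "0 \<le> bump t" "bump t \<le> 1" "1 < t \<Longrightarrow> t < 2 \<Longrightarrow> 0 < bump t"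
  "t \<le> 1 \<or> 2 \<le> t \<Longrightarrow> bump t = 0" "t \<le> 1 \<or> 2 \<le> t \<Longrightarrow> bump' t = 0"
  by (auto simp: bump_def bump'_def flat_0_bounds intro!: mult_le_one)

text \<open>One family covers both sides of the Rayleigh quotient: q = 1 / p' with \<epsilon> > 0
  arises from L, while q = 1 and \<epsilon> = 0 give bump^p, which arises from K.\<close>

definition hardy_profile :: "real \<Rightarrow> real \<Rightarrow> real \<Rightarrow> real \<Rightarrow> real" where
  "hardy_profile p q \<epsilon> t = \<bar>q * bump t - \<epsilon> * bump' t\<bar> powr p"

lemma hardy_profile_props:
  assumes "p > 0"
  shows "continuous_on UNIV (hardy_profile p q \<epsilon>)" "hardy_profile p q \<epsilon> \<in> borel_measurable borel"
    "hardy_profile p q \<epsilon> t \<ge> 0" "t \<le> 1 \<or> 2 \<le> t \<Longrightarrow> hardy_profile p q \<epsilon> t = 0"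
proof -
  show "continuous_on UNIV (hardy_profile p q \<epsilon>)"
    unfolding hardy_profile_def[abs_def] using assms
    by (intro continuous_on_powr' continuous_intros continuous_bump) auto
  then show "hardy_profile p q \<epsilon> \<in> borel_measurable borel" by (rule borel_measurable_continuous_onI)
qed (auto simp: hardy_profile_def bump_bounds)

lemma integrable_hardy_profile:
  assumes "p > 0"
  shows "integrable lborel (hardy_profile p q \<epsilon>)"
proof -
  have "integrable lborel (\<lambda>t. indicator {1..2} t *\<^sub>R hardy_profile p q \<epsilon> t)"
    by (rule borel_integrable_compact[OF _ continuous_on_subset[OF hardy_profile_props(1)[OF assms]]]) auto
  moreover have "(\<lambda>t. indicator {1..2} t *\<^sub>R hardy_profile p q \<epsilon> t) = hardy_profile p q \<epsilon>"
  proof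
    fix t show "indicator {1..2} t *\<^sub>R hardy_profile p q \<epsilon> t = hardy_profile p q \<epsilon> t"
      using hardy_profile_props(4)[OF assms, of t q \<epsilon>] by (cases "t \<in> {1..2}") auto
  qed
  ultimately show ?thesis by simp
qed

lemma integral_hardy_profile_0_pos:
  assumes "p > 0"
  shows "integral\<^sup>L lborel (hardy_profile p 1 0) > 0"
proof -
  have "integral\<^sup>L lborel (hardy_profile p 1 0) \<noteq> 0"
  proof
    assume "integral\<^sup>L lborel (hardy_profile p 1 0) = 0"
    then have "AE t in lborel. hardy_profile p 1 0 t = 0"
      using integral_nonneg_eq_0_iff_AE[OF integrable_hardy_profile[OF assms], of 1 0] hardy_profile_props(3)[OF assms] by simp
    then have "AE t in lborel. t \<notin> {1<..<2::real}"
      by eventually_elim (auto simp: hardy_profile_def dest: bump_bounds(3))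
    then have "emeasure lborel {1<..<2::real} = 0"
      by (subst (asm) AE_iff_measurable[OF _ refl]) (auto simp: greaterThanLessThan_def greaterThan_def lessThan_def Int_def)
    then show False by simp
  qed
  moreover have "integral\<^sup>L lborel (hardy_profile p 1 0) \<ge> 0"
    by (intro integral_nonneg_AE) (simp add: hardy_profile_props(3)[OF assms])
  ultimately show ?thesis by linarith
qed

text \<open>With \<open>v(\<tau>) = \<tau>\<^bsup>1/p'\<^esup> W(- \<epsilon> ln \<tau>)\<close> and \<open>W = bump\<close>, the Rayleigh quotient of the one-dimensional Hardy
  inequality becomes \<open>\<integral>|W/p' - \<epsilon> W'|\<^sup>p / \<integral>|W|\<^sup>p\<close>, which tends to \<open>(1/p')\<^sup>p\<close> as \<open>\<epsilon> \<rightarrow> 0\<close>.\<close>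
lemma hardy_profile_near_optimal:
  assumes p: "p > 0" and q: "q > 0" and D: "D > q powr p"
  obtains \<epsilon> where "\<epsilon> > 0"
    "integral\<^sup>L lborel (hardy_profile p q \<epsilon>) < D * integral\<^sup>L lborel (hardy_profile p 1 0)"
proof -
  obtain M where "\<forall>y\<in>bump' ` {1..2}. norm y \<le> M"
    using compact_imp_bounded[OF compact_continuous_image[OF continuous_bump(2) compact_Icc[of 1 2]]]
    unfolding bounded_iff by blast
  then have M: "norm (bump' t) \<le> M" if "t \<in> {1..2}" for t using that by blast
  define t where "t j = 1 / real (Suc j)" for j
  have t: "0 < t j" "t j \<le> 1" for j by (auto simp: t_def)
  have t0: "t \<longlonglongrightarrow> 0" unfolding t_def by (rule LIMSEQ_Suc[OF lim_1_over_n])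
  have "(\<lambda>j. integral\<^sup>L lborel (hardy_profile p q (t j))) \<longlonglongrightarrow> integral\<^sup>L lborel (hardy_profile p q 0)"
  proof (rule integral_dominated_convergence[where w="\<lambda>s. indicator {1..2} s *\<^sub>R (q + M) powr p"])
    show "integrable lborel (\<lambda>s::real. indicator {1..2} s *\<^sub>R (q + M) powr p)"
      by (rule borel_integrable_compact) auto
    show "AE s in lborel. (\<lambda>j. hardy_profile p q (t j) s) \<longlonglongrightarrow> hardy_profile p q 0 s"
      unfolding hardy_profile_def using p t0
      by (intro AE_I2 tendsto_powr' tendsto_intros) auto
    show "AE s in lborel. norm (hardy_profile p q (t j) s) \<le> indicator {1..2} s *\<^sub>R (q + M) powr p" for j
    proof (rule AE_I2)
      fix s
      show "norm (hardy_profile p q (t j) s) \<le> indicator {1..2} s *\<^sub>R (q + M) powr p"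
      proof (cases "s \<in> {1..2}")
        case True
        have "\<bar>q * bump s\<bar> \<le> q" using bump_bounds(1,2)[of s] q by (simp add: abs_mult mult_left_le)
        moreover have "\<bar>t j * bump' s\<bar> \<le> M"
          using M[OF True] t[of j] mult_mono[of "t j" 1 "\<bar>bump' s\<bar>" M] by (simp add: abs_mult)
        ultimately have "\<bar>q * bump s - t j * bump' s\<bar> \<le> q + M" by linarith
        then show ?thesis using True p by (simp add: hardy_profile_def powr_mono2)
      qed (use hardy_profile_props(4)[OF p, of s] in auto)
    qed
  qed (use hardy_profile_props(2)[OF p] in auto)
  moreover have "integral\<^sup>L lborel (hardy_profile p q 0) = q powr p * integral\<^sup>L lborel (hardy_profile p 1 0)"
    using q by (simp add: hardy_profile_def[abs_def] abs_mult powr_mult)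
  moreover have "q powr p * integral\<^sup>L lborel (hardy_profile p 1 0) < D * integral\<^sup>L lborel (hardy_profile p 1 0)"
    using D integral_hardy_profile_0_pos[OF p] by simp
  ultimately have "\<forall>\<^sub>F j in sequentially. integral\<^sup>L lborel (hardy_profile p q (t j)) < D * integral\<^sup>L lborel (hardy_profile p 1 0)"
    by (intro order_tendstoD(2)) auto
  then obtain j where "integral\<^sup>L lborel (hardy_profile p q (t j)) < D * integral\<^sup>L lborel (hardy_profile p 1 0)"
    by (auto simp: eventually_sequentially)
  then show ?thesis using that t(1) by blast
qed

text \<open>Substitution z = - \<epsilon> ln (1 - (r / c)^a), for which dz = (a \<epsilon> / c^a)
  r^(a - 1) dr / (1 - (r / c)^a). The weight, not integrable at r = c, becomes a constant multiple
  of dz.\<close>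

lemma nn_integral_log_substitution:
  fixes F :: "real \<Rightarrow> real"
  assumes a: "a > 0" and c: "c > 0" and \<epsilon>: "\<epsilon> > 0" and [measurable]: "F \<in> borel_measurable borel"
    and F0: "\<And>z. F z \<ge> 0" "\<And>z. z \<notin> {1..2} \<Longrightarrow> F z = 0"
  shows "(\<integral>\<^sup>+r. ennreal (r powr (a - 1) * (1 / (1 - (r / c) powr a)) * F (- \<epsilon> * ln (1 - (r / c) powr a))) * indicator {0<..<c} r \<partial>lborel)
    = ennreal (c powr a / (a * \<epsilon>)) * (\<integral>\<^sup>+z. ennreal (F z) \<partial>lborel)"
proof -
  define g where "g r = - \<epsilon> * ln (1 - (r / c) powr a)" for r
  define g' where "g' r = \<epsilon> * (a * r powr (a - 1) / c powr a) / (1 - (r / c) powr a)" for r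
  \<comment> \<open>\<rho> is the inverse of \<open>g\<close>. Since \<open>F\<close> vanishes off
    [1, 2], only the interval from \<rho>(1) to \<rho>(2) matters, a compact subset of (0, c) on
    which the substitution rule applies.\<close>
  define \<rho> where "\<rho> z = c * (1 - exp (- (z / \<epsilon>))) powr (1 / a)" for z
  have e: "0 < exp (- (z / \<epsilon>))" "exp (- (z / \<epsilon>)) < 1" if "z > 0" for z
    using that \<epsilon> by auto
  have \<rho>a: "(\<rho> z / c) powr a = 1 - exp (- (z / \<epsilon>))" if "z > 0" for z
    using e[OF that] a c by (simp add: \<rho>_def powr_powr)
  have \<rho>0: "0 < \<rho> z" "\<rho> z < c" if "z > 0" for z
  proof -
    have "1 - exp (- (z / \<epsilon>)) \<noteq> 0" using e[OF that] by linarith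
    then show "0 < \<rho> z" unfolding \<rho>_def by (rule mult_pos_pos[OF c powr_gt_zero[THEN iffD2]])
    have "(1 - exp (- (z / \<epsilon>))) powr (1 / a) < 1 powr (1 / a)"
      using e[OF that] a by (intro powr_less_mono2) auto
    then show "\<rho> z < c" using c by (simp add: \<rho>_def)
  qed
  have g\<rho>: "g (\<rho> z) = z" if "z > 0" for z
    using \<epsilon> by (simp add: g_def \<rho>a[OF that])
  have less1: "(r / c) powr a < 1" if "0 < r" "r < c" for r
  proof -
    have "(r / c) powr a < 1 powr a" using that c a by (intro powr_less_mono2) auto
    then show ?thesis by simp
  qed
  have mono: "g r < g s" if "0 < r" "r < s" "s < c" for r s
  proof -
    have "(r / c) powr a < (s / c) powr a" using that c a by (intro powr_less_mono2) (auto simp: divide_strict_right_mono)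
    then show ?thesis using less1[of r] less1[of s] that \<epsilon> by (simp add: g_def)
  qed
  have \<rho>le: "\<rho> 1 \<le> \<rho> 2"
    by (rule ccontr) (use mono[of "\<rho> 2" "\<rho> 1"] \<rho>0 g\<rho> in auto)
  have ind: "ennreal (y * indicator A z) = ennreal y * indicator A z" for y z and A :: "real set"
    by (simp add: indicator_def)
  have "(\<integral>\<^sup>+z. ennreal (F z * indicator {g (\<rho> 1)..g (\<rho> 2)} z) \<partial>lborel) = (\<integral>\<^sup>+r. ennreal (F (g r) * g' r * indicator {\<rho> 1..\<rho> 2} r) \<partial>lborel)"
  proof (rule nn_integral_substitution)
    fix r assume "r \<in> {\<rho> 1..\<rho> 2}"
    then have r: "0 < r" "r < c" using \<rho>0(1)[of 1] \<rho>0(2)[of 2] by auto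
    have pw: "(r / c) powr a = r powr a / c powr a" using r c by (simp add: powr_divide)
    have "((\<lambda>r. - \<epsilon> * ln (1 - r powr a / c powr a)) has_real_derivative g' r) (at r)"
      using r c less1[OF r] unfolding pw g'_def
      by (auto intro!: derivative_eq_intros simp: pw mult_ac)
    then show "(g has_real_derivative g' r) (at r)"
      by (rule has_field_derivative_transform_within_open[of _ _ _ "{0<..}"])
         (use r c in \<open>auto simp: g_def powr_divide\<close>)
    show "g' r \<ge> 0" using less1[OF r] a \<epsilon> by (simp add: g'_def)
  next
    show "continuous_on {\<rho> 1..\<rho> 2} g'"
      unfolding g'_def using \<rho>0(1)[of 1] \<rho>0(2)[of 2] c less1
      by (intro continuous_intros) (auto, fastforce+)
    show "set_borel_measurable borel {g (\<rho> 1)..g (\<rho> 2)} F" unfolding set_borel_measurable_def by measurable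
  qed (use \<rho>le in auto)
  also have "(\<integral>\<^sup>+z. ennreal (F z * indicator {g (\<rho> 1)..g (\<rho> 2)} z) \<partial>lborel) = (\<integral>\<^sup>+z. ennreal (F z) \<partial>lborel)"
  proof (rule nn_integral_cong)
    fix z show "ennreal (F z * indicator {g (\<rho> 1)..g (\<rho> 2)} z) = ennreal (F z)"
      using F0(2)[of z] g\<rho>[of 1] g\<rho>[of 2] by (cases "z \<in> {1..2}") auto
  qed
  finally have sub: "(\<integral>\<^sup>+z. ennreal (F z) \<partial>lborel) = (\<integral>\<^sup>+r. ennreal (F (g r) * g' r) * indicator {\<rho> 1..\<rho> 2} r \<partial>lborel)"
    unfolding ind .
  have "(\<integral>\<^sup>+r. ennreal (r powr (a - 1) * (1 / (1 - (r / c) powr a)) * F (- \<epsilon> * ln (1 - (r / c) powr a))) * indicator {0<..<c} r \<partial>lborel)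
    = (\<integral>\<^sup>+r. ennreal (c powr a / (a * \<epsilon>)) * (ennreal (F (g r) * g' r) * indicator {\<rho> 1..\<rho> 2} r) \<partial>lborel)"
  proof (rule nn_integral_cong)
    fix r
    show "ennreal (r powr (a - 1) * (1 / (1 - (r / c) powr a)) * F (- \<epsilon> * ln (1 - (r / c) powr a))) * indicator {0<..<c} r
      = ennreal (c powr a / (a * \<epsilon>)) * (ennreal (F (g r) * g' r) * indicator {\<rho> 1..\<rho> 2} r)"
    proof (cases "r \<in> {\<rho> 1..\<rho> 2}")
      case True
      then have r: "0 < r" "r < c" using \<rho>0(1)[of 1] \<rho>0(2)[of 2] by auto
      have "r powr (a - 1) * (1 / (1 - (r / c) powr a)) * F (g r) = c powr a / (a * \<epsilon>) * (F (g r) * g' r)"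
        using a \<epsilon> c by (simp add: g'_def)
      moreover have "- \<epsilon> * ln (1 - (r / c) powr a) = g r" by (simp add: g_def)
      moreover have "0 \<le> c powr a / (a * \<epsilon>)" "0 \<le> F (g r) * g' r"
        using less1[OF r] a \<epsilon> F0(1) by (simp_all add: g'_def)
      ultimately show ?thesis using True r by (simp only: ennreal_mult) (simp add: indicator_def)
    next
      case False
      have "F (g r) = 0" if r: "0 < r" "r < c"
      proof -
        have "g r < 1 \<or> 2 < g r"
          using mono[of r "\<rho> 1"] mono[of "\<rho> 2" r] False r \<rho>0(1)[of 2] \<rho>0(2)[of 1] g\<rho>[of 1] g\<rho>[of 2] by auto
        then show ?thesis by (intro F0(2)) auto
      qed
      then show ?thesis using False by (auto simp: indicator_def g_def)
    qed
  qed
  also have "\<dots> = ennreal (c powr a / (a * \<epsilon>)) * (\<integral>\<^sup>+z. ennreal (F z) \<partial>lborel)"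
    unfolding sub g_def g'_def by (subst nn_integral_cmult) auto
  finally show ?thesis .
qed

text \<open>Separation of variables: the dependence on \<open>Q\<close> sits in a factor that does
  not see \<open>F\<close>. Two such integrals differing only in \<open>F\<close> have a quotient
  independent of \<open>Q\<close>, so the shape of the gauge drops out of the Rayleigh
  quotient.\<close>

lemma nn_integral_gauge_substitution:
  fixes Q :: "'a::euclidean_space \<Rightarrow> real" and F :: "real \<Rightarrow> real"
  assumes a: "a > 0" and \<epsilon>: "\<epsilon> > 0" and [measurable]: "F \<in> borel_measurable borel" "Q \<in> borel_measurable borel"
    and F0: "\<And>z. F z \<ge> 0" "\<And>z. z \<notin> {1..2} \<Longrightarrow> F z = 0"
    and Q: "\<And>x. Q x > 0" "\<And>r x. r > 0 \<Longrightarrow> Q (r *\<^sub>R x) = Q x"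
  shows "(\<integral>\<^sup>+x. ennreal (indicator {x. x \<noteq> 0 \<and> norm x < Q x} x * (norm x powr (a - real DIM('a)) * Q x powr b *
      (1 / (1 - (norm x / Q x) powr a)) * F (- \<epsilon> * ln (1 - (norm x / Q x) powr a)))) \<partial>lborel) =
    ennreal (real DIM('a)) * (\<integral>\<^sup>+x. indicator (ball 0 1) x * ennreal (Q x powr (a + b) / (a * \<epsilon>)) \<partial>lborel) * (\<integral>\<^sup>+z. ennreal (F z) \<partial>lborel)"
    (is "(\<integral>\<^sup>+x. ennreal (?f x) \<partial>lborel) = _")
proof -
  let ?n = "DIM('a)"
  have "(\<integral>\<^sup>+x. ennreal (?f x) \<partial>lborel) = ennreal (real ?n) * (\<integral>\<^sup>+x. indicator (ball 0 1) x *
    (\<integral>\<^sup>+r. indicator {0<..} r * ennreal (r ^ (?n - 1)) * ennreal (?f (r *\<^sub>R sgn x)) \<partial>lborel) \<partial>lborel)"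
    by (rule nn_integral_polar) measurable
  also have "\<dots> = ennreal (real ?n) * (\<integral>\<^sup>+x. (indicator (ball 0 1) x * ennreal (Q x powr (a + b) / (a * \<epsilon>))) * (\<integral>\<^sup>+z. ennreal (F z) \<partial>lborel) \<partial>lborel)"
  proof (rule arg_cong, rule nn_integral_cong_AE, use AE_lborel_singleton[of 0] in eventually_elim)
    fix x :: 'a assume x: "x \<noteq> 0"
    have nx: "norm (sgn x) = 1" using x by (simp add: norm_sgn)
    have Qx: "Q (sgn x) = Q x" using Q(2) x by (simp add: sgn_div_norm)
    have "(\<integral>\<^sup>+r. indicator {0<..} r * ennreal (r ^ (?n - 1)) * ennreal (?f (r *\<^sub>R sgn x)) \<partial>lborel) =
      (\<integral>\<^sup>+r. ennreal (Q x powr b) * (ennreal (r powr (a - 1) * (1 / (1 - (r / Q x) powr a)) * F (- \<epsilon> * ln (1 - (r / Q x) powr a))) * indicator {0<..<Q x} r) \<partial>lborel)"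
    proof (rule nn_integral_cong)
      fix r :: real
      show "indicator {0<..} r * ennreal (r ^ (?n - 1)) * ennreal (?f (r *\<^sub>R sgn x)) =
        ennreal (Q x powr b) * (ennreal (r powr (a - 1) * (1 / (1 - (r / Q x) powr a)) * F (- \<epsilon> * ln (1 - (r / Q x) powr a))) * indicator {0<..<Q x} r)"
      proof (cases "0 < r \<and> r < Q x")
        case True
        then have r: "0 < r" "r < Q x" by auto
        have "(r / Q x) powr a < 1 powr a" using r a by (intro powr_less_mono2) auto
        then have less1: "(r / Q x) powr a < 1" by simp
        have rp: "r ^ (?n - 1) * r powr (a - real ?n) = r powr (a - 1)"
        proof -
          have "r ^ (?n - 1) = r powr (real ?n - 1)"
            using r by (subst powr_realpow[symmetric]) (auto simp: of_nat_diff)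
          then show ?thesis using r by (simp add: powr_add[symmetric])
        qed
        have f: "?f (r *\<^sub>R sgn x) = r powr (a - real ?n) * Q x powr b * (1 / (1 - (r / Q x) powr a)) * F (- \<epsilon> * ln (1 - (r / Q x) powr a))"
          using r x nx by (simp add: Q(2) Qx sgn_zero_iff)
        have "r ^ (?n - 1) * ?f (r *\<^sub>R sgn x) = Q x powr b * (r powr (a - 1) * (1 / (1 - (r / Q x) powr a)) * F (- \<epsilon> * ln (1 - (r / Q x) powr a)))"
          unfolding f rp[symmetric] by (simp add: mult_ac)
        moreover have "0 \<le> ?f (r *\<^sub>R sgn x)" "0 \<le> r powr (a - 1) * (1 / (1 - (r / Q x) powr a)) * F (- \<epsilon> * ln (1 - (r / Q x) powr a))"
          unfolding f using less1 F0(1) by auto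
        ultimately have "ennreal (r ^ (?n - 1)) * ennreal (?f (r *\<^sub>R sgn x)) =
          ennreal (Q x powr b) * ennreal (r powr (a - 1) * (1 / (1 - (r / Q x) powr a)) * F (- \<epsilon> * ln (1 - (r / Q x) powr a)))"
          using r by (simp only: ennreal_mult[symmetric] powr_ge_zero zero_le_power less_imp_le)
        then show ?thesis using r by simp
      next
        case False
        have "?f (r *\<^sub>R sgn x) = 0" if "r > 0"
        proof -
          have "\<not> norm (r *\<^sub>R sgn x) < Q (r *\<^sub>R sgn x)" using that False nx by (simp add: Q(2) Qx)
          then show ?thesis by simp
        qed
        then show ?thesis
        proof (cases "r > 0")
          case True
          then show ?thesis unfolding \<open>r > 0 \<Longrightarrow> ?f (r *\<^sub>R sgn x) = 0\<close>[OF True] using False by simp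
        qed simp
      qed
    qed
    also have "\<dots> = ennreal (Q x powr b) * (\<integral>\<^sup>+r. ennreal (r powr (a - 1) * (1 / (1 - (r / Q x) powr a)) * F (- \<epsilon> * ln (1 - (r / Q x) powr a))) * indicator {0<..<Q x} r \<partial>lborel)"
      by (rule nn_integral_cmult) measurable
    also have "(\<integral>\<^sup>+r. ennreal (r powr (a - 1) * (1 / (1 - (r / Q x) powr a)) * F (- \<epsilon> * ln (1 - (r / Q x) powr a))) * indicator {0<..<Q x} r \<partial>lborel)
        = ennreal (Q x powr a / (a * \<epsilon>)) * (\<integral>\<^sup>+z. ennreal (F z) \<partial>lborel)"
      by (rule nn_integral_log_substitution[OF a Q(1) \<epsilon> assms(3)]) (use F0 in auto)
    also have "ennreal (Q x powr b) * (ennreal (Q x powr a / (a * \<epsilon>)) * (\<integral>\<^sup>+z. ennreal (F z) \<partial>lborel)) =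
      ennreal (Q x powr (a + b) / (a * \<epsilon>)) * (\<integral>\<^sup>+z. ennreal (F z) \<partial>lborel)"
    proof -
      have "ennreal (Q x powr b) * ennreal (Q x powr a / (a * \<epsilon>)) = ennreal (Q x powr (a + b) / (a * \<epsilon>))"
        using a \<epsilon> by (simp add: powr_add mult_ac flip: ennreal_mult)
      then show ?thesis by (simp flip: mult.assoc)
    qed
    finally show "indicator (ball 0 1) x * (\<integral>\<^sup>+r. indicator {0<..} r * ennreal (r ^ (?n - 1)) * ennreal (?f (r *\<^sub>R sgn x)) \<partial>lborel)
      = (indicator (ball 0 1) x * ennreal (Q x powr (a + b) / (a * \<epsilon>))) * (\<integral>\<^sup>+z. ennreal (F z) \<partial>lborel)"
      by (simp only: mult.assoc)
  qed
  also have "\<dots> = ennreal (real ?n) * (\<integral>\<^sup>+x. indicator (ball 0 1) x * ennreal (Q x powr (a + b) / (a * \<epsilon>)) \<partial>lborel) * (\<integral>\<^sup>+z. ennreal (F z) \<partial>lborel)"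
    by (subst nn_integral_multc) (simp_all add: mult_ac)
  finally show ?thesis .
qed

section \<open>Smooth homogeneous gauges just below the profile\<close>

lemma ln_norm_smooth:
  fixes S :: "'a::euclidean_space set"
  assumes "0 \<notin> S"
  shows "(\<lambda>x. ln (\<Sum>b\<in>Basis. (x \<bullet> b) * (x \<bullet> b)) / 2) \<in> smooth_terms S"
    and "x \<in> S \<Longrightarrow> ln (norm x) = ln (\<Sum>b\<in>Basis. (x \<bullet> b) * (x \<bullet> b)) / 2"
proof -
  have sq: "(\<Sum>b\<in>Basis. (x \<bullet> b) * (x \<bullet> b)) = (norm x)\<^sup>2" for x :: 'a
    unfolding euclidean_inner[symmetric] by (simp add: power2_norm_eq_inner)
  have p: "(\<Sum>b\<in>Basis. (x \<bullet> b) * (x \<bullet> b)) > 0" if "x \<in> S" for x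
    using that assms unfolding sq by (auto intro: zero_less_power)
  have "(\<lambda>x. (1 / 2) * ln (\<Sum>b\<in>Basis. (x \<bullet> b) * (x \<bullet> b))) \<in> smooth_terms S"
    by (intro smooth_terms.mult smooth_terms.const smooth_terms.ln smooth_terms_sum finite_Basis smooth_terms.inner p)
  then show "(\<lambda>x. ln (\<Sum>b\<in>Basis. (x \<bullet> b) * (x \<bullet> b)) / 2) \<in> smooth_terms S" by simp
  show "x \<in> S \<Longrightarrow> ln (norm x) = ln (\<Sum>b\<in>Basis. (x \<bullet> b) * (x \<bullet> b)) / 2"
    using assms unfolding sq by (auto simp: ln_realpow)
qed

text \<open>sgn x is x exp (- ln |x|), and ln |x| is half the logarithm of the sum of the squared
  coordinates, which belongs to the class away from the origin. Induction over the structure of the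
  polynomial does the rest.\<close>

lemma polynomial_sgn_smooth:
  fixes S :: "'a::euclidean_space set"
  assumes S: "0 \<notin> S" and "real_polynomial_function G"
  shows "\<exists>g\<in>smooth_terms S. \<forall>x\<in>S. G (sgn x) = g x"
  using assms(2)
proof (induction rule: real_polynomial_function.induct)
  case (linear f)
  let ?N = "\<lambda>x::'a. ln (\<Sum>b\<in>Basis. (x \<bullet> b) * (x \<bullet> b)) / 2"
  interpret bounded_linear f by (rule linear)
  have "(\<lambda>x. exp (- ?N x) * (\<Sum>b\<in>Basis. (x \<bullet> b) * f b)) \<in> smooth_terms S"
    by (intro smooth_terms.mult smooth_terms_exp smooth_terms_minus ln_norm_smooth(1)[OF S]
        smooth_terms_sum finite_Basis smooth_terms.inner smooth_terms.const)
  moreover have "f (sgn x) = exp (- ?N x) * (\<Sum>b\<in>Basis. (x \<bullet> b) * f b)" if "x \<in> S" for x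
  proof -
    have "norm x > 0" using that S by auto
    then have "exp (- ?N x) = inverse (norm x)"
      unfolding ln_norm_smooth(2)[OF S that, symmetric] by (simp add: exp_minus)
    moreover have "f x = (\<Sum>b\<in>Basis. (x \<bullet> b) * f b)"
      by (subst euclidean_representation[symmetric, of x]) (simp only: sum scaleR real_scaleR_def)
    ultimately show ?thesis by (simp add: sgn_div_norm scaleR)
  qed
  ultimately show ?case
    by (intro bexI[of _ "\<lambda>x. exp (- ?N x) * (\<Sum>b\<in>Basis. (x \<bullet> b) * f b)"]) blast+
next
  case (const c)
  show ?case using smooth_terms.const[of c S] by (intro bexI[of _ "\<lambda>_. c"]) auto
next
  case (add f g)
  from add.IH obtain f' g' where "f' \<in> smooth_terms S" "\<forall>x\<in>S. f (sgn x) = f' x" "g' \<in> smooth_terms S" "\<forall>x\<in>S. g (sgn x) = g' x"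
    by blast
  then show ?case using smooth_terms.add[of f' S g'] by (intro bexI[of _ "\<lambda>x. f' x + g' x"]) auto
next
  case (mult f g)
  from mult.IH obtain f' g' where "f' \<in> smooth_terms S" "\<forall>x\<in>S. f (sgn x) = f' x" "g' \<in> smooth_terms S" "\<forall>x\<in>S. g (sgn x) = g' x"
    by blast
  then show ?case using smooth_terms.mult[of f' S g'] by (intro bexI[of _ "\<lambda>x. f' x * g' x"]) auto
qed

text \<open>Approximating ln \<phi> - \<delta> / 2 within \<delta> / 2 puts the polynomial strictly
  between ln \<phi> - \<delta> and ln \<phi>. Working with logarithms makes the gauge positive and
  the error multiplicative.\<close>

lemma (in star_domain) polynomial_gauge:
  assumes "\<delta> > 0"
  obtains G where "real_polynomial_function G" "\<And>x. x \<noteq> 0 \<Longrightarrow> exp (- \<delta>) * \<phi> x < exp (G (sgn x)) \<and> exp (G (sgn x)) < \<phi> x"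
proof -
  have "continuous_on (sphere 0 1) (\<lambda>x. ln (\<phi> x) - \<delta> / 2)"
    using pos by (intro continuous_intros continuous_on_subset[OF continuous_on_\<phi>]) (auto simp: less_imp_neq[symmetric])
  then obtain G where G: "real_polynomial_function G" "\<And>x. x \<in> sphere 0 1 \<Longrightarrow> \<bar>ln (\<phi> x) - \<delta> / 2 - G x\<bar> < \<delta> / 2"
    using Stone_Weierstrass_real_polynomial_function[OF compact_sphere, of _ _ "\<lambda>x. ln (\<phi> x) - \<delta> / 2" "\<delta> / 2"] assms
    by (metis half_gt_zero)
  have "exp (- \<delta>) * \<phi> x < exp (G (sgn x)) \<and> exp (G (sgn x)) < \<phi> x" if x: "x \<noteq> 0" for x
  proof -
    have "\<bar>ln (\<phi> x) - \<delta> / 2 - G (sgn x)\<bar> < \<delta> / 2"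
      using G(2)[of "sgn x"] x by (simp add: norm_sgn \<phi>_sgn)
    then have "- \<delta> + ln (\<phi> x) < G (sgn x)" "G (sgn x) < ln (\<phi> x)" unfolding abs_less_iff by linarith+
    then have "exp (- \<delta> + ln (\<phi> x)) < exp (G (sgn x))" "exp (G (sgn x)) < exp (ln (\<phi> x))" by simp_all
    then show ?thesis unfolding exp_add using pos[of x] by simp
  qed
  with G(1) show ?thesis by (rule that)
qed

section \<open>A violating test function for each larger constant\<close>

context hardy_setting
begin

text \<open>L of the witness is computed exactly as a^p M A, with M the angular factor of the gauge
  and A, B the two profile integrals. K involves \<phi> rather than \<open>Q\<close>, so its
  integrand is only bracketed, which gives M B \<le> \<kappa>^p K. The slack \<kappa> > 1 is fixed
  before \<open>Q\<close>, with \<kappa>^p a^p A < C B.\<close>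

lemma sharp_witness:
  assumes C: "C > (a / p') powr p"
  obtains u where "u \<in> test_functions \<Omega>" "KL_finite \<Omega> \<phi> p m l u" "K_fun \<Omega> \<phi> p m l u > 0"
    "L_fun \<Omega> p l u < C * K_fun \<Omega> \<phi> p m l u"
proof -
  define q where "q = 1 / p'"
  have q: "q > 0" "q * p = p - 1" using p'(1) p by (auto simp: q_def p'(2) field_simps)
  have p0: "p > 0" using p by simp
  \<comment> \<open>The factor a^p comes from the radial derivative of \<tau>; dividing it off
    leaves the one-dimensional constant (1 / p')^p.\<close>
  have "C / a powr p > q powr p"
    using C a p'(1) by (simp add: q_def powr_divide field_simps)
  then obtain \<epsilon> where \<epsilon>: "\<epsilon> > 0"
    and opt: "integral\<^sup>L lborel (hardy_profile p q \<epsilon>) < C / a powr p * integral\<^sup>L lborel (hardy_profile p 1 0)"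
    using hardy_profile_near_optimal[OF p0 q(1)] by metis
  define A B where "A = integral\<^sup>L lborel (hardy_profile p q \<epsilon>)" and "B = integral\<^sup>L lborel (hardy_profile p 1 0)"
  have A0: "A \<ge> 0" unfolding A_def by (intro integral_nonneg_AE) (simp add: hardy_profile_props(3)[OF p0])
  have B0: "B > 0" unfolding B_def by (rule integral_hardy_profile_0_pos[OF p0])
  have nA: "(\<integral>\<^sup>+z. ennreal (hardy_profile p q \<epsilon> z) \<partial>lborel) = ennreal A"
    unfolding A_def by (rule nn_integral_eq_integral[OF integrable_hardy_profile[OF p0]]) (simp add: hardy_profile_props(3)[OF p0])
  have nB: "(\<integral>\<^sup>+z. ennreal (hardy_profile p 1 0 z) \<partial>lborel) = ennreal B"
    unfolding B_def by (rule nn_integral_eq_integral[OF integrable_hardy_profile[OF p0]]) (simp add: hardy_profile_props(3)[OF p0])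
  have AB: "a powr p * A < C * B" using opt a unfolding A_def[symmetric] B_def[symmetric] by (simp add: field_simps)
  \<comment> \<open>\<open>AB\<close> is strict, so a factor slightly above 1 can be afforded; it
    pays for replacing \<phi> by \<open>Q\<close> in K.\<close>
  obtain \<kappa> where \<kappa>: "\<kappa> > 1" "\<kappa> powr p * (a powr p * A) < C * B"
  proof -
    have "((\<lambda>t. t powr p * (a powr p * A)) \<longlongrightarrow> 1 powr p * (a powr p * A)) (at_right 1)"
      by (intro tendsto_intros) auto
    then have "\<forall>\<^sub>F t in at_right 1. t powr p * (a powr p * A) < C * B"
      using AB by (intro order_tendstoD(2)) auto
    moreover have "\<forall>\<^sub>F t in at_right (1::real). t > 1" by (simp add: eventually_at_filter)
    ultimately have "\<forall>\<^sub>F t in at_right (1::real). t > 1 \<and> t powr p * (a powr p * A) < C * B"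
      by eventually_elim simp
    then show ?thesis using that eventually_happens'[OF trivial_limit_at_right_real] by blast
  qed
  \<comment> \<open>The smallest value that \<tau> can take on the support of \<open>u\<close>,
    where - \<epsilon> ln \<tau> = 2.\<close>
  define \<tau>0 where "\<tau>0 = exp (- (2 / \<epsilon>))"
  have \<tau>0: "\<tau>0 > 0" by (simp add: \<tau>0_def)
  \<comment> \<open>Chosen so that exp (a \<delta>) = 1 + (\<kappa> - 1) \<tau>0. The error made in
    \<phi>^a - |x|^a is proportional to Q^a and not to Q^a \<tau>, so it has to be small compared
    with \<tau>0.\<close>
  define \<delta> where "\<delta> = ln (1 + (\<kappa> - 1) * \<tau>0) / a"
  have l1: "1 + (\<kappa> - 1) * \<tau>0 > 1" using \<kappa>(1) \<tau>0 by simp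
  have \<delta>: "\<delta> > 0" "exp (a * \<delta>) = 1 + (\<kappa> - 1) * \<tau>0" using a l1 by (simp_all add: \<delta>_def)
  obtain G where G: "real_polynomial_function G"
    "\<And>x. x \<noteq> 0 \<Longrightarrow> exp (- \<delta>) * \<phi> x < exp (G (sgn x)) \<and> exp (G (sgn x)) < \<phi> x"
    using polynomial_gauge[OF \<delta>(1)] by metis
  define Q where "Q x = exp (G (sgn x))" for x
  have Q: "\<And>x. Q x > 0" "\<And>r x. r > 0 \<Longrightarrow> Q (r *\<^sub>R x) = Q x"
    by (simp_all add: Q_def sgn_scaleR)
  have cG: "continuous_on UNIV G" by (metis G(1) continuous_on_polymonial_function real_polynomial_function_eq)
  have cQ: "continuous_on (- {0}) Q"
    unfolding Q_def by (intro continuous_intros continuous_on_compose2[OF cG] continuous_on_sgn) auto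
  have mQ[measurable]: "Q \<in> borel_measurable borel"
    unfolding Q_def using borel_measurable_continuous_onI[OF cG] by measurable
  obtain \<rho> R where \<rho>: "0 < \<rho>" "\<rho> < R" "\<And>x. x \<noteq> 0 \<Longrightarrow> \<rho> \<le> \<phi> x \<and> \<phi> x \<le> R" using \<phi>_bounds by metis
  define Q0 where "Q0 = exp (- \<delta>) * \<rho>"
  have Q0: "Q0 > 0" using \<rho> by (simp add: Q0_def)
  have Qb: "Q0 < Q x" "Q x < \<phi> x" "\<phi> x < exp \<delta> * Q x" if "x \<noteq> 0" for x
  proof -
    have "exp (- \<delta>) * \<rho> \<le> exp (- \<delta>) * \<phi> x" using \<rho>(3)[OF that] by simp
    then show "Q0 < Q x" "Q x < \<phi> x" using G(2)[OF that] unfolding Q0_def Q_def by linarith+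
    have "exp \<delta> * (exp (- \<delta>) * \<phi> x) < exp \<delta> * Q x" using G(2)[OF that] by (simp add: Q_def)
    then show "\<phi> x < exp \<delta> * Q x" by (simp add: mult.assoc[symmetric] exp_add[symmetric])
  qed
  define \<tau> where "\<tau> x = 1 - (norm x / Q x) powr a" for x
  define S where "S = {x. x \<noteq> 0 \<and> norm x < Q x}"
  have S0: "0 \<notin> S" and S\<Omega>: "S \<subseteq> \<Omega>" using Qb(2) by (fastforce simp: S_def \<Omega>_def)+
  have oS: "open S"
  proof -
    have "open {x \<in> - {0}. norm x - Q x \<in> {..<0}}"
      by (rule continuous_open_preimage[unfolded vimage_def Int_def mem_Collect_eq]) (auto intro!: continuous_intros cQ)
    moreover have "S = {x \<in> - {0}. norm x - Q x \<in> {..<0}}" by (auto simp: S_def)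
    ultimately show ?thesis by simp
  qed
  have \<tau>: "0 < \<tau> x" "\<tau> x < 1" if "x \<in> S" for x
  proof -
    have "(norm x / Q x) powr a < 1 powr a"
      using that a Q(1)[of x] by (intro powr_less_mono2) (auto simp: S_def)
    then show "0 < \<tau> x" by (simp add: \<tau>_def)
    show "\<tau> x < 1" using that Q(1)[of x] by (simp add: \<tau>_def S_def)
  qed
  define v where "v t = exp (q * ln t) * bump (- \<epsilon> * ln t)" for t
  define u where "u x = (if x \<in> S then v (\<tau> x) else 0)" for x
  \<comment> \<open>For x in \<open>S\<close> with \<tau>(x) \<le> exp (- 1 / \<epsilon>) the norm
    of x is at least this radius, because Q > Q0 there; the support thus stays away from the
    origin.\<close>
  define \<rho>0 where "\<rho>0 = Q0 * (1 - exp (- (1 / \<epsilon>))) powr (1 / a)"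
  have e1: "exp (- (1 / \<epsilon>)) < 1" using \<epsilon> by simp
  then have e1': "1 - exp (- (1 / \<epsilon>)) > 0" by linarith
  then have \<rho>0: "\<rho>0 > 0" unfolding \<rho>0_def by (intro mult_pos_pos[OF Q0]) simp
  \<comment> \<open>Removing the ball makes closedness provable, since \<tau> is known to be
    continuous only off the origin; the bound by \<tau>0 from below keeps the set inside
    \<open>S\<close>.\<close>
  define Cs where "Cs = {x \<in> - ball 0 \<rho>0. \<tau> x \<in> {\<tau>0..exp (- (1 / \<epsilon>))}}"
  have CsS: "Cs \<subseteq> S"
  proof
    fix x assume x: "x \<in> Cs"
    then have x0: "x \<noteq> 0" using \<rho>0 by (auto simp: Cs_def)
    have "(norm x / Q x) powr a < 1" using x \<tau>0 by (auto simp: Cs_def \<tau>_def)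
    have "\<not> norm x \<ge> Q x"
    proof
      assume "norm x \<ge> Q x"
      then have "1 powr a \<le> (norm x / Q x) powr a" using Q(1)[of x] a by (intro powr_mono2) auto
      then show False using \<open>(norm x / Q x) powr a < 1\<close> by simp
    qed
    then show "x \<in> S" using x0 by (simp add: S_def)
  qed
  have cCs: "compact Cs"
    unfolding compact_eq_bounded_closed
  proof
    show "bounded Cs" using bounded_subset[OF bounded_\<Omega>] CsS S\<Omega> by blast
    have "continuous_on (- ball 0 \<rho>0) \<tau>"
      unfolding \<tau>_def using \<rho>0 Q(1) a
      by (intro continuous_intros continuous_on_powr' continuous_on_subset[OF cQ]) (auto simp: less_imp_neq[symmetric] less_imp_le)
    then show "closed Cs" unfolding Cs_def
      using continuous_closed_preimage[of "- ball 0 \<rho>0" \<tau> "{\<tau>0..exp (- (1 / \<epsilon>))}"]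
      by (simp add: vimage_def Int_def closed_Compl)
  qed
  have bumpCs: "x \<in> Cs" if x: "x \<in> S" and b: "- \<epsilon> * ln (\<tau> x) \<in> {1..2}" for x
  proof -
    have "ln (\<tau> x) \<le> - (1 / \<epsilon>)" "- (2 / \<epsilon>) \<le> ln (\<tau> x)" using b \<epsilon> by (auto simp: field_simps)
    then have t: "\<tau> x \<le> exp (- (1 / \<epsilon>))" "\<tau>0 \<le> \<tau> x"
      using \<tau>[OF x] unfolding \<tau>0_def by (metis exp_le_cancel_iff exp_ln)+
    have "1 - exp (- (1 / \<epsilon>)) \<le> (norm x / Q x) powr a" using t(1) by (simp add: \<tau>_def)
    then have "(1 - exp (- (1 / \<epsilon>))) powr (1 / a) \<le> ((norm x / Q x) powr a) powr (1 / a)"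
      using e1' a by (intro powr_mono2) auto
    also have "\<dots> = norm x / Q x" using a Q(1)[of x] by (simp add: powr_powr)
    finally have "Q x * (1 - exp (- (1 / \<epsilon>))) powr (1 / a) \<le> norm x" using Q(1)[of x] by (simp add: field_simps)
    moreover have "Q0 * (1 - exp (- (1 / \<epsilon>))) powr (1 / a) \<le> Q x * (1 - exp (- (1 / \<epsilon>))) powr (1 / a)"
      using Qb(1)[of x] x by (intro mult_right_mono) (auto simp: S_def)
    ultimately have "\<rho>0 \<le> norm x" by (simp add: \<rho>0_def)
    then show ?thesis using t by (simp add: Cs_def)
  qed
  have u0: "u x = 0" if "x \<notin> Cs" for x
  proof (cases "x \<in> S")
    case True
    then have "- \<epsilon> * ln (\<tau> x) \<notin> {1..2}" using bumpCs that by blast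
    then have "bump (- \<epsilon> * ln (\<tau> x)) = 0" by (intro bump_bounds(4)) auto
    then show ?thesis by (simp add: u_def v_def)
  qed (simp add: u_def)
  have ut: "u \<in> test_functions \<Omega>"
  proof -
    obtain g where g: "g \<in> smooth_terms S" "\<And>x. x \<in> S \<Longrightarrow> G (sgn x) = g x"
      using polynomial_sgn_smooth[OF S0 G(1)] by blast
    let ?N = "\<lambda>x::'a. ln (\<Sum>b\<in>Basis. (x \<bullet> b) * (x \<bullet> b)) / 2"
    define s where "s x = 1 - exp (a * (?N x - g x))" for x
    have s: "s x = \<tau> x" if "x \<in> S" for x
    proof -
      have "norm x > 0" using that S0 by auto
      then have "norm x / Q x = exp (?N x - g x)"
        unfolding ln_norm_smooth(2)[OF S0 that, symmetric] g(2)[OF that, symmetric] Q_def by (simp add: exp_diff)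
      then show ?thesis by (simp add: s_def \<tau>_def powr_def)
    qed
    have ss: "s \<in> smooth_terms S"
      unfolding s_def[abs_def]
      by (intro smooth_terms_diff smooth_terms_exp smooth_terms.mult smooth_terms.const ln_norm_smooth(1)[OF S0] g(1))
    have ls: "(\<lambda>x. ln (s x)) \<in> smooth_terms S" by (rule smooth_terms.ln[OF ss]) (simp add: s \<tau>)
    have "(\<lambda>x. exp (q * ln (s x)) * (flat 0 (- \<epsilon> * ln (s x) - 1) * flat 0 (2 - - \<epsilon> * ln (s x)))) \<in> smooth_terms S"
      by (intro smooth_terms.mult smooth_terms_exp smooth_terms_flat smooth_terms_diff smooth_terms.const ls)
    then show ?thesis
      by (rule test_functions_smooth_terms[OF oS cCs CsS, rotated])
         (use CsS S\<Omega> s u0 in \<open>auto simp: u_def v_def bump_def\<close>)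
  qed
  have mS[measurable]: "S \<in> sets borel" using oS by simp
  have mu[measurable]: "u \<in> borel_measurable borel"
    by (rule borel_measurable_continuous_onI[OF test_functionsD(2)[OF ut]])
  \<comment> \<open>Differentiating u (s x) in s at s = 1 suffices: \<open>Q\<close> is constant
    along the ray, so \<tau>(s x) = 1 - s^a c^a with c = norm x / Q x.\<close>
  have radial: "x \<bullet> grad u x = - a * (norm x / Q x) powr a * (1 / \<tau> x) * exp (q * ln (\<tau> x)) * (q * bump (- \<epsilon> * ln (\<tau> x)) - \<epsilon> * bump' (- \<epsilon> * ln (\<tau> x)))"
    if x: "x \<in> S" for x
  proof -
    define c where "c = norm x / Q x"
    have c: "c > 0" "c < 1" using x Q(1)[of x] by (auto simp: c_def S_def)
    have c\<tau>: "\<tau> x = 1 - c powr a" by (simp add: \<tau>_def c_def)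
    have dv: "(v has_real_derivative (1 / t) * exp (q * ln t) * (q * bump (- \<epsilon> * ln t) - \<epsilon> * bump' (- \<epsilon> * ln t))) (at t)" if "t > 0" for t
      unfolding v_def[abs_def] using that
      by (auto intro!: derivative_eq_intros DERIV_chain2[OF DERIV_bump] simp: algebra_simps)
    have "((\<lambda>s. u (s *\<^sub>R x)) has_real_derivative x \<bullet> grad u (1 *\<^sub>R x)) (at 1)"
      by (rule GDERIV_ray[OF test_functionsD(1)[OF ut]])
    moreover have "((\<lambda>s. u (s *\<^sub>R x)) has_real_derivative
        (1 / \<tau> x) * exp (q * ln (\<tau> x)) * (q * bump (- \<epsilon> * ln (\<tau> x)) - \<epsilon> * bump' (- \<epsilon> * ln (\<tau> x))) * (- (a * c powr a))) (at 1)"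
    proof -
      have "((\<lambda>s. 1 - s powr a * c powr a) has_real_derivative - (a * c powr a)) (at 1)"
        by (auto intro!: derivative_eq_intros)
      moreover have "(v has_real_derivative (1 / \<tau> x) * exp (q * ln (\<tau> x)) * (q * bump (- \<epsilon> * ln (\<tau> x)) - \<epsilon> * bump' (- \<epsilon> * ln (\<tau> x)))) (at (1 - 1 powr a * c powr a))"
        using dv[OF \<tau>(1)[OF x]] by (simp add: c\<tau>)
      ultimately have "((\<lambda>s. v (1 - s powr a * c powr a)) has_real_derivative
        (1 / \<tau> x) * exp (q * ln (\<tau> x)) * (q * bump (- \<epsilon> * ln (\<tau> x)) - \<epsilon> * bump' (- \<epsilon> * ln (\<tau> x))) * (- (a * c powr a))) (at 1)"
        by (rule DERIV_chain2[rotated])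
      then show ?thesis
      proof (rule has_field_derivative_transform_within_open[of _ _ _ "{0<..<1 / c}"])
        fix s assume s: "s \<in> {0<..<1 / c}"
        have "s *\<^sub>R x \<in> S" using s x c Q(1)[of x] by (auto simp: S_def Q(2) c_def field_simps)
        moreover have "\<tau> (s *\<^sub>R x) = 1 - s powr a * c powr a"
          using s c by (simp add: \<tau>_def Q(2) c_def powr_mult[symmetric])
        ultimately show "v (1 - s powr a * c powr a) = u (s *\<^sub>R x)" by (simp add: u_def)
      qed (use c in auto)
    qed
    ultimately have "x \<bullet> grad u (1 *\<^sub>R x) = (1 / \<tau> x) * exp (q * ln (\<tau> x)) * (q * bump (- \<epsilon> * ln (\<tau> x)) - \<epsilon> * bump' (- \<epsilon> * ln (\<tau> x))) * (- (a * c powr a))"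
      by (rule DERIV_unique)
    then show ?thesis by (simp add: c_def)
  qed
  have rad0: "grad u x = 0" if "x \<notin> S" for x
  proof (rule grad_eqI, rule GDERIV_local[OF GDERIV_const[of 0], of "- Cs"])
    show "open (- Cs)" using cCs by (simp add: compact_imp_closed open_Compl)
  qed (use that CsS u0 in auto)
  \<comment> \<open>The common form of both integrands: the weight |x|^(a - n) Q^(- a p) / \<tau>
    times a profile evaluated at - \<epsilon> ln \<tau>. This is the shape of
    \<open>nn_integral_gauge_substitution\<close> with b = - a p.\<close>
  define E where "E F x = indicator S x * (norm x powr (a - real DIM('a)) * Q x powr (- (a * p)) *
      (1 / (1 - (norm x / Q x) powr a)) * F (- \<epsilon> * ln (1 - (norm x / Q x) powr a)))" for F :: "real \<Rightarrow> real" and x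
  have Eeq: "E F x = norm x powr (a - real DIM('a)) * Q x powr (- (a * p)) * (1 / \<tau> x) * F (- \<epsilon> * ln (\<tau> x))" if "x \<in> S" for F x
    using that by (simp add: E_def \<tau>_def)
  define M0 where "M0 = ennreal (real DIM('a)) * (\<integral>\<^sup>+x. indicator (ball 0 1) x * ennreal (Q x powr (a + - (a * p)) / (a * \<epsilon>)) \<partial>(lborel :: 'a measure))"
  have E: "(\<integral>\<^sup>+x. ennreal (E F x) \<partial>lborel) = M0 * (\<integral>\<^sup>+z. ennreal (F z) \<partial>lborel)"
    if "F \<in> borel_measurable borel" "\<And>z. F z \<ge> 0" "\<And>z. z \<notin> {1..2} \<Longrightarrow> F z = 0" for F
    unfolding E_def S_def M0_def by (rule nn_integral_gauge_substitution[OF a \<epsilon> that(1) mQ that(2,3) Q])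
  \<comment> \<open>The exponent a - a p is negative, so it is the lower bound \<open>Q0\<close> of
    the gauge that makes the angular factor finite.\<close>
  obtain M where M: "M0 = ennreal M" "M > 0"
  proof -
    define c where "c = a + - (a * p)"
    have c: "c \<le> 0" using a p by (simp add: c_def)
    have "M0 \<le> ennreal (real DIM('a)) * (\<integral>\<^sup>+x. ennreal (Q0 powr c / (a * \<epsilon>)) * indicator (ball 0 1) x \<partial>(lborel :: 'a measure))"
      unfolding M0_def c_def[symmetric]
    proof (intro mult_left_mono nn_integral_mono_AE, use AE_lborel_singleton[of 0] in eventually_elim)
      fix x :: 'a assume x: "x \<noteq> 0"
      have "Q x powr c \<le> Q0 powr c" using Qb(1)[OF x] Q0 c by (intro powr_mono2') auto
      then show "indicator (ball 0 1) x * ennreal (Q x powr c / (a * \<epsilon>)) \<le> ennreal (Q0 powr c / (a * \<epsilon>)) * indicator (ball 0 1) x"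
        using a \<epsilon> by (auto simp: indicator_def intro!: ennreal_leI divide_right_mono)
    qed auto
    also have "\<dots> < \<infinity>"
      using emeasure_lborel_ball_finite[of "0::'a" 1]
      by (subst nn_integral_cmult) (auto simp: ennreal_mult_less_top)
    finally have fin: "M0 < \<infinity>" .
    have "M0 \<noteq> 0"
    proof
      assume "M0 = 0"
      then have "AE x in lborel. indicator (ball 0 1) (x::'a) * ennreal (Q x powr c / (a * \<epsilon>)) = 0"
        unfolding M0_def c_def[symmetric] by (subst nn_integral_0_iff_AE[symmetric]) auto
      then have "AE x in lborel. x \<notin> ball (0::'a) 1"
      proof eventually_elim
        case (elim x)
        have "Q x powr c / (a * \<epsilon>) > 0" using Q(1)[of x] a \<epsilon> by simp
        then show ?case using elim by (auto simp: indicator_def)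
      qed
      then have "emeasure lborel (ball (0::'a) 1) = 0"
        by (subst (asm) AE_iff_measurable[OF _ refl]) (auto simp: ball_def)
      then show False using unit_ball_vol_pos[of "real DIM('a)"] by (simp add: emeasure_ball)
    qed
    then show ?thesis using fin that by (cases M0) (auto simp: less_le)
  qed
  have LE: "AE x in lborel. indicator \<Omega> x * L_integrand \<Omega> p l u x = a powr p * E (hardy_profile p q \<epsilon>) x"
    using weak_grad_AE_eq(1)[OF open_\<Omega> is_weak_gradient_test_function[OF ut]]
  proof eventually_elim
    case (elim x)
    show ?case
    proof (cases "x \<in> S")
      case True
      define r where "r = norm x"
      define H where "H = hardy_profile p q \<epsilon> (- \<epsilon> * ln (\<tau> x))"
      have r: "r > 0" using True S0 by (auto simp: r_def)
      have t: "\<tau> x > 0" using \<tau>[OF True] by simp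
      have \<Omega>: "x \<in> \<Omega>" using True S\<Omega> by blast
      then have wg: "weak_grad \<Omega> u x = grad u x" using elim by simp
      have "\<bar>x \<bullet> weak_grad \<Omega> u x / r\<bar> powr p = a powr p * (r / Q x) powr (a * p) * \<tau> x powr (- p) * \<tau> x powr (q * p) * H / r powr p"
      proof -
        have "exp (q * ln (\<tau> x)) = \<tau> x powr q" using t by (simp add: powr_def)
        then show ?thesis
          using r t a Q(1)[of x] unfolding wg radial[OF True] H_def hardy_profile_def
          by (simp add: r_def abs_mult powr_mult powr_divide powr_powr powr_minus_divide mult_ac)
      qed
      also have "\<dots> = a powr p * (r powr (a * p) * Q x powr (- (a * p)) * (\<tau> x powr (- p) * \<tau> x powr (q * p)) * H / r powr p)"
        using Q(1)[of x] r by (simp add: powr_divide powr_minus_divide)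
      \<comment> \<open>Here the power 1 / p' pays off: q p = p - 1 leaves exactly 1 / \<tau>, the
        weight that the logarithmic substitution absorbs.\<close>
      also have "\<tau> x powr (- p) * \<tau> x powr (q * p) = 1 / \<tau> x"
        using t by (simp add: powr_add[symmetric] q(2) powr_neg_one)
      finally have "L_integrand \<Omega> p l u x = r powr (a * (1 - p) + p - real DIM('a)) * (a powr p * (r powr (a * p) * Q x powr (- (a * p)) * (1 / \<tau> x) * H / r powr p))"
        by (simp add: L_integrand_def r_def[symmetric] weight_exponent)
      also have "\<dots> = a powr p * ((r powr (a * (1 - p) + p - real DIM('a)) * r powr (a * p) / r powr p) * Q x powr (- (a * p)) * (1 / \<tau> x) * H)"
        by (simp add: mult_ac)
      also have "r powr (a * (1 - p) + p - real DIM('a)) * r powr (a * p) / r powr p = r powr (a - real DIM('a))"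
        using r by (simp add: powr_add[symmetric] powr_diff[symmetric] algebra_simps)
      finally show ?thesis using \<Omega> by (simp add: Eeq[OF True] H_def r_def)
    next
      case False
      then have "indicator \<Omega> x * L_integrand \<Omega> p l u x = 0"
        using elim rad0[OF False] by (auto simp: L_integrand_def indicator_def)
      then show ?thesis using False by (simp add: E_def)
    qed
  qed
  \<comment> \<open>Q < \<phi> gives Q^a \<tau> \<le> \<phi>^a - |x|^a and with it the upper bound
    on the integrand of K. The other bound comes from \<phi> < exp (\<delta>) Q and matters only
    where the profile is nonzero, so that \<tau> \<ge> \<tau>0 may be used.\<close>
  have KE: "E (hardy_profile p 1 0) x \<le> \<kappa> powr p * (indicator \<Omega> x * K_integrand \<phi> p m l u x) \<and>
      indicator \<Omega> x * K_integrand \<phi> p m l u x \<le> E (hardy_profile p 1 0) x" for x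
  proof (cases "x \<in> S")
    case True
    define r where "r = norm x"
    define H where "H = hardy_profile p 1 0 (- \<epsilon> * ln (\<tau> x))"
    have H0: "H \<ge> 0" by (simp add: H_def hardy_profile_props(3)[OF p0])
    have x0: "x \<noteq> 0" using True S0 by auto
    have r: "r > 0" using x0 by (auto simp: r_def)
    have t: "\<tau> x > 0" using \<tau>[OF True] by simp
    have \<Omega>: "x \<in> \<Omega>" using True S\<Omega> by blast
    define \<Delta> where "\<Delta> = \<phi> x powr a - r powr a"
    have \<Delta>: "\<Delta> > 0" using powr_less_\<phi>[OF \<Omega>] by (simp add: \<Delta>_def r_def)
    have Qt: "Q x powr a * \<tau> x = Q x powr a - r powr a"
      using r Q(1)[of x] by (simp add: \<tau>_def r_def powr_divide field_simps)
    have up: "\<bar>u x\<bar> powr p = \<tau> x powr (p - 1) * H"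
    proof -
      have "u x = \<tau> x powr q * bump (- \<epsilon> * ln (\<tau> x))" using True t by (simp add: u_def v_def powr_def)
      then show ?thesis using t q(2) by (simp add: H_def hardy_profile_def abs_mult powr_mult powr_powr)
    qed
    have K: "K_integrand \<phi> p m l u x = r powr (a - real DIM('a)) * (\<tau> x powr (p - 1) * H) / \<Delta> powr p"
    proof -
      have "1 / r powr (real DIM('a) - a) = r powr (a - real DIM('a))"
        using r by (simp add: powr_minus_divide[symmetric])
      moreover have "K_integrand \<phi> p m l u x = 1 / r powr (real DIM('a) - a) * (\<tau> x powr (p - 1) * H) / \<Delta> powr p"
        unfolding K_integrand_def up using \<Delta> by (simp add: r_def[symmetric] a_def[symmetric] \<Delta>_def[symmetric] diff_diff_add)
      ultimately show ?thesis by simp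
    qed
    have EH: "E (hardy_profile p 1 0) x = r powr (a - real DIM('a)) * (\<tau> x powr (p - 1) * H) / (Q x powr a * \<tau> x) powr p"
    proof -
      have "\<tau> x powr (p - 1) / \<tau> x powr p = 1 / \<tau> x" using t by (simp add: powr_diff)
      moreover have "r powr (a - real DIM('a)) * (\<tau> x powr (p - 1) * H) / (Q x powr a * \<tau> x) powr p =
         r powr (a - real DIM('a)) * Q x powr (- (a * p)) * (\<tau> x powr (p - 1) / \<tau> x powr p) * H"
        using t Q(1)[of x] by (simp add: powr_mult powr_powr powr_minus_divide)
      ultimately show ?thesis unfolding Eeq[OF True] by (simp add: r_def H_def)
    qed
    have num: "r powr (a - real DIM('a)) * (\<tau> x powr (p - 1) * H) \<ge> 0" using H0 by simp
    have low: "Q x powr a * \<tau> x \<le> \<Delta>"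
    proof -
      have "Q x powr a \<le> \<phi> x powr a" using Qb(2)[OF x0] Q(1)[of x] a by (intro powr_mono2) auto
      then show ?thesis by (simp add: Qt \<Delta>_def)
    qed
    have 2: "K_integrand \<phi> p m l u x \<le> E (hardy_profile p 1 0) x"
      unfolding K EH using low t Q(1)[of x] p0 \<Delta> num
      by (intro divide_left_mono powr_mono2) (auto intro!: mult_pos_pos)
    have 1: "E (hardy_profile p 1 0) x \<le> \<kappa> powr p * K_integrand \<phi> p m l u x"
    proof (cases "H = 0")
      case True
      then show ?thesis by (simp add: EH K)
    next
      case False
      then have "- \<epsilon> * ln (\<tau> x) \<in> {1..2}"
        using hardy_profile_props(4)[OF p0, of "- \<epsilon> * ln (\<tau> x)" 1 0] unfolding H_def by fastforce
      then have "\<tau>0 \<le> \<tau> x" using bumpCs[OF True] by (simp add: Cs_def)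
      have "\<phi> x powr a \<le> (exp \<delta> * Q x) powr a" using Qb(3)[OF x0] pos[of x] a by (intro powr_mono2) auto
      also have "\<dots> = (1 + (\<kappa> - 1) * \<tau>0) * Q x powr a"
        using Q(1)[of x] by (simp add: powr_mult exp_powr_real mult.commute[of \<delta>] \<delta>(2))
      also have "\<dots> \<le> (1 + (\<kappa> - 1) * \<tau> x) * Q x powr a"
        using \<kappa>(1) \<open>\<tau>0 \<le> \<tau> x\<close> by (intro mult_right_mono add_left_mono mult_left_mono) auto
      finally have "\<Delta> \<le> (1 + (\<kappa> - 1) * \<tau> x) * Q x powr a - r powr a" by (simp add: \<Delta>_def)
      \<comment> \<open>Q^a - r^a is Q^a \<tau>, and the excess (\<kappa> - 1) \<tau> Q^a completes
        it to \<kappa> Q^a \<tau>; \<delta> was chosen for this.\<close>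
      also have "\<dots> = \<kappa> * (Q x powr a * \<tau> x)" using Qt by (simp add: algebra_simps)
      finally have "\<Delta> powr p \<le> (\<kappa> * (Q x powr a * \<tau> x)) powr p" using \<Delta> p0 by (intro powr_mono2) auto
      also have "\<dots> = \<kappa> powr p * (Q x powr a * \<tau> x) powr p" using \<kappa>(1) t Q(1)[of x] by (simp add: powr_mult)
      finally have "\<Delta> powr p / (Q x powr a * \<tau> x) powr p \<le> \<kappa> powr p"
        using t Q(1)[of x] by (simp add: pos_divide_le_eq)
      then have "(r powr (a - real DIM('a)) * (\<tau> x powr (p - 1) * H) / \<Delta> powr p) * (\<Delta> powr p / (Q x powr a * \<tau> x) powr p)
        \<le> (r powr (a - real DIM('a)) * (\<tau> x powr (p - 1) * H) / \<Delta> powr p) * \<kappa> powr p"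
        using num \<Delta> by (intro mult_left_mono) auto
      then show ?thesis unfolding K EH using \<Delta> by (simp add: mult.commute)
    qed
    show ?thesis using 1 2 \<Omega> by simp
  next
    case False
    then have "u x = 0" by (simp add: u_def)
    then show ?thesis using False p0 by (simp add: E_def K_integrand_def)
  qed
  have K0: "0 \<le> indicator \<Omega> x * K_integrand \<phi> p m l u x" for x by (simp add: K_integrand_def)
  have Enn: "(\<integral>\<^sup>+x. ennreal (E (hardy_profile p 1 0) x) \<partial>lborel) = ennreal (M * B)"
    "(\<integral>\<^sup>+x. ennreal (E (hardy_profile p q \<epsilon>) x) \<partial>lborel) = ennreal (M * A)"
  proof -
    have "hardy_profile p q' \<epsilon>' z = 0" if "z \<notin> {1..2}" for q' \<epsilon>' z
      using that by (intro hardy_profile_props(4)[OF p0]) auto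
    note * = E[OF hardy_profile_props(2,3)[OF p0] this]
    show "(\<integral>\<^sup>+x. ennreal (E (hardy_profile p 1 0) x) \<partial>lborel) = ennreal (M * B)"
      "(\<integral>\<^sup>+x. ennreal (E (hardy_profile p q \<epsilon>) x) \<partial>lborel) = ennreal (M * A)"
      using *[of 1 0] *[of q \<epsilon>] M A0 B0 unfolding nA nB by (simp_all add: ennreal_mult)
  qed
  have Epos: "0 \<le> E (hardy_profile p q' \<epsilon>') x" for q' \<epsilon>' x
    using \<tau>[of x] hardy_profile_props(3)[OF p0] by (cases "x \<in> S") (auto simp: E_def \<tau>_def)
  have mE[measurable]: "E (hardy_profile p q' \<epsilon>') \<in> borel_measurable borel" for q' \<epsilon>'
    unfolding E_def using hardy_profile_props(2)[OF p0] by measurable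
  have hL: "has_bochner_integral lborel (\<lambda>x. indicator \<Omega> x * L_integrand \<Omega> p l u x) (a powr p * (M * A))"
  proof -
    have "has_bochner_integral lborel (E (hardy_profile p q \<epsilon>)) (M * A)"
      by (rule has_bochner_integral_nn_integral) (use Epos Enn M A0 in auto)
    then have "has_bochner_integral lborel (\<lambda>x. a powr p * E (hardy_profile p q \<epsilon>) x) (a powr p * (M * A))"
      by (intro has_bochner_integral_mult_right) auto
    then show ?thesis
      by (subst has_bochner_integral_cong_AE[OF _ _ LE])
         (use measurable_L_integrand[OF is_weak_gradient_test_function[OF ut]] in auto)
  qed
  have hE: "has_bochner_integral lborel (E (hardy_profile p 1 0)) (M * B)"
    by (rule has_bochner_integral_nn_integral) (use Epos Enn M B0 in auto)
  have iK: "integrable lborel (\<lambda>x. indicator \<Omega> x * K_integrand \<phi> p m l u x)"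
    by (rule Bochner_Integration.integrable_bound[OF integrable.intros[OF hE]])
       (use KE K0 Epos in auto)
  have "M * B = (LINT x|lborel. E (hardy_profile p 1 0) x)"
    using hE by (simp add: has_bochner_integral_iff)
  also have "\<dots> \<le> (LINT x|lborel. \<kappa> powr p * (indicator \<Omega> x * K_integrand \<phi> p m l u x))"
    using hE iK KE by (intro integral_mono) (auto simp: has_bochner_integral_iff)
  also have "\<dots> = \<kappa> powr p * K_fun \<Omega> \<phi> p m l u" by (simp add: K_fun_def set_lebesgue_integral_def)
  finally have KB: "M * B \<le> \<kappa> powr p * K_fun \<Omega> \<phi> p m l u" .
  have Lf: "L_fun \<Omega> p l u = a powr p * (M * A)"
    using hL by (simp add: L_fun_def set_lebesgue_integral_def has_bochner_integral_iff)
  have lp: "\<kappa> powr p > 0" using \<kappa>(1) by simp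
  have C0: "C > 0" using C powr_ge_zero[of "a / p'" p] by linarith
  have "\<kappa> powr p * L_fun \<Omega> p l u = M * (\<kappa> powr p * (a powr p * A))" by (simp add: Lf)
  also have "\<dots> < M * (C * B)" using \<kappa>(2) M(2) by (rule mult_strict_left_mono)
  also have "\<dots> \<le> \<kappa> powr p * (C * K_fun \<Omega> \<phi> p m l u)"
    using mult_left_mono[OF KB, of C] C0 by (simp add: mult_ac)
  finally have "L_fun \<Omega> p l u < C * K_fun \<Omega> \<phi> p m l u" using lp by simp
  moreover have "K_fun \<Omega> \<phi> p m l u > 0"
  proof -
    have "0 < \<kappa> powr p * K_fun \<Omega> \<phi> p m l u" using KB M(2) B0 mult_pos_pos[of M B] by linarith
    then show ?thesis using lp by (simp add: zero_less_mult_iff)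
  qed
  moreover have "KL_finite \<Omega> \<phi> p m l u"
    using iK hL by (auto simp: KL_finite_def set_integrable_def has_bochner_integral_iff)
  ultimately show ?thesis using ut that by blast
qed

end

theorem theorem5p2:
  fixes \<phi> :: "'a::euclidean_space \<Rightarrow> real"
    and \<Omega> :: "'a set"
    and p p' m l :: real
  assumes "DIM('a) \<ge> 2"
    and "p > 1"
    and "1 / p + 1 / p' = 1"
    and "m = (p - real DIM('a)) / (p - 1)"
    and "- m < l" and "l \<le> 1 - m"
    and "homogeneous0 \<phi>" and "\<forall>x. \<phi> x > 0"
    and "\<Omega> = {x. norm x < \<phi> x}"
    and "open \<Omega>" and "connected \<Omega>" and "bounded \<Omega>"
    and "\<exists>\<rho>>0. star_shaped_wrt_ball \<Omega> (ball 0 \<rho>)"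
  shows
    "(\<forall>k \<Phi>. k > 1 / p' \<and> homogeneous0 \<Phi> \<and> \<not> (AE x in sphere_measure 1. \<Phi> x = 0) \<and>
        admissible \<Omega> \<phi> p m l k \<Phi> \<longrightarrow>
        KL_finite \<Omega> \<phi> p m l (u_ext \<phi> m l k \<Phi>) \<and>
        K_fun \<Omega> \<phi> p m l (u_ext \<phi> m l k \<Phi>) > 0 \<and>
        sphere_limsup \<phi> p m l (u_ext \<phi> m l k \<Phi>) < \<infinity> \<and>
        lhsA \<Omega> p l (u_ext \<phi> m l k \<Phi>) =
          rhsA (((m + l) / p') powr p) \<Omega> \<phi> p p' m l (u_ext \<phi> m l k \<Phi>)) \<and>
     (\<forall>C > ((m + l) / p') powr p.
        \<exists>u \<in> W0 p (\<lambda>x. norm x powr (l * (1 - p))) \<Omega>.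
          KL_finite \<Omega> \<phi> p m l u \<and> \<not> ineqB C \<Omega> \<phi> p m l u) \<and>
     (\<forall>C > ((m + l) / p') powr p.
        \<exists>u \<in> W0 p (\<lambda>x. norm x powr (l * (1 - p))) \<Omega>.
          KL_finite \<Omega> \<phi> p m l u \<and> K_fun \<Omega> \<phi> p m l u > 0 \<and> \<not> ineqA C \<Omega> \<phi> p p' m l u)"
proof (intro conjI allI impI)
  define a where "a = m + l"
  interpret hardy_setting \<phi> \<Omega> p p' m l a
  proof
    show "star_shaped_at \<Omega> 0" using assms(13) by (auto simp: star_shaped_wrt_ball_def)
  qed (use assms in \<open>auto simp: a_def\<close>)
  have ml: "m + l = a" by (simp add: a_def)
  show "KL_finite \<Omega> \<phi> p m l (u_ext \<phi> m l k \<Phi>)"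
    "0 < K_fun \<Omega> \<phi> p m l (u_ext \<phi> m l k \<Phi>)"
    "sphere_limsup \<phi> p m l (u_ext \<phi> m l k \<Phi>) < \<infinity>"
    "lhsA \<Omega> p l (u_ext \<phi> m l k \<Phi>) = rhsA (((m + l) / p') powr p) \<Omega> \<phi> p p' m l (u_ext \<phi> m l k \<Phi>)"
    if "1 / p' < k \<and> homogeneous0 \<Phi> \<and> \<not> (AE x in sphere_measure 1. \<Phi> x = 0) \<and> admissible \<Omega> \<phi> p m l k \<Phi>"
    for k \<Phi>
    unfolding ml using u_ext_equality[of k \<Phi>] that by blast+
  fix C :: real
  assume C: "((m + l) / p') powr p < C"
  obtain u where u: "u \<in> test_functions \<Omega>" "KL_finite \<Omega> \<phi> p m l u" "K_fun \<Omega> \<phi> p m l u > 0"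
    "L_fun \<Omega> p l u < C * K_fun \<Omega> \<phi> p m l u"
    using sharp_witness[OF C[unfolded ml]] by metis
  have W0: "u \<in> W0 p (\<lambda>x. norm x powr (l * (1 - p))) \<Omega>"
    by (rule test_functions_W0[OF open_\<Omega> u(1)])
  show "\<exists>u\<in>W0 p (\<lambda>x. norm x powr (l * (1 - p))) \<Omega>. KL_finite \<Omega> \<phi> p m l u \<and> \<not> ineqB C \<Omega> \<phi> p m l u"
    using W0 u by (intro bexI[of _ u]) (auto simp: ineqB_def)
  \<comment> \<open>The violation of (B) survives taking p-th roots. The remaining term of
    \<open>rhsA\<close> lives in \<open>ereal\<close> and might be infinite, so only its sign is
    used.\<close>
  have "\<not> ineqA C \<Omega> \<phi> p p' m l u"
  proof -
    have "0 \<le> L_fun \<Omega> p l u"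
      unfolding L_fun_def set_lebesgue_integral_def L_integrand_def by (intro integral_nonneg_AE) auto
    moreover have "0 \<le> C" using C powr_ge_zero[of "(m + l) / p'" p] by linarith
    ultimately have "L_fun \<Omega> p l u powr (1 / p) < C powr (1 / p) * K_fun \<Omega> \<phi> p m l u powr (1 / p)"
      using u(3,4) p powr_less_mono2[of "1 / p" "L_fun \<Omega> p l u" "C * K_fun \<Omega> \<phi> p m l u"] by (simp add: powr_mult)
    then have "lhsA \<Omega> p l u < ereal (C powr (1 / p) * K_fun \<Omega> \<phi> p m l u powr (1 / p))"
      by (simp add: lhsA_def)
    also have "\<dots> \<le> rhsA C \<Omega> \<phi> p p' m l u"
      unfolding rhsA_def using p by (intro ereal_le_add_self ereal_0_le_mult) (auto simp: ereal_0_le_mult)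
    finally show ?thesis by (simp add: ineqA_def not_le)
  qed
  then show "\<exists>u\<in>W0 p (\<lambda>x. norm x powr (l * (1 - p))) \<Omega>. KL_finite \<Omega> \<phi> p m l u \<and> 0 < K_fun \<Omega> \<phi> p m l u \<and> \<not> ineqA C \<Omega> \<phi> p p' m l u"
    using W0 u by (intro bexI[of _ u]) auto
qed

end
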